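(* Let $\Phi$ be a unital commutative associative ring containing $1/2$. Any octonion algebra over $\Phi$, say $(\Phi,\mu_1,\mu_2,\mu_3)$ for cancellable scalars $\mu_1,\mu_2,\mu_3$ of $\Phi$, is isomorphic to $\Phi_C[t_1,t_2,t_3]/(t_1^2-\mu_1,\,t_2^2-\mu_2,\,t_3^2-\mu_3)$, the quotient of the ring of Cayley polynomials by the ideal generated by $t_i^2-\mu_i$, $i=1,2,3$. Hence $(\Phi,\mu_1,\mu_2,\mu_3)$ has the following presentation in the category of alternative algebras over $\Phi$: generators $t_1,t_2,t_3$ with the Cayley relations $t_2t_1=-t_1t_2$, $t_3t_1=-t_1t_3$, $t_3t_2=-t_2t_3$, $(t_1t_2)t_3=-t_1(t_2t_3)$, and $t_1^2=\mu_1$, $t_2^2=\mu_2$, $t_3^2=\mu_3$. In particular, if $\Phi$ is a field and $A$ is a nonzero alternative algebra over $\Phi$ generated by $a_1,a_2,a_3$ which satisfy $a_1^2=\mu_1$, $a_2^2=\mu_2$, $a_3^2=\mu_3$ and the Cayley relations $a_1a_2=-a_2a_1$, $a_1a_3=-a_3a_1$, $a_2a_3=-a_3a_2$ and $(a_1a_2)a_3=-a_1(a_2a_3)$, then $A$ is isomorphic to $(\Phi,\mu_1,\mu_2,\mu_3)$.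
   Context: All algebras are unital. With $(a,b,c)=(ab)c-a(bc)$, an algebra is alternative if $(a,a,b)=0=(b,a,a)$ for all $a,b$. Cayley-Dickson process. Let $k$ be a unital commutative associative ring containing $1/2$, $B$ a faithful unital $k$-algebra (i.e. $\alpha 1=0$ implies $\alpha=0$ for $\alpha\in k$) with a scalar involution $*$ (an anti-automorphism of period 2 with $bb^*\in k1$ for all $b$), and let $\mu\in k$ be a cancellable scalar (i.e. $\mu b=0$ implies $b=0$ for $b\in B$). Then $(B,\mu)$ is the algebra $B\oplus vB$ with product $(a+vb)(c+vd)=(ac+\mu db^* )+v(a^*d+cb)$ and new involution $(a+vb)^*=a^*-vb$; $v$ is called the basic generator and $v^2=\mu$. Iterating three times starting from $k$ with the trivial involution, with cancellable $\mu_1,\mu_2,\mu_3\in k$, gives the octonion algebra $(k,\mu_1,\mu_2,\mu_3)$ over $k$. (Cancellable scalars of $k$: $\mu\alpha=0$ implies $\alpha=0$ for $\alpha\in k$.) The ring of Cayley polynomials $\Phi_C[t_1,t_2,t_3]$ is the alternative algebra over $\Phi$ presented, in the category of (unital) alternative algebras, by generators $t_1,t_2,t_3$ and the Cayley relations $t_2t_1=-t_1t_2$, $t_3t_1=-t_1t_3$, $t_3t_2=-t_2t_3$, $(t_1t_2)t_3=-t_1(t_2t_3)$. *)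

theory Defs
  imports "HOL-Algebra.Module" "HOL-Algebra.QuotRing"
begin

section \<open>Unital nonassociative algebras\<close>

text \<open>The record \<^typ>\<open>('k, 'a) module\<close> already carries a multiplication and a unit, on which the
  locale \<^locale>\<open>module\<close> imposes nothing. (The locale \<^locale>\<open>algebra\<close> would force the
  multiplication to be associative and commutative.)\<close>

locale unital_algebra = module R A
  for R :: "('k, 'm) ring_scheme" (structure) and A :: "('k, 'a, 'n) module_scheme" (structure) +
  assumes mult_closed: "\<lbrakk>x \<in> carrier A; y \<in> carrier A\<rbrakk> \<Longrightarrow> x \<otimes>\<^bsub>A\<^esub> y \<in> carrier A"
    and one_closed: "\<one>\<^bsub>A\<^esub> \<in> carrier A"
    and mult_one_left: "x \<in> carrier A \<Longrightarrow> \<one>\<^bsub>A\<^esub> \<otimes>\<^bsub>A\<^esub> x = x"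
    and mult_one_right: "x \<in> carrier A \<Longrightarrow> x \<otimes>\<^bsub>A\<^esub> \<one>\<^bsub>A\<^esub> = x"
    and mult_add_left: "\<lbrakk>x \<in> carrier A; y \<in> carrier A; z \<in> carrier A\<rbrakk>
          \<Longrightarrow> (x \<oplus>\<^bsub>A\<^esub> y) \<otimes>\<^bsub>A\<^esub> z = x \<otimes>\<^bsub>A\<^esub> z \<oplus>\<^bsub>A\<^esub> y \<otimes>\<^bsub>A\<^esub> z"
    and mult_add_right: "\<lbrakk>x \<in> carrier A; y \<in> carrier A; z \<in> carrier A\<rbrakk>
          \<Longrightarrow> z \<otimes>\<^bsub>A\<^esub> (x \<oplus>\<^bsub>A\<^esub> y) = z \<otimes>\<^bsub>A\<^esub> x \<oplus>\<^bsub>A\<^esub> z \<otimes>\<^bsub>A\<^esub> y"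
    and mult_smult_left: "\<lbrakk>\<alpha> \<in> carrier R; x \<in> carrier A; y \<in> carrier A\<rbrakk>
          \<Longrightarrow> (\<alpha> \<odot>\<^bsub>A\<^esub> x) \<otimes>\<^bsub>A\<^esub> y = \<alpha> \<odot>\<^bsub>A\<^esub> (x \<otimes>\<^bsub>A\<^esub> y)"
    and mult_smult_right: "\<lbrakk>\<alpha> \<in> carrier R; x \<in> carrier A; y \<in> carrier A\<rbrakk>
          \<Longrightarrow> x \<otimes>\<^bsub>A\<^esub> (\<alpha> \<odot>\<^bsub>A\<^esub> y) = \<alpha> \<odot>\<^bsub>A\<^esub> (x \<otimes>\<^bsub>A\<^esub> y)"

definition associator :: "('a, 'm) ring_scheme \<Rightarrow> 'a \<Rightarrow> 'a \<Rightarrow> 'a \<Rightarrow> 'a"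
  where "associator A a b c = ((a \<otimes>\<^bsub>A\<^esub> b) \<otimes>\<^bsub>A\<^esub> c) \<ominus>\<^bsub>A\<^esub> (a \<otimes>\<^bsub>A\<^esub> (b \<otimes>\<^bsub>A\<^esub> c))"

locale alternative_algebra = unital_algebra R A
  for R :: "('k, 'm) ring_scheme" (structure) and A :: "('k, 'a, 'n) module_scheme" (structure) +
  assumes left_alternative:
      "\<lbrakk>a \<in> carrier A; b \<in> carrier A\<rbrakk> \<Longrightarrow> associator A a a b = \<zero>\<^bsub>A\<^esub>"
    and right_alternative:
      "\<lbrakk>a \<in> carrier A; b \<in> carrier A\<rbrakk> \<Longrightarrow> associator A b a a = \<zero>\<^bsub>A\<^esub>"

definition alg_hom ::
    "('k, 'm) ring_scheme \<Rightarrow> ('k, 'a, 'n) module_scheme \<Rightarrow> ('k, 'b, 'l) module_scheme \<Rightarrow> ('a \<Rightarrow> 'b) set"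
  where "alg_hom R A B = {h. h \<in> carrier A \<rightarrow> carrier B
    \<and> (\<forall>x\<in>carrier A. \<forall>y\<in>carrier A. h (x \<oplus>\<^bsub>A\<^esub> y) = h x \<oplus>\<^bsub>B\<^esub> h y)
    \<and> (\<forall>x\<in>carrier A. \<forall>y\<in>carrier A. h (x \<otimes>\<^bsub>A\<^esub> y) = h x \<otimes>\<^bsub>B\<^esub> h y)
    \<and> (\<forall>\<alpha>\<in>carrier R. \<forall>x\<in>carrier A. h (\<alpha> \<odot>\<^bsub>A\<^esub> x) = \<alpha> \<odot>\<^bsub>B\<^esub> h x)
    \<and> h \<one>\<^bsub>A\<^esub> = \<one>\<^bsub>B\<^esub>}"

definition alg_iso ::
    "('k, 'm) ring_scheme \<Rightarrow> ('k, 'a, 'n) module_scheme \<Rightarrow> ('k, 'b, 'l) module_scheme \<Rightarrow> ('a \<Rightarrow> 'b) set"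
  where "alg_iso R A B = {h \<in> alg_hom R A B. bij_betw h (carrier A) (carrier B)}"

definition alg_isomorphic ::
    "('k, 'm) ring_scheme \<Rightarrow> ('k, 'a, 'n) module_scheme \<Rightarrow> ('k, 'b, 'l) module_scheme \<Rightarrow> bool"
  where "alg_isomorphic R A B \<longleftrightarrow> alg_iso R A B \<noteq> {}"

definition alg_generated_by ::
    "('k, 'm) ring_scheme \<Rightarrow> ('k, 'a, 'n) module_scheme \<Rightarrow> 'a set \<Rightarrow> bool"
  where "alg_generated_by R A X \<longleftrightarrow> X \<subseteq> carrier A \<and>
    (\<forall>S. submodule S R A \<and> \<one>\<^bsub>A\<^esub> \<in> S \<and> (\<forall>x\<in>S. \<forall>y\<in>S. x \<otimes>\<^bsub>A\<^esub> y \<in> S) \<and> X \<subseteq> S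
        \<longrightarrow> S = carrier A)"


section \<open>Ideals and quotients\<close>

text \<open>\<^locale>\<open>ideal\<close> and \<^const>\<open>genideal\<close> presuppose an associative ring, hence the nonassociative
  versions below.\<close>

definition alg_ideal :: "('k, 'm) ring_scheme \<Rightarrow> ('k, 'a, 'n) module_scheme \<Rightarrow> 'a set \<Rightarrow> bool"
  where "alg_ideal R A I \<longleftrightarrow> submodule I R A \<and>
    (\<forall>x\<in>carrier A. \<forall>y\<in>I. x \<otimes>\<^bsub>A\<^esub> y \<in> I \<and> y \<otimes>\<^bsub>A\<^esub> x \<in> I)"

definition alg_genideal :: "('k, 'm) ring_scheme \<Rightarrow> ('k, 'a, 'n) module_scheme \<Rightarrow> 'a set \<Rightarrow> 'a set"
  where "alg_genideal R A S = \<Inter>{I. alg_ideal R A I \<and> S \<subseteq> I}"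

text \<open>This is \<^const>\<open>FactRing\<close> extended by the induced scalar multiplication.\<close>

definition alg_quot :: "('k, 'a, 'n) module_scheme \<Rightarrow> 'a set \<Rightarrow> ('k, 'a set) module"
  where "alg_quot A I =
    \<lparr>carrier = a_rcosets\<^bsub>A\<^esub> I, mult = rcoset_mult A I, one = I +>\<^bsub>A\<^esub> \<one>\<^bsub>A\<^esub>, zero = I, add = set_add A,
     smult = (\<lambda>\<alpha> X. \<Union>x\<in>X. I +>\<^bsub>A\<^esub> (\<alpha> \<odot>\<^bsub>A\<^esub> x))\<rparr>"


section \<open>Free and presented alternative algebras\<close>

datatype 'x word = Gen 'x | Prod "'x word" "'x word"

text \<open>\<^term>\<open>None\<close> is the empty monomial.\<close>

type_synonym 'x monomial = "'x word option"

fun mono_mult :: "'x monomial \<Rightarrow> 'x monomial \<Rightarrow> 'x monomial" where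
  "mono_mult None w = w"
| "mono_mult w None = w"
| "mono_mult (Some u) (Some w) = Some (Prod u w)"

text \<open>The free unital nonassociative \<open>R\<close>-algebra on \<^typ>\<open>'x\<close>: finitely supported functions on the
  free unital magma, with the convolution product. (Every monomial has only finitely many
  factorizations, so the sum is finite.)\<close>

definition free_alg :: "('k, 'm) ring_scheme \<Rightarrow> ('k, 'x monomial \<Rightarrow> 'k) module"
  where "free_alg R =
    \<lparr>carrier = {f. (\<forall>w. f w \<in> carrier R) \<and> finite {w. f w \<noteq> \<zero>\<^bsub>R\<^esub>}},
     mult = (\<lambda>f g w. finsum R (\<lambda>(u, v). f u \<otimes>\<^bsub>R\<^esub> g v) {(u, v). mono_mult u v = w}),
     one = (\<lambda>w. if w = None then \<one>\<^bsub>R\<^esub> else \<zero>\<^bsub>R\<^esub>),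
     zero = (\<lambda>w. \<zero>\<^bsub>R\<^esub>),
     add = (\<lambda>f g w. f w \<oplus>\<^bsub>R\<^esub> g w),
     smult = (\<lambda>\<alpha> f w. \<alpha> \<otimes>\<^bsub>R\<^esub> f w)\<rparr>"

definition free_gen :: "('k, 'm) ring_scheme \<Rightarrow> 'x \<Rightarrow> 'x monomial \<Rightarrow> 'k"
  where "free_gen R x = (\<lambda>w. if w = Some (Gen x) then \<one>\<^bsub>R\<^esub> else \<zero>\<^bsub>R\<^esub>)"

text \<open>A relation is a pair \<open>(l, r)\<close>, read as \<open>l = r\<close>.\<close>

definition relators :: "('a, 'm) ring_scheme \<Rightarrow> ('a \<times> 'a) set \<Rightarrow> 'a set"
  where "relators A Rel = {l \<ominus>\<^bsub>A\<^esub> r | l r. (l, r) \<in> Rel}"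

definition alternators :: "('a, 'm) ring_scheme \<Rightarrow> 'a set"
  where "alternators A =
    {associator A a a b | a b. a \<in> carrier A \<and> b \<in> carrier A} \<union>
    {associator A b a a | a b. a \<in> carrier A \<and> b \<in> carrier A}"

definition presentation_ideal ::
    "('k, 'm) ring_scheme \<Rightarrow> (('x monomial \<Rightarrow> 'k) \<times> ('x monomial \<Rightarrow> 'k)) set \<Rightarrow> ('x monomial \<Rightarrow> 'k) set"
  where "presentation_ideal R Rel =
    alg_genideal R (free_alg R) (alternators (free_alg R) \<union> relators (free_alg R) Rel)"

text \<open>The alternative \<open>R\<close>-algebra presented by the generators \<^typ>\<open>'x\<close> and the relations \<open>Rel\<close>.\<close>

definition presented_alg ::
    "('k, 'm) ring_scheme \<Rightarrow> (('x monomial \<Rightarrow> 'k) \<times> ('x monomial \<Rightarrow> 'k)) set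
      \<Rightarrow> ('k, ('x monomial \<Rightarrow> 'k) set) module"
  where "presented_alg R Rel = alg_quot (free_alg R) (presentation_ideal R Rel)"

definition presented_gen ::
    "('k, 'm) ring_scheme \<Rightarrow> (('x monomial \<Rightarrow> 'k) \<times> ('x monomial \<Rightarrow> 'k)) set
      \<Rightarrow> 'x \<Rightarrow> ('x monomial \<Rightarrow> 'k) set"
  where "presented_gen R Rel x = presentation_ideal R Rel +>\<^bsub>free_alg R\<^esub> free_gen R x"


section \<open>Cayley polynomials\<close>

definition cayley_rels :: "('a, 'm) ring_scheme \<Rightarrow> 'a \<Rightarrow> 'a \<Rightarrow> 'a \<Rightarrow> ('a \<times> 'a) set"
  where "cayley_rels A t1 t2 t3 =
    {(t2 \<otimes>\<^bsub>A\<^esub> t1, \<ominus>\<^bsub>A\<^esub> (t1 \<otimes>\<^bsub>A\<^esub> t2)),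
     (t3 \<otimes>\<^bsub>A\<^esub> t1, \<ominus>\<^bsub>A\<^esub> (t1 \<otimes>\<^bsub>A\<^esub> t3)),
     (t3 \<otimes>\<^bsub>A\<^esub> t2, \<ominus>\<^bsub>A\<^esub> (t2 \<otimes>\<^bsub>A\<^esub> t3)),
     ((t1 \<otimes>\<^bsub>A\<^esub> t2) \<otimes>\<^bsub>A\<^esub> t3, \<ominus>\<^bsub>A\<^esub> (t1 \<otimes>\<^bsub>A\<^esub> (t2 \<otimes>\<^bsub>A\<^esub> t3)))}"

definition square_rels ::
    "('k, 'a, 'm) module_scheme \<Rightarrow> 'k \<Rightarrow> 'k \<Rightarrow> 'k \<Rightarrow> 'a \<Rightarrow> 'a \<Rightarrow> 'a \<Rightarrow> ('a \<times> 'a) set"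
  where "square_rels A \<mu>1 \<mu>2 \<mu>3 t1 t2 t3 =
    {(t1 \<otimes>\<^bsub>A\<^esub> t1, \<mu>1 \<odot>\<^bsub>A\<^esub> \<one>\<^bsub>A\<^esub>), (t2 \<otimes>\<^bsub>A\<^esub> t2, \<mu>2 \<odot>\<^bsub>A\<^esub> \<one>\<^bsub>A\<^esub>), (t3 \<otimes>\<^bsub>A\<^esub> t3, \<mu>3 \<odot>\<^bsub>A\<^esub> \<one>\<^bsub>A\<^esub>)}"

datatype gen3 = T1 | T2 | T3

definition free_cayley_rels ::
    "('k, 'm) ring_scheme \<Rightarrow> ((gen3 monomial \<Rightarrow> 'k) \<times> (gen3 monomial \<Rightarrow> 'k)) set"
  where "free_cayley_rels R =
    cayley_rels (free_alg R) (free_gen R T1) (free_gen R T2) (free_gen R T3)"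

definition free_square_rels ::
    "('k, 'm) ring_scheme \<Rightarrow> 'k \<Rightarrow> 'k \<Rightarrow> 'k \<Rightarrow> ((gen3 monomial \<Rightarrow> 'k) \<times> (gen3 monomial \<Rightarrow> 'k)) set"
  where "free_square_rels R \<mu>1 \<mu>2 \<mu>3 =
    square_rels (free_alg R) \<mu>1 \<mu>2 \<mu>3 (free_gen R T1) (free_gen R T2) (free_gen R T3)"

definition cayley_polys :: "('k, 'm) ring_scheme \<Rightarrow> ('k, (gen3 monomial \<Rightarrow> 'k) set) module"
  where "cayley_polys R = presented_alg R (free_cayley_rels R)"

definition cayley_var :: "('k, 'm) ring_scheme \<Rightarrow> gen3 \<Rightarrow> (gen3 monomial \<Rightarrow> 'k) set"
  where "cayley_var R = presented_gen R (free_cayley_rels R)"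

text \<open>The ideal generated by \<open>t\<^sub>i\<^sup>2 - \<mu>\<^sub>i\<close> in the ring of Cayley polynomials.\<close>

definition cayley_square_ideal ::
    "('k, 'm) ring_scheme \<Rightarrow> 'k \<Rightarrow> 'k \<Rightarrow> 'k \<Rightarrow> (gen3 monomial \<Rightarrow> 'k) set set"
  where "cayley_square_ideal R \<mu>1 \<mu>2 \<mu>3 =
    alg_genideal R (cayley_polys R)
      (relators (cayley_polys R)
        (square_rels (cayley_polys R) \<mu>1 \<mu>2 \<mu>3
          (cayley_var R T1) (cayley_var R T2) (cayley_var R T3)))"


section \<open>The Cayley-Dickson process\<close>

record ('k, 'a) star_algebra = "('k, 'a) module" +
  star :: "'a \<Rightarrow> 'a"

definition cancellable :: "('k, 'm) ring_scheme \<Rightarrow> 'k \<Rightarrow> bool"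
  where "cancellable R \<mu> \<longleftrightarrow> \<mu> \<in> carrier R \<and> (\<forall>\<alpha>\<in>carrier R. \<mu> \<otimes>\<^bsub>R\<^esub> \<alpha> = \<zero>\<^bsub>R\<^esub> \<longrightarrow> \<alpha> = \<zero>\<^bsub>R\<^esub>)"

definition scalar_alg :: "('k, 'm) ring_scheme \<Rightarrow> ('k, 'k) star_algebra"
  where "scalar_alg R =
    \<lparr>carrier = carrier R, mult = mult R, one = \<one>\<^bsub>R\<^esub>, zero = \<zero>\<^bsub>R\<^esub>, add = add R,
     smult = mult R, star = (\<lambda>\<alpha>. \<alpha>)\<rparr>"

text \<open>The pair \<open>(a, b)\<close> stands for \<open>a + vb\<close>.\<close>

definition cayley_dickson ::
    "('k, 'a, 'n) star_algebra_scheme \<Rightarrow> 'k \<Rightarrow> ('k, 'a \<times> 'a) star_algebra"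
  where "cayley_dickson B \<mu> =
    \<lparr>carrier = carrier B \<times> carrier B,
     mult = (\<lambda>(a, b) (c, d).
       ((a \<otimes>\<^bsub>B\<^esub> c) \<oplus>\<^bsub>B\<^esub> (\<mu> \<odot>\<^bsub>B\<^esub> (d \<otimes>\<^bsub>B\<^esub> star B b)), (star B a \<otimes>\<^bsub>B\<^esub> d) \<oplus>\<^bsub>B\<^esub> (c \<otimes>\<^bsub>B\<^esub> b))),
     one = (\<one>\<^bsub>B\<^esub>, \<zero>\<^bsub>B\<^esub>),
     zero = (\<zero>\<^bsub>B\<^esub>, \<zero>\<^bsub>B\<^esub>),
     add = (\<lambda>(a, b) (c, d). (a \<oplus>\<^bsub>B\<^esub> c, b \<oplus>\<^bsub>B\<^esub> d)),
     smult = (\<lambda>\<alpha> (a, b). (\<alpha> \<odot>\<^bsub>B\<^esub> a, \<alpha> \<odot>\<^bsub>B\<^esub> b)),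
     star = (\<lambda>(a, b). (star B a, \<ominus>\<^bsub>B\<^esub> b))\<rparr>"

definition basic_gen :: "('k, 'a, 'n) star_algebra_scheme \<Rightarrow> 'a \<times> 'a"
  where "basic_gen B = (\<zero>\<^bsub>B\<^esub>, \<one>\<^bsub>B\<^esub>)"

definition cd_embed :: "('k, 'a, 'n) star_algebra_scheme \<Rightarrow> 'a \<Rightarrow> 'a \<times> 'a"
  where "cd_embed B a = (a, \<zero>\<^bsub>B\<^esub>)"

definition binarion_alg :: "('k, 'm) ring_scheme \<Rightarrow> 'k \<Rightarrow> ('k, 'k \<times> 'k) star_algebra"
  where "binarion_alg R \<mu>1 = cayley_dickson (scalar_alg R) \<mu>1"

definition quaternion_alg ::
    "('k, 'm) ring_scheme \<Rightarrow> 'k \<Rightarrow> 'k \<Rightarrow> ('k, ('k \<times> 'k) \<times> ('k \<times> 'k)) star_algebra"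
  where "quaternion_alg R \<mu>1 \<mu>2 = cayley_dickson (binarion_alg R \<mu>1) \<mu>2"

type_synonym 'k oct = "(('k \<times> 'k) \<times> ('k \<times> 'k)) \<times> (('k \<times> 'k) \<times> ('k \<times> 'k))"

definition octonion_alg ::
    "('k, 'm) ring_scheme \<Rightarrow> 'k \<Rightarrow> 'k \<Rightarrow> 'k \<Rightarrow> ('k, 'k oct) star_algebra"
  where "octonion_alg R \<mu>1 \<mu>2 \<mu>3 = cayley_dickson (quaternion_alg R \<mu>1 \<mu>2) \<mu>3"

text \<open>The basic generators of the three steps, viewed in the octonion algebra.\<close>

fun oct_gen :: "('k, 'm) ring_scheme \<Rightarrow> 'k \<Rightarrow> 'k \<Rightarrow> gen3 \<Rightarrow> 'k oct" where
  "oct_gen R \<mu>1 \<mu>2 T1 =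
     cd_embed (quaternion_alg R \<mu>1 \<mu>2) (cd_embed (binarion_alg R \<mu>1) (basic_gen (scalar_alg R)))"
| "oct_gen R \<mu>1 \<mu>2 T2 = cd_embed (quaternion_alg R \<mu>1 \<mu>2) (basic_gen (binarion_alg R \<mu>1))"
| "oct_gen R \<mu>1 \<mu>2 T3 = basic_gen (quaternion_alg R \<mu>1 \<mu>2)"

end

theory Submission
  imports Defs
begin

text \<open>The heart of the matter is that the octonion algebra has the universal property of the presented
algebra: if \<open>a\<^sub>1, a\<^sub>2, a\<^sub>3\<close> satisfy the relations in an alternative algebra \<open>A\<close>, there is a homomorphism
from the octonions to \<open>A\<close> with \<open>v\<^sub>i \<mapsto> a\<^sub>i\<close> (\<open>octonion_lift\<close>). Instead of comparing the products of
the eight basis monomials, one builds the homomorphism one Cayley-Dickson step at a time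
(\<open>cayley_dickson_lift\<close>): a homomorphism \<open>\<phi>\<close> from \<open>B\<close> to \<open>A\<close> extends to \<open>a + vb \<mapsto> \<phi> a + w \<phi> b\<close> as
soon as \<open>w\<^sup>2 = \<mu>\<close> and \<open>\<phi> b \<cdot> w = w \<cdot> \<phi> b\<^sup>*\<close> for all \<open>b\<close>. The three rules

  \<open>a(wb) = w(a\<^sup>*b)\<close>,  \<open>(wa)b = w(ba)\<close>,  \<open>(wa)(wb) = \<mu> ba\<^sup>*\<close>

that this requires follow from the linearized alternative laws, because \<open>a + a\<^sup>*\<close> is a scalar. At the
first two steps the condition on \<open>w\<close> is anticommutativity of the generators. At the third one it
also involves the product \<open>a\<^sub>1a\<^sub>2\<close>, and this is where \<open>(a\<^sub>1a\<^sub>2)a\<^sub>3 = -a\<^sub>1(a\<^sub>2a\<^sub>3)\<close> enters.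

Conversely the octonions are themselves alternative (\<open>octonion_alternative\<close>), generated by \<open>v\<^sub>1, v\<^sub>2,
v\<^sub>3\<close>, and satisfy the relations. Hence both the presented algebra and the quotient of the Cayley
polynomials map onto them. In each case the two homomorphisms are mutually inverse, since homomorphisms
that agree on generators agree (\<open>octonion_iso\<close>). The remaining work here is to supply free
nonassociative algebras, ideals and quotients with their universal properties.

Over a field, an algebra \<open>A\<close> generated by such \<open>a\<^sub>i\<close> is a homomorphic image of the octonions, and it
must be shown that a homomorphism \<open>h\<close> into a nonzero \<open>A\<close> is injective
(\<open>hom_inj_of_nondegenerate\<close>). If \<open>h x = 0\<close>, then applying \<open>h\<close> to the scalar \<open>n(x,y) = xy\<^sup>* + yx\<^sup>*\<close> gives
\<open>t(x) h y = n(x,y) 1\<close> for all \<open>y\<close>, where \<open>t\<close> is the trace. If \<open>t(x) \<noteq> 0\<close>, the image of \<open>h\<close> consists of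
scalars and cannot contain two invertible anticommuting elements, as \<open>2 \<noteq> 0\<close>. If \<open>t(x) = 0\<close>, then
\<open>x\<close> is orthogonal to everything, so \<open>x = 0\<close> because the norm form is nondegenerate; this last fact is
where \<open>2\<close> and the \<open>\<mu>\<^sub>i\<close> have to be cancellable.\<close>

section \<open>Computing in unital nonassociative algebras\<close>

context unital_algebra
begin

lemmas [simp] = mult_closed one_closed mult_one_left mult_one_right

lemma mult_zero_left [simp]: "x \<in> carrier A \<Longrightarrow> \<zero>\<^bsub>A\<^esub> \<otimes>\<^bsub>A\<^esub> x = \<zero>\<^bsub>A\<^esub>"
  using mult_smult_left[of "\<zero>" "\<zero>\<^bsub>A\<^esub>" x] by simp

lemma mult_zero_right [simp]: "x \<in> carrier A \<Longrightarrow> x \<otimes>\<^bsub>A\<^esub> \<zero>\<^bsub>A\<^esub> = \<zero>\<^bsub>A\<^esub>"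
  using mult_smult_right[of "\<zero>" x "\<zero>\<^bsub>A\<^esub>"] by simp

lemma mult_minus_left:
  "\<lbrakk>x \<in> carrier A; y \<in> carrier A\<rbrakk> \<Longrightarrow> (\<ominus>\<^bsub>A\<^esub> x) \<otimes>\<^bsub>A\<^esub> y = \<ominus>\<^bsub>A\<^esub> (x \<otimes>\<^bsub>A\<^esub> y)"
  using mult_smult_left[of "\<ominus> \<one>" x y] by (simp add: smult_l_minus)

lemma mult_minus_right:
  "\<lbrakk>x \<in> carrier A; y \<in> carrier A\<rbrakk> \<Longrightarrow> x \<otimes>\<^bsub>A\<^esub> (\<ominus>\<^bsub>A\<^esub> y) = \<ominus>\<^bsub>A\<^esub> (x \<otimes>\<^bsub>A\<^esub> y)"
  using mult_smult_right[of "\<ominus> \<one>" x y] by (simp add: smult_l_minus)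

lemma smult_lcomm:
  "\<lbrakk>\<alpha> \<in> carrier R; \<beta> \<in> carrier R; x \<in> carrier A\<rbrakk> \<Longrightarrow> \<alpha> \<odot>\<^bsub>A\<^esub> (\<beta> \<odot>\<^bsub>A\<^esub> x) = \<beta> \<odot>\<^bsub>A\<^esub> (\<alpha> \<odot>\<^bsub>A\<^esub> x)"
  by (simp add: smult_assoc1[symmetric] R.m_comm)

lemma minus_zero_A [simp]: "\<ominus>\<^bsub>A\<^esub> \<zero>\<^bsub>A\<^esub> = \<zero>\<^bsub>A\<^esub>"
  using M.minus_equality[of "\<zero>\<^bsub>A\<^esub>" "\<zero>\<^bsub>A\<^esub>"] by simp

text \<open>These rules turn a term into a sum of scalar multiples of bracketed products, without rebracketing any
product. Registering them as a structure of their own makes the method \<open>algebra\<close> decide identities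
that follow from bilinearity alone. Whatever uses (non)associativity has to be supplied separately.\<close>

lemmas nonassociative_simprules
  [algebra nonassociative "zero A" "add A" "a_inv A" "a_minus A" "one A" "mult A" "smult A"] =
  M.a_closed M.zero_closed M.a_inv_closed M.minus_closed mult_closed one_closed smult_closed
  M.a_assoc M.l_zero M.l_neg M.a_comm mult_one_left mult_one_right mult_add_left M.minus_eq
  M.r_zero M.r_neg M.r_neg2 M.r_neg1 M.minus_add M.minus_minus minus_zero_A
  M.a_lcomm mult_add_right mult_zero_left mult_zero_right mult_minus_left mult_minus_right
  smult_r_distr smult_l_distr smult_r_minus smult_l_minus smult_assoc1 smult_lcomm smult_one
  smult_l_null smult_r_null mult_smult_left mult_smult_right

end

lemma (in unital_algebra) minus_eq_zeroD:
  assumes "x \<ominus>\<^bsub>A\<^esub> y = \<zero>\<^bsub>A\<^esub>" "x \<in> carrier A" "y \<in> carrier A"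
  shows "x = y"
proof -
  have "x = (x \<ominus>\<^bsub>A\<^esub> y) \<oplus>\<^bsub>A\<^esub> y" using assms(2,3) by algebra
  then show ?thesis using assms by simp
qed

lemma (in alternative_algebra) left_alternative':
  "\<lbrakk>x \<in> carrier A; y \<in> carrier A\<rbrakk> \<Longrightarrow> (x \<otimes>\<^bsub>A\<^esub> x) \<otimes>\<^bsub>A\<^esub> y = x \<otimes>\<^bsub>A\<^esub> (x \<otimes>\<^bsub>A\<^esub> y)"
  using left_alternative[of x y] minus_eq_zeroD[of "(x \<otimes>\<^bsub>A\<^esub> x) \<otimes>\<^bsub>A\<^esub> y" "x \<otimes>\<^bsub>A\<^esub> (x \<otimes>\<^bsub>A\<^esub> y)"]
  by (simp add: associator_def)

lemma (in alternative_algebra) right_alternative':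
  "\<lbrakk>x \<in> carrier A; y \<in> carrier A\<rbrakk> \<Longrightarrow> (y \<otimes>\<^bsub>A\<^esub> x) \<otimes>\<^bsub>A\<^esub> x = y \<otimes>\<^bsub>A\<^esub> (x \<otimes>\<^bsub>A\<^esub> x)"
  using right_alternative[of x y] minus_eq_zeroD[of "(y \<otimes>\<^bsub>A\<^esub> x) \<otimes>\<^bsub>A\<^esub> x" "y \<otimes>\<^bsub>A\<^esub> (x \<otimes>\<^bsub>A\<^esub> x)"]
  by (simp add: associator_def)

text \<open>Polarization: put \<open>x + y\<close> for \<open>x\<close> in the left alternative law and subtract the diagonal terms.\<close>

lemma (in alternative_algebra) left_alternative_linearized:
  assumes "x \<in> carrier A" "y \<in> carrier A" "z \<in> carrier A"
  shows "(x \<otimes>\<^bsub>A\<^esub> y) \<otimes>\<^bsub>A\<^esub> z \<oplus>\<^bsub>A\<^esub> (y \<otimes>\<^bsub>A\<^esub> x) \<otimes>\<^bsub>A\<^esub> z = x \<otimes>\<^bsub>A\<^esub> (y \<otimes>\<^bsub>A\<^esub> z) \<oplus>\<^bsub>A\<^esub> y \<otimes>\<^bsub>A\<^esub> (x \<otimes>\<^bsub>A\<^esub> z)"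
proof -
  have "(x \<otimes>\<^bsub>A\<^esub> y) \<otimes>\<^bsub>A\<^esub> z \<oplus>\<^bsub>A\<^esub> (y \<otimes>\<^bsub>A\<^esub> x) \<otimes>\<^bsub>A\<^esub> z
      = (((x \<oplus>\<^bsub>A\<^esub> y) \<otimes>\<^bsub>A\<^esub> (x \<oplus>\<^bsub>A\<^esub> y)) \<otimes>\<^bsub>A\<^esub> z \<ominus>\<^bsub>A\<^esub> (x \<otimes>\<^bsub>A\<^esub> x) \<otimes>\<^bsub>A\<^esub> z) \<ominus>\<^bsub>A\<^esub> (y \<otimes>\<^bsub>A\<^esub> y) \<otimes>\<^bsub>A\<^esub> z"
    using assms by algebra
  also have "\<dots> = ((x \<oplus>\<^bsub>A\<^esub> y) \<otimes>\<^bsub>A\<^esub> ((x \<oplus>\<^bsub>A\<^esub> y) \<otimes>\<^bsub>A\<^esub> z) \<ominus>\<^bsub>A\<^esub> x \<otimes>\<^bsub>A\<^esub> (x \<otimes>\<^bsub>A\<^esub> z)) \<ominus>\<^bsub>A\<^esub> y \<otimes>\<^bsub>A\<^esub> (y \<otimes>\<^bsub>A\<^esub> z)"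
    using assms by (simp add: left_alternative')
  also have "\<dots> = x \<otimes>\<^bsub>A\<^esub> (y \<otimes>\<^bsub>A\<^esub> z) \<oplus>\<^bsub>A\<^esub> y \<otimes>\<^bsub>A\<^esub> (x \<otimes>\<^bsub>A\<^esub> z)"
    using assms by algebra
  finally show ?thesis .
qed

lemma (in alternative_algebra) right_alternative_linearized:
  assumes "x \<in> carrier A" "y \<in> carrier A" "z \<in> carrier A"
  shows "(x \<otimes>\<^bsub>A\<^esub> y) \<otimes>\<^bsub>A\<^esub> z \<oplus>\<^bsub>A\<^esub> (x \<otimes>\<^bsub>A\<^esub> z) \<otimes>\<^bsub>A\<^esub> y = x \<otimes>\<^bsub>A\<^esub> (y \<otimes>\<^bsub>A\<^esub> z) \<oplus>\<^bsub>A\<^esub> x \<otimes>\<^bsub>A\<^esub> (z \<otimes>\<^bsub>A\<^esub> y)"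
proof -
  have "(x \<otimes>\<^bsub>A\<^esub> y) \<otimes>\<^bsub>A\<^esub> z \<oplus>\<^bsub>A\<^esub> (x \<otimes>\<^bsub>A\<^esub> z) \<otimes>\<^bsub>A\<^esub> y
      = ((x \<otimes>\<^bsub>A\<^esub> (y \<oplus>\<^bsub>A\<^esub> z)) \<otimes>\<^bsub>A\<^esub> (y \<oplus>\<^bsub>A\<^esub> z) \<ominus>\<^bsub>A\<^esub> (x \<otimes>\<^bsub>A\<^esub> y) \<otimes>\<^bsub>A\<^esub> y) \<ominus>\<^bsub>A\<^esub> (x \<otimes>\<^bsub>A\<^esub> z) \<otimes>\<^bsub>A\<^esub> z"
    using assms by algebra
  also have "\<dots> = (x \<otimes>\<^bsub>A\<^esub> ((y \<oplus>\<^bsub>A\<^esub> z) \<otimes>\<^bsub>A\<^esub> (y \<oplus>\<^bsub>A\<^esub> z)) \<ominus>\<^bsub>A\<^esub> x \<otimes>\<^bsub>A\<^esub> (y \<otimes>\<^bsub>A\<^esub> y)) \<ominus>\<^bsub>A\<^esub> x \<otimes>\<^bsub>A\<^esub> (z \<otimes>\<^bsub>A\<^esub> z)"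
    using assms by (simp add: right_alternative')
  also have "\<dots> = x \<otimes>\<^bsub>A\<^esub> (y \<otimes>\<^bsub>A\<^esub> z) \<oplus>\<^bsub>A\<^esub> x \<otimes>\<^bsub>A\<^esub> (z \<otimes>\<^bsub>A\<^esub> y)"
    using assms by algebra
  finally show ?thesis .
qed

section \<open>Scalar involutions\<close>

text \<open>The trace is the polarization of the norm at \<open>1\<close>. It is carried along explicitly because most
arguments below use it to replace \<open>x\<^sup>*\<close> by \<open>\<tau> 1 - x\<close>.\<close>

locale scalar_involution = unital_algebra R B
  for R :: "('k, 'm) ring_scheme" (structure)
    and B :: "('k, 'a, 'n) star_algebra_scheme" (structure) +
  assumes star_closed [simp]: "x \<in> carrier B \<Longrightarrow> star B x \<in> carrier B"
    and star_add: "\<lbrakk>x \<in> carrier B; y \<in> carrier B\<rbrakk> \<Longrightarrow> star B (x \<oplus>\<^bsub>B\<^esub> y) = star B x \<oplus>\<^bsub>B\<^esub> star B y"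
    and star_smult: "\<lbrakk>\<alpha> \<in> carrier R; x \<in> carrier B\<rbrakk> \<Longrightarrow> star B (\<alpha> \<odot>\<^bsub>B\<^esub> x) = \<alpha> \<odot>\<^bsub>B\<^esub> star B x"
    and star_mult: "\<lbrakk>x \<in> carrier B; y \<in> carrier B\<rbrakk> \<Longrightarrow> star B (x \<otimes>\<^bsub>B\<^esub> y) = star B y \<otimes>\<^bsub>B\<^esub> star B x"
    and star_star [simp]: "x \<in> carrier B \<Longrightarrow> star B (star B x) = x"
    and trace_scalar: "x \<in> carrier B \<Longrightarrow> \<exists>\<tau>\<in>carrier R. x \<oplus>\<^bsub>B\<^esub> star B x = \<tau> \<odot>\<^bsub>B\<^esub> \<one>\<^bsub>B\<^esub>"
    and norm_scalar: "x \<in> carrier B \<Longrightarrow> \<exists>\<nu>\<in>carrier R. star B x \<otimes>\<^bsub>B\<^esub> x = \<nu> \<odot>\<^bsub>B\<^esub> \<one>\<^bsub>B\<^esub>"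
begin

lemma star_one [simp]: "star B \<one>\<^bsub>B\<^esub> = \<one>\<^bsub>B\<^esub>"
  using star_mult[of "star B \<one>\<^bsub>B\<^esub>" "\<one>\<^bsub>B\<^esub>"] by simp

lemma star_zero [simp]: "star B \<zero>\<^bsub>B\<^esub> = \<zero>\<^bsub>B\<^esub>"
  using star_smult[of "\<zero>" "\<zero>\<^bsub>B\<^esub>"] by simp

lemma star_minus: "x \<in> carrier B \<Longrightarrow> star B (\<ominus>\<^bsub>B\<^esub> x) = \<ominus>\<^bsub>B\<^esub> star B x"
  using star_smult[of "\<ominus> \<one>" x] by (simp add: smult_l_minus)

text \<open>With these additions \<open>algebra\<close> also normalizes terms with the involution.\<close>

lemmas star_simprules
  [algebra nonassociative "zero B" "add B" "a_inv B" "a_minus B" "one B" "mult B" "smult B"] =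
  star_closed star_star star_zero star_one star_add star_minus star_smult star_mult

lemma star_eq_trace_minus:
  assumes "x \<in> carrier B" "\<tau> \<in> carrier R" "x \<oplus>\<^bsub>B\<^esub> star B x = \<tau> \<odot>\<^bsub>B\<^esub> \<one>\<^bsub>B\<^esub>"
  shows "star B x = \<tau> \<odot>\<^bsub>B\<^esub> \<one>\<^bsub>B\<^esub> \<ominus>\<^bsub>B\<^esub> x"
proof -
  have "star B x = (x \<oplus>\<^bsub>B\<^esub> star B x) \<ominus>\<^bsub>B\<^esub> x"
    using assms(1) star_closed[OF assms(1)] by algebra
  then show ?thesis using assms by simp
qed

lemma mult_star_comm:
  assumes "x \<in> carrier B" shows "x \<otimes>\<^bsub>B\<^esub> star B x = star B x \<otimes>\<^bsub>B\<^esub> x"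
proof -
  obtain \<tau> where t: "\<tau> \<in> carrier R" "x \<oplus>\<^bsub>B\<^esub> star B x = \<tau> \<odot>\<^bsub>B\<^esub> \<one>\<^bsub>B\<^esub>"
    using trace_scalar[OF assms] by blast
  have "x \<otimes>\<^bsub>B\<^esub> (\<tau> \<odot>\<^bsub>B\<^esub> \<one>\<^bsub>B\<^esub> \<ominus>\<^bsub>B\<^esub> x) = (\<tau> \<odot>\<^bsub>B\<^esub> \<one>\<^bsub>B\<^esub> \<ominus>\<^bsub>B\<^esub> x) \<otimes>\<^bsub>B\<^esub> x"
    using assms t(1) by algebra
  then show ?thesis using star_eq_trace_minus[OF assms t] by simp
qed

end

section \<open>The Cayley-Dickson step\<close>

lemma cayley_dickson_simps [simp]:
  "carrier (cayley_dickson B \<mu>) = carrier B \<times> carrier B"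
  "(a, b) \<otimes>\<^bsub>cayley_dickson B \<mu>\<^esub> (c, d) =
     ((a \<otimes>\<^bsub>B\<^esub> c) \<oplus>\<^bsub>B\<^esub> (\<mu> \<odot>\<^bsub>B\<^esub> (d \<otimes>\<^bsub>B\<^esub> star B b)), (star B a \<otimes>\<^bsub>B\<^esub> d) \<oplus>\<^bsub>B\<^esub> (c \<otimes>\<^bsub>B\<^esub> b))"
  "\<one>\<^bsub>cayley_dickson B \<mu>\<^esub> = (\<one>\<^bsub>B\<^esub>, \<zero>\<^bsub>B\<^esub>)"
  "\<zero>\<^bsub>cayley_dickson B \<mu>\<^esub> = (\<zero>\<^bsub>B\<^esub>, \<zero>\<^bsub>B\<^esub>)"
  "(a, b) \<oplus>\<^bsub>cayley_dickson B \<mu>\<^esub> (c, d) = (a \<oplus>\<^bsub>B\<^esub> c, b \<oplus>\<^bsub>B\<^esub> d)"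
  "\<alpha> \<odot>\<^bsub>cayley_dickson B \<mu>\<^esub> (a, b) = (\<alpha> \<odot>\<^bsub>B\<^esub> a, \<alpha> \<odot>\<^bsub>B\<^esub> b)"
  "star (cayley_dickson B \<mu>) (a, b) = (star B a, \<ominus>\<^bsub>B\<^esub> b)"
  by (simp_all add: cayley_dickson_def)

lemma (in scalar_involution) cayley_dickson_unital_algebra:
  assumes mu: "\<mu> \<in> carrier R"
  shows "unital_algebra R (cayley_dickson B \<mu>)" (is "unital_algebra R ?D")
proof -
  have "abelian_group ?D"
  proof (rule abelian_groupI)
    fix x assume "x \<in> carrier ?D"
    then show "\<exists>y\<in>carrier ?D. y \<oplus>\<^bsub>?D\<^esub> x = \<zero>\<^bsub>?D\<^esub>"
      by (intro bexI[of _ "(\<ominus>\<^bsub>B\<^esub> fst x, \<ominus>\<^bsub>B\<^esub> snd x)"]) (auto simp: M.l_neg)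
  qed (auto simp: M.a_assoc, auto simp: M.a_comm)
  then have "module R ?D"
    by (rule moduleI[OF R.is_cring])
       (auto simp: smult_l_distr smult_r_distr smult_assoc1)
  then show ?thesis
  proof (rule unital_algebra.intro, unfold_locales)
    fix x y z assume "x \<in> carrier ?D" "y \<in> carrier ?D" "z \<in> carrier ?D"
    then obtain a b c d e f where xyz: "x = (a,b)" "y = (c,d)" "z = (e,f)" and
      *: "a \<in> carrier B" "b \<in> carrier B" "c \<in> carrier B" "d \<in> carrier B" "e \<in> carrier B" "f \<in> carrier B"
      by auto
    show "(x \<oplus>\<^bsub>?D\<^esub> y) \<otimes>\<^bsub>?D\<^esub> z = x \<otimes>\<^bsub>?D\<^esub> z \<oplus>\<^bsub>?D\<^esub> y \<otimes>\<^bsub>?D\<^esub> z"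
      unfolding xyz cayley_dickson_simps prod.inject
      using * mu by algebra
    show "z \<otimes>\<^bsub>?D\<^esub> (x \<oplus>\<^bsub>?D\<^esub> y) = z \<otimes>\<^bsub>?D\<^esub> x \<oplus>\<^bsub>?D\<^esub> z \<otimes>\<^bsub>?D\<^esub> y"
      unfolding xyz cayley_dickson_simps prod.inject
      using * mu by algebra
  next
    fix \<alpha> x y assume al: "\<alpha> \<in> carrier R" and "x \<in> carrier ?D" "y \<in> carrier ?D"
    then obtain a b c d where xyz: "x = (a,b)" "y = (c,d)" and
      *: "a \<in> carrier B" "b \<in> carrier B" "c \<in> carrier B" "d \<in> carrier B"
      by auto
    note closed = * mu al
    show "(\<alpha> \<odot>\<^bsub>?D\<^esub> x) \<otimes>\<^bsub>?D\<^esub> y = \<alpha> \<odot>\<^bsub>?D\<^esub> (x \<otimes>\<^bsub>?D\<^esub> y)"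
      unfolding xyz cayley_dickson_simps prod.inject
      using closed by algebra
    show "x \<otimes>\<^bsub>?D\<^esub> (\<alpha> \<odot>\<^bsub>?D\<^esub> y) = \<alpha> \<odot>\<^bsub>?D\<^esub> (x \<otimes>\<^bsub>?D\<^esub> y)"
      unfolding xyz cayley_dickson_simps prod.inject
      using closed by algebra
  qed (use mu in auto)
qed

lemma (in scalar_involution) cayley_dickson_minus:
  assumes mu: "\<mu> \<in> carrier R" and "a \<in> carrier B" "b \<in> carrier B"
  shows "\<ominus>\<^bsub>cayley_dickson B \<mu>\<^esub> (a, b) = (\<ominus>\<^bsub>B\<^esub> a, \<ominus>\<^bsub>B\<^esub> b)"
proof -
  interpret D: unital_algebra R "cayley_dickson B \<mu>"
    by (rule cayley_dickson_unital_algebra[OF mu])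
  show ?thesis
    by (rule D.M.minus_equality) (use assms in \<open>auto simp: M.l_neg\<close>)
qed

text \<open>The trace of \<open>a + vb\<close> is the trace of \<open>a\<close>, and its norm is \<open>n(a) - \<mu> n(b)\<close>.\<close>

theorem (in scalar_involution) cayley_dickson_scalar_involution:
  assumes mu: "\<mu> \<in> carrier R"
  shows "scalar_involution R (cayley_dickson B \<mu>)" (is "scalar_involution R ?D")
proof -
  interpret D: unital_algebra R ?D
    by (rule cayley_dickson_unital_algebra[OF mu])
  show ?thesis
  proof
    fix x y assume "x \<in> carrier ?D" "y \<in> carrier ?D"
    then obtain a b c d where xyz: "x = (a,b)" "y = (c,d)" and
      *: "a \<in> carrier B" "b \<in> carrier B" "c \<in> carrier B" "d \<in> carrier B"
      by auto
    show "star ?D (x \<oplus>\<^bsub>?D\<^esub> y) = star ?D x \<oplus>\<^bsub>?D\<^esub> star ?D y"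
      using * by (simp add: xyz star_add M.minus_add)
    show "star ?D (x \<otimes>\<^bsub>?D\<^esub> y) = star ?D y \<otimes>\<^bsub>?D\<^esub> star ?D x"
      unfolding xyz cayley_dickson_simps prod.inject
      using * mu by algebra
  next
    fix \<alpha> x assume al: "\<alpha> \<in> carrier R" and x: "x \<in> carrier ?D"
    show "star ?D (\<alpha> \<odot>\<^bsub>?D\<^esub> x) = \<alpha> \<odot>\<^bsub>?D\<^esub> star ?D x"
      using al x by (auto simp: star_smult smult_r_minus)
  next
    fix x assume "x \<in> carrier ?D"
    then obtain a b where x: "x = (a,b)" and *: "a \<in> carrier B" "b \<in> carrier B" by auto
    obtain \<tau> where "\<tau> \<in> carrier R" "a \<oplus>\<^bsub>B\<^esub> star B a = \<tau> \<odot>\<^bsub>B\<^esub> \<one>\<^bsub>B\<^esub>"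
      using trace_scalar[OF *(1)] by blast
    then show "\<exists>\<tau>\<in>carrier R. x \<oplus>\<^bsub>?D\<^esub> star ?D x = \<tau> \<odot>\<^bsub>?D\<^esub> \<one>\<^bsub>?D\<^esub>"
      using * by (intro bexI[of _ \<tau>]) (auto simp: x M.r_neg)
    obtain \<nu> where nu: "\<nu> \<in> carrier R" "star B a \<otimes>\<^bsub>B\<^esub> a = \<nu> \<odot>\<^bsub>B\<^esub> \<one>\<^bsub>B\<^esub>"
      using norm_scalar[OF *(1)] by blast
    obtain \<nu>' where nu': "\<nu>' \<in> carrier R" "star B b \<otimes>\<^bsub>B\<^esub> b = \<nu>' \<odot>\<^bsub>B\<^esub> \<one>\<^bsub>B\<^esub>"
      using norm_scalar[OF *(2)] by blast
    have "star ?D x \<otimes>\<^bsub>?D\<^esub> x = (\<nu> \<odot>\<^bsub>B\<^esub> \<one>\<^bsub>B\<^esub> \<ominus>\<^bsub>B\<^esub> \<mu> \<odot>\<^bsub>B\<^esub> (\<nu>' \<odot>\<^bsub>B\<^esub> \<one>\<^bsub>B\<^esub>), \<zero>\<^bsub>B\<^esub>)"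
      unfolding x cayley_dickson_simps prod.inject nu(2)[symmetric] nu'(2)[symmetric]
      using * mu mult_star_comm by algebra
    also have "\<dots> = (\<nu> \<ominus> \<mu> \<otimes> \<nu>') \<odot>\<^bsub>?D\<^esub> \<one>\<^bsub>?D\<^esub>"
      using nu nu' mu by (simp add: R.minus_eq smult_l_distr smult_l_minus smult_assoc1 M.minus_eq)
    finally show "\<exists>\<nu>\<in>carrier R. star ?D x \<otimes>\<^bsub>?D\<^esub> x = \<nu> \<odot>\<^bsub>?D\<^esub> \<one>\<^bsub>?D\<^esub>"
      using nu nu' mu by blast
  qed (auto simp: star_minus)
qed


text \<open>Each step of the process costs one property: the binarions are commutative, but with a nontrivial
involution, so that the quaternions are still associative and the octonions still alternative.\<close>

lemma (in scalar_involution) cayley_dickson_commutative: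
  assumes mu: "\<mu> \<in> carrier R"
    and comm: "\<And>x y. \<lbrakk>x \<in> carrier B; y \<in> carrier B\<rbrakk> \<Longrightarrow> x \<otimes>\<^bsub>B\<^esub> y = y \<otimes>\<^bsub>B\<^esub> x"
    and triv: "\<And>x. x \<in> carrier B \<Longrightarrow> star B x = x"
    and x: "x \<in> carrier (cayley_dickson B \<mu>)" and y: "y \<in> carrier (cayley_dickson B \<mu>)"
  shows "x \<otimes>\<^bsub>cayley_dickson B \<mu>\<^esub> y = y \<otimes>\<^bsub>cayley_dickson B \<mu>\<^esub> x"
  using x y by (auto simp: triv) (simp_all add: comm M.a_comm)

lemma (in scalar_involution) cayley_dickson_associative:
  assumes mu: "\<mu> \<in> carrier R"
    and comm: "\<And>x y. \<lbrakk>x \<in> carrier B; y \<in> carrier B\<rbrakk> \<Longrightarrow> x \<otimes>\<^bsub>B\<^esub> y = y \<otimes>\<^bsub>B\<^esub> x"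
    and assoc: "\<And>x y z. \<lbrakk>x \<in> carrier B; y \<in> carrier B; z \<in> carrier B\<rbrakk>
                  \<Longrightarrow> (x \<otimes>\<^bsub>B\<^esub> y) \<otimes>\<^bsub>B\<^esub> z = x \<otimes>\<^bsub>B\<^esub> (y \<otimes>\<^bsub>B\<^esub> z)"
    and x: "x \<in> carrier (cayley_dickson B \<mu>)" and y: "y \<in> carrier (cayley_dickson B \<mu>)"
    and z: "z \<in> carrier (cayley_dickson B \<mu>)"
  shows "(x \<otimes>\<^bsub>cayley_dickson B \<mu>\<^esub> y) \<otimes>\<^bsub>cayley_dickson B \<mu>\<^esub> z
       = x \<otimes>\<^bsub>cayley_dickson B \<mu>\<^esub> (y \<otimes>\<^bsub>cayley_dickson B \<mu>\<^esub> z)"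
proof -
  obtain a b c d e f where xyz: "x = (a,b)" "y = (c,d)" "z = (e,f)" and
    *: "a \<in> carrier B" "b \<in> carrier B" "c \<in> carrier B" "d \<in> carrier B" "e \<in> carrier B" "f \<in> carrier B"
    using x y z by auto
  have lcomm: "x \<otimes>\<^bsub>B\<^esub> (y \<otimes>\<^bsub>B\<^esub> z) = y \<otimes>\<^bsub>B\<^esub> (x \<otimes>\<^bsub>B\<^esub> z)"
    if "x \<in> carrier B" "y \<in> carrier B" "z \<in> carrier B" for x y z
    using that by (metis assoc comm)
  show ?thesis
    unfolding xyz cayley_dickson_simps prod.inject
    using * mu comm lcomm by (algebra, simp add: assoc)
qed

text \<open>Since \<open>x\<^sup>* = \<tau> 1 - x\<close>, the left alternative law for \<open>x\<close> is equivalent to \<open>(x\<^sup>*x)y = x\<^sup>*(xy)\<close>. The right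
alternative law is the image of the left one under the involution.\<close>

lemma (in scalar_involution) alternativeI:
  assumes norm: "\<And>x y. \<lbrakk>x \<in> carrier B; y \<in> carrier B\<rbrakk>
      \<Longrightarrow> (star B x \<otimes>\<^bsub>B\<^esub> x) \<otimes>\<^bsub>B\<^esub> y = star B x \<otimes>\<^bsub>B\<^esub> (x \<otimes>\<^bsub>B\<^esub> y)"
  shows "alternative_algebra R B"
proof -
  have left: "(x \<otimes>\<^bsub>B\<^esub> x) \<otimes>\<^bsub>B\<^esub> y = x \<otimes>\<^bsub>B\<^esub> (x \<otimes>\<^bsub>B\<^esub> y)" if *: "x \<in> carrier B" "y \<in> carrier B" for x y
  proof -
    obtain \<tau> where t: "\<tau> \<in> carrier R" "x \<oplus>\<^bsub>B\<^esub> star B x = \<tau> \<odot>\<^bsub>B\<^esub> \<one>\<^bsub>B\<^esub>"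
      using trace_scalar[OF *(1)] by blast
    have star: "star B x = \<tau> \<odot>\<^bsub>B\<^esub> \<one>\<^bsub>B\<^esub> \<ominus>\<^bsub>B\<^esub> x" by (rule star_eq_trace_minus[OF *(1) t])
    have "(x \<otimes>\<^bsub>B\<^esub> x) \<otimes>\<^bsub>B\<^esub> y = \<tau> \<odot>\<^bsub>B\<^esub> (x \<otimes>\<^bsub>B\<^esub> y) \<ominus>\<^bsub>B\<^esub> ((\<tau> \<odot>\<^bsub>B\<^esub> \<one>\<^bsub>B\<^esub> \<ominus>\<^bsub>B\<^esub> x) \<otimes>\<^bsub>B\<^esub> x) \<otimes>\<^bsub>B\<^esub> y"
      using * t(1) by algebra
    also have "\<dots> = \<tau> \<odot>\<^bsub>B\<^esub> (x \<otimes>\<^bsub>B\<^esub> y) \<ominus>\<^bsub>B\<^esub> (\<tau> \<odot>\<^bsub>B\<^esub> \<one>\<^bsub>B\<^esub> \<ominus>\<^bsub>B\<^esub> x) \<otimes>\<^bsub>B\<^esub> (x \<otimes>\<^bsub>B\<^esub> y)"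
      using norm[OF *] by (simp add: star)
    also have "\<dots> = x \<otimes>\<^bsub>B\<^esub> (x \<otimes>\<^bsub>B\<^esub> y)"
      using * t(1) by algebra
    finally show ?thesis .
  qed
  have right: "(y \<otimes>\<^bsub>B\<^esub> x) \<otimes>\<^bsub>B\<^esub> x = y \<otimes>\<^bsub>B\<^esub> (x \<otimes>\<^bsub>B\<^esub> x)" if *: "x \<in> carrier B" "y \<in> carrier B" for x y
  proof -
    have "star B ((y \<otimes>\<^bsub>B\<^esub> x) \<otimes>\<^bsub>B\<^esub> x) = star B (y \<otimes>\<^bsub>B\<^esub> (x \<otimes>\<^bsub>B\<^esub> x))"
      using * left[of "star B x" "star B y"] by (simp add: star_mult)
    then show ?thesis
      using * star_star by (metis mult_closed)
  qed
  show ?thesis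
    by unfold_locales (simp_all add: associator_def left right M.r_neg M.minus_eq)
qed

text \<open>For \<open>x = a + vb\<close> both \<open>(x\<^sup>*x)y\<close> and \<open>x\<^sup>*(xy)\<close> are the multiple of \<open>y\<close> by the scalar \<open>n(a) - \<mu> n(b)\<close>.
Associativity of the base is needed to bring \<open>a\<^sup>*\<close> next to \<open>a\<close>, and \<open>b\<^sup>*\<close> next to \<open>b\<close>.\<close>

theorem (in scalar_involution) cayley_dickson_alternative:
  assumes mu: "\<mu> \<in> carrier R"
    and assoc: "\<And>x y z. \<lbrakk>x \<in> carrier B; y \<in> carrier B; z \<in> carrier B\<rbrakk>
                  \<Longrightarrow> (x \<otimes>\<^bsub>B\<^esub> y) \<otimes>\<^bsub>B\<^esub> z = x \<otimes>\<^bsub>B\<^esub> (y \<otimes>\<^bsub>B\<^esub> z)"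
  shows "alternative_algebra R (cayley_dickson B \<mu>)" (is "alternative_algebra R ?D")
proof -
  interpret D: scalar_involution R ?D
    by (rule cayley_dickson_scalar_involution[OF mu])
  show ?thesis
  proof (rule D.alternativeI)
    fix x y assume "x \<in> carrier ?D" "y \<in> carrier ?D"
    then obtain a b c d where xy: "x = (a,b)" "y = (c,d)" and
      *: "a \<in> carrier B" "b \<in> carrier B" "c \<in> carrier B" "d \<in> carrier B"
      by auto
    obtain \<nu> where nu: "\<nu> \<in> carrier R" "star B a \<otimes>\<^bsub>B\<^esub> a = \<nu> \<odot>\<^bsub>B\<^esub> \<one>\<^bsub>B\<^esub>"
      using norm_scalar[OF *(1)] by blast
    obtain \<nu>' where nu': "\<nu>' \<in> carrier R" "star B b \<otimes>\<^bsub>B\<^esub> b = \<nu>' \<odot>\<^bsub>B\<^esub> \<one>\<^bsub>B\<^esub>"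
      using norm_scalar[OF *(2)] by blast
    have n: "a \<otimes>\<^bsub>B\<^esub> star B a = \<nu> \<odot>\<^bsub>B\<^esub> \<one>\<^bsub>B\<^esub>" "b \<otimes>\<^bsub>B\<^esub> star B b = \<nu>' \<odot>\<^bsub>B\<^esub> \<one>\<^bsub>B\<^esub>"
      using nu nu' * mult_star_comm by auto
    \<comment> \<open>The norm laws in the form in which they apply to products bracketed to the right.\<close>
    have m: "star B a \<otimes>\<^bsub>B\<^esub> (a \<otimes>\<^bsub>B\<^esub> z) = \<nu> \<odot>\<^bsub>B\<^esub> z" "a \<otimes>\<^bsub>B\<^esub> (star B a \<otimes>\<^bsub>B\<^esub> z) = \<nu> \<odot>\<^bsub>B\<^esub> z"
            "star B b \<otimes>\<^bsub>B\<^esub> (b \<otimes>\<^bsub>B\<^esub> z) = \<nu>' \<odot>\<^bsub>B\<^esub> z" "b \<otimes>\<^bsub>B\<^esub> (star B b \<otimes>\<^bsub>B\<^esub> z) = \<nu>' \<odot>\<^bsub>B\<^esub> z"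
      if z: "z \<in> carrier B" for z
      using z * nu nu' n by (simp_all add: assoc[symmetric] mult_smult_left)
    show "(star ?D x \<otimes>\<^bsub>?D\<^esub> x) \<otimes>\<^bsub>?D\<^esub> y = star ?D x \<otimes>\<^bsub>?D\<^esub> (x \<otimes>\<^bsub>?D\<^esub> y)"
      unfolding xy cayley_dickson_simps prod.inject
      using * mu assoc nu nu' n m by algebra
  qed
qed

section \<open>Homomorphisms out of a Cayley-Dickson algebra\<close>

lemma alg_homI:
  assumes "\<And>x. x \<in> carrier A \<Longrightarrow> h x \<in> carrier B"
    and "\<And>x y. \<lbrakk>x \<in> carrier A; y \<in> carrier A\<rbrakk> \<Longrightarrow> h (x \<oplus>\<^bsub>A\<^esub> y) = h x \<oplus>\<^bsub>B\<^esub> h y"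
    and "\<And>x y. \<lbrakk>x \<in> carrier A; y \<in> carrier A\<rbrakk> \<Longrightarrow> h (x \<otimes>\<^bsub>A\<^esub> y) = h x \<otimes>\<^bsub>B\<^esub> h y"
    and "\<And>\<alpha> x. \<lbrakk>\<alpha> \<in> carrier R; x \<in> carrier A\<rbrakk> \<Longrightarrow> h (\<alpha> \<odot>\<^bsub>A\<^esub> x) = \<alpha> \<odot>\<^bsub>B\<^esub> h x"
    and "h \<one>\<^bsub>A\<^esub> = \<one>\<^bsub>B\<^esub>"
  shows "h \<in> alg_hom R A B"
  using assms by (simp add: alg_hom_def)

lemma alg_homD:
  assumes "h \<in> alg_hom R A B"
  shows "x \<in> carrier A \<Longrightarrow> h x \<in> carrier B"
    and "\<lbrakk>x \<in> carrier A; y \<in> carrier A\<rbrakk> \<Longrightarrow> h (x \<oplus>\<^bsub>A\<^esub> y) = h x \<oplus>\<^bsub>B\<^esub> h y"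
    and "\<lbrakk>x \<in> carrier A; y \<in> carrier A\<rbrakk> \<Longrightarrow> h (x \<otimes>\<^bsub>A\<^esub> y) = h x \<otimes>\<^bsub>B\<^esub> h y"
    and "\<lbrakk>\<alpha> \<in> carrier R; x \<in> carrier A\<rbrakk> \<Longrightarrow> h (\<alpha> \<odot>\<^bsub>A\<^esub> x) = \<alpha> \<odot>\<^bsub>B\<^esub> h x"
    and "h \<one>\<^bsub>A\<^esub> = \<one>\<^bsub>B\<^esub>"
  using assms by (auto simp: alg_hom_def)

lemma alg_hom_zero:
  assumes "unital_algebra R A" "unital_algebra R B" "h \<in> alg_hom R A B"
  shows "h \<zero>\<^bsub>A\<^esub> = \<zero>\<^bsub>B\<^esub>"
proof -
  interpret A: unital_algebra R A by fact
  interpret B: unital_algebra R B by fact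
  show ?thesis
    using alg_homD(4)[OF assms(3), of "\<zero>\<^bsub>R\<^esub>" "\<zero>\<^bsub>A\<^esub>"] alg_homD(1)[OF assms(3), of "\<zero>\<^bsub>A\<^esub>"] by simp
qed

lemma alg_hom_minus:
  assumes "unital_algebra R A" "unital_algebra R B" "h \<in> alg_hom R A B" "x \<in> carrier A"
  shows "h (\<ominus>\<^bsub>A\<^esub> x) = \<ominus>\<^bsub>B\<^esub> h x"
proof -
  interpret A: unital_algebra R A by fact
  interpret B: unital_algebra R B by fact
  show ?thesis
    using alg_homD(4)[OF assms(3), of "\<ominus>\<^bsub>R\<^esub> \<one>\<^bsub>R\<^esub>" x] alg_homD(1)[OF assms(3,4)] assms(4)
    by (simp add: A.smult_l_minus B.smult_l_minus)
qed

context alternative_algebra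
begin

text \<open>The following three lemmas recover the Cayley-Dickson product inside an alternative algebra. Here
\<open>v\<close> stands for the new generator, and \<open>a'\<close>, \<open>b'\<close> for the conjugates of \<open>a\<close>, \<open>b\<close>. In this one, left
alternativity for the pair \<open>a, v\<close> gives \<open>a(vy) + v(ay) = (av + va)y\<close>, and \<open>av + va = v(a' + a)\<close> is the
multiple of \<open>v\<close> by the trace.\<close>

lemma left_factor_past_generator:
  assumes "\<tau> \<in> carrier R" "a \<in> carrier A" "a' \<in> carrier A" "v \<in> carrier A" "y \<in> carrier A"
    and trace: "a \<oplus>\<^bsub>A\<^esub> a' = \<tau> \<odot>\<^bsub>A\<^esub> \<one>\<^bsub>A\<^esub>" and av: "a \<otimes>\<^bsub>A\<^esub> v = v \<otimes>\<^bsub>A\<^esub> a'"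
  shows "a \<otimes>\<^bsub>A\<^esub> (v \<otimes>\<^bsub>A\<^esub> y) = v \<otimes>\<^bsub>A\<^esub> (a' \<otimes>\<^bsub>A\<^esub> y)"
proof -
  have "a \<otimes>\<^bsub>A\<^esub> (v \<otimes>\<^bsub>A\<^esub> y) = (a \<otimes>\<^bsub>A\<^esub> (v \<otimes>\<^bsub>A\<^esub> y) \<oplus>\<^bsub>A\<^esub> v \<otimes>\<^bsub>A\<^esub> (a \<otimes>\<^bsub>A\<^esub> y)) \<ominus>\<^bsub>A\<^esub> v \<otimes>\<^bsub>A\<^esub> (a \<otimes>\<^bsub>A\<^esub> y)"
    using assms(1-5) by algebra
  also have "\<dots> = ((a \<otimes>\<^bsub>A\<^esub> v) \<otimes>\<^bsub>A\<^esub> y \<oplus>\<^bsub>A\<^esub> (v \<otimes>\<^bsub>A\<^esub> a) \<otimes>\<^bsub>A\<^esub> y) \<ominus>\<^bsub>A\<^esub> v \<otimes>\<^bsub>A\<^esub> (a \<otimes>\<^bsub>A\<^esub> y)"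
    using assms(1-5) by (simp add: left_alternative_linearized)
  also have "\<dots> = (v \<otimes>\<^bsub>A\<^esub> (a \<oplus>\<^bsub>A\<^esub> a')) \<otimes>\<^bsub>A\<^esub> y \<ominus>\<^bsub>A\<^esub> v \<otimes>\<^bsub>A\<^esub> (a \<otimes>\<^bsub>A\<^esub> y)"
    unfolding av using assms(1-5) by algebra
  also have "\<dots> = v \<otimes>\<^bsub>A\<^esub> ((a \<oplus>\<^bsub>A\<^esub> a') \<otimes>\<^bsub>A\<^esub> y) \<ominus>\<^bsub>A\<^esub> v \<otimes>\<^bsub>A\<^esub> (a \<otimes>\<^bsub>A\<^esub> y)"
    unfolding trace using assms(1-5) by algebra
  also have "\<dots> = v \<otimes>\<^bsub>A\<^esub> (a' \<otimes>\<^bsub>A\<^esub> y)"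
    using assms(1-5) by algebra
  finally show ?thesis .
qed

text \<open>Write \<open>va\<close> as \<open>a'v\<close> and exchange \<open>v\<close> and \<open>b\<close> by right alternativity; again \<open>vb + bv\<close> is a scalar
multiple of \<open>v\<close>.\<close>

lemma right_factor_into_generator:
  assumes "\<tau> \<in> carrier R" "a \<in> carrier A" "a' \<in> carrier A" "b \<in> carrier A" "b' \<in> carrier A" "v \<in> carrier A"
    and av: "a' \<otimes>\<^bsub>A\<^esub> v = v \<otimes>\<^bsub>A\<^esub> a"
    and trace: "b \<oplus>\<^bsub>A\<^esub> b' = \<tau> \<odot>\<^bsub>A\<^esub> \<one>\<^bsub>A\<^esub>" and bv: "b \<otimes>\<^bsub>A\<^esub> v = v \<otimes>\<^bsub>A\<^esub> b'"
    and abv: "(a' \<otimes>\<^bsub>A\<^esub> b) \<otimes>\<^bsub>A\<^esub> v = v \<otimes>\<^bsub>A\<^esub> (b' \<otimes>\<^bsub>A\<^esub> a)"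
  shows "(v \<otimes>\<^bsub>A\<^esub> a) \<otimes>\<^bsub>A\<^esub> b = v \<otimes>\<^bsub>A\<^esub> (b \<otimes>\<^bsub>A\<^esub> a)"
proof -
  have "(v \<otimes>\<^bsub>A\<^esub> a) \<otimes>\<^bsub>A\<^esub> b = ((a' \<otimes>\<^bsub>A\<^esub> v) \<otimes>\<^bsub>A\<^esub> b \<oplus>\<^bsub>A\<^esub> (a' \<otimes>\<^bsub>A\<^esub> b) \<otimes>\<^bsub>A\<^esub> v) \<ominus>\<^bsub>A\<^esub> (a' \<otimes>\<^bsub>A\<^esub> b) \<otimes>\<^bsub>A\<^esub> v"
    unfolding av using assms(1-6) by algebra
  also have "\<dots> = (a' \<otimes>\<^bsub>A\<^esub> (v \<otimes>\<^bsub>A\<^esub> b) \<oplus>\<^bsub>A\<^esub> a' \<otimes>\<^bsub>A\<^esub> (b \<otimes>\<^bsub>A\<^esub> v)) \<ominus>\<^bsub>A\<^esub> v \<otimes>\<^bsub>A\<^esub> (b' \<otimes>\<^bsub>A\<^esub> a)"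
    unfolding right_alternative_linearized[OF assms(3,6,4)] unfolding abv ..
  also have "\<dots> = a' \<otimes>\<^bsub>A\<^esub> (v \<otimes>\<^bsub>A\<^esub> (b \<oplus>\<^bsub>A\<^esub> b')) \<ominus>\<^bsub>A\<^esub> v \<otimes>\<^bsub>A\<^esub> (b' \<otimes>\<^bsub>A\<^esub> a)"
    unfolding bv using assms(1-6) by algebra
  also have "\<dots> = \<tau> \<odot>\<^bsub>A\<^esub> (a' \<otimes>\<^bsub>A\<^esub> v) \<ominus>\<^bsub>A\<^esub> v \<otimes>\<^bsub>A\<^esub> (b' \<otimes>\<^bsub>A\<^esub> a)"
    unfolding trace using assms(1-6) by algebra
  also have "\<dots> = v \<otimes>\<^bsub>A\<^esub> ((\<tau> \<odot>\<^bsub>A\<^esub> \<one>\<^bsub>A\<^esub>) \<otimes>\<^bsub>A\<^esub> a) \<ominus>\<^bsub>A\<^esub> v \<otimes>\<^bsub>A\<^esub> (b' \<otimes>\<^bsub>A\<^esub> a)"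
    unfolding av using assms(1-6) by algebra
  also have "\<dots> = v \<otimes>\<^bsub>A\<^esub> (b \<otimes>\<^bsub>A\<^esub> a)"
    unfolding trace[symmetric] using assms(1-6) by algebra
  finally show ?thesis .
qed

text \<open>Right alternativity for \<open>a\<close> and \<open>vb\<close> reduces \<open>(va)(vb)\<close> to products in which \<open>v\<close> is applied twice from
the left, which amounts to multiplication by \<open>\<mu>\<close>: \<open>(va)(vb) = \<mu>(a'b + ab - ba) = \<mu> ba'\<close>. The
last equality is the scalarity of \<open>a + a'\<close>.\<close>

lemma generator_pair_mult:
  assumes "\<tau> \<in> carrier R" "\<mu> \<in> carrier R" "a \<in> carrier A" "a' \<in> carrier A" "b \<in> carrier A" "v \<in> carrier A"
    and vv: "v \<otimes>\<^bsub>A\<^esub> v = \<mu> \<odot>\<^bsub>A\<^esub> \<one>\<^bsub>A\<^esub>" and trace: "a \<oplus>\<^bsub>A\<^esub> a' = \<tau> \<odot>\<^bsub>A\<^esub> \<one>\<^bsub>A\<^esub>"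
    and avb: "a \<otimes>\<^bsub>A\<^esub> (v \<otimes>\<^bsub>A\<^esub> b) = v \<otimes>\<^bsub>A\<^esub> (a' \<otimes>\<^bsub>A\<^esub> b)"
    and vba: "(v \<otimes>\<^bsub>A\<^esub> b) \<otimes>\<^bsub>A\<^esub> a = v \<otimes>\<^bsub>A\<^esub> (a \<otimes>\<^bsub>A\<^esub> b)"
  shows "(v \<otimes>\<^bsub>A\<^esub> a) \<otimes>\<^bsub>A\<^esub> (v \<otimes>\<^bsub>A\<^esub> b) = \<mu> \<odot>\<^bsub>A\<^esub> (b \<otimes>\<^bsub>A\<^esub> a')"
proof -
  have vv': "v \<otimes>\<^bsub>A\<^esub> (v \<otimes>\<^bsub>A\<^esub> x) = \<mu> \<odot>\<^bsub>A\<^esub> x" if "x \<in> carrier A" for x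
    using that assms(1-6) vv left_alternative'[of v x] by (simp add: mult_smult_left)
  have "(v \<otimes>\<^bsub>A\<^esub> a) \<otimes>\<^bsub>A\<^esub> (v \<otimes>\<^bsub>A\<^esub> b)
      = ((v \<otimes>\<^bsub>A\<^esub> a) \<otimes>\<^bsub>A\<^esub> (v \<otimes>\<^bsub>A\<^esub> b) \<oplus>\<^bsub>A\<^esub> (v \<otimes>\<^bsub>A\<^esub> (v \<otimes>\<^bsub>A\<^esub> b)) \<otimes>\<^bsub>A\<^esub> a) \<ominus>\<^bsub>A\<^esub> (v \<otimes>\<^bsub>A\<^esub> (v \<otimes>\<^bsub>A\<^esub> b)) \<otimes>\<^bsub>A\<^esub> a"
    using assms(1-6) by algebra
  also have "\<dots> = (v \<otimes>\<^bsub>A\<^esub> (v \<otimes>\<^bsub>A\<^esub> (a' \<otimes>\<^bsub>A\<^esub> b)) \<oplus>\<^bsub>A\<^esub> v \<otimes>\<^bsub>A\<^esub> (v \<otimes>\<^bsub>A\<^esub> (a \<otimes>\<^bsub>A\<^esub> b))) \<ominus>\<^bsub>A\<^esub> \<mu> \<odot>\<^bsub>A\<^esub> (b \<otimes>\<^bsub>A\<^esub> a)"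
    using assms(1-6) right_alternative_linearized[of v a "v \<otimes>\<^bsub>A\<^esub> b", unfolded avb vba]
    by (simp add: vv' mult_smult_left)
  also have "\<dots> = \<mu> \<odot>\<^bsub>A\<^esub> ((a \<oplus>\<^bsub>A\<^esub> a') \<otimes>\<^bsub>A\<^esub> b) \<ominus>\<^bsub>A\<^esub> \<mu> \<odot>\<^bsub>A\<^esub> (b \<otimes>\<^bsub>A\<^esub> a)"
    using assms(1-6) vv' by algebra
  also have "\<dots> = \<mu> \<odot>\<^bsub>A\<^esub> (b \<otimes>\<^bsub>A\<^esub> (a \<oplus>\<^bsub>A\<^esub> a')) \<ominus>\<^bsub>A\<^esub> \<mu> \<odot>\<^bsub>A\<^esub> (b \<otimes>\<^bsub>A\<^esub> a)"
    unfolding trace using assms(1-6) by algebra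
  also have "\<dots> = \<mu> \<odot>\<^bsub>A\<^esub> (b \<otimes>\<^bsub>A\<^esub> a')"
    using assms(1-6) by algebra
  finally show ?thesis .
qed

end

definition cd_lift :: "('a, 'm) ring_scheme \<Rightarrow> ('b \<Rightarrow> 'a) \<Rightarrow> 'a \<Rightarrow> 'b \<times> 'b \<Rightarrow> 'a"
  where "cd_lift A \<phi> v = (\<lambda>(a, b). \<phi> a \<oplus>\<^bsub>A\<^esub> v \<otimes>\<^bsub>A\<^esub> \<phi> b)"

lemma cd_lift_pair [simp]: "cd_lift A \<phi> v (a, b) = \<phi> a \<oplus>\<^bsub>A\<^esub> v \<otimes>\<^bsub>A\<^esub> \<phi> b"
  by (simp add: cd_lift_def)

text \<open>The Cayley-Dickson algebra is universal among the alternative algebras that contain a homomorphic image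
of \<open>B\<close> together with an element \<open>v\<close> of square \<open>\<mu>\<close> past which the elements of \<open>B\<close> move by conjugation.
Besides \<open>\<phi> a \<cdot> \<phi> c\<close>, a product of two values in \<open>A\<close> has three terms, one for each of the previous
lemmas.\<close>

theorem (in alternative_algebra) cayley_dickson_lift:
  fixes B :: "('k, 'b, 'l) star_algebra_scheme"
  assumes B: "scalar_involution R B" and \<phi>: "\<phi> \<in> alg_hom R B A"
    and mu: "\<mu> \<in> carrier R" and v: "v \<in> carrier A" and vv: "v \<otimes>\<^bsub>A\<^esub> v = \<mu> \<odot>\<^bsub>A\<^esub> \<one>\<^bsub>A\<^esub>"
    and commute: "\<And>b. b \<in> carrier B \<Longrightarrow> \<phi> b \<otimes>\<^bsub>A\<^esub> v = v \<otimes>\<^bsub>A\<^esub> \<phi> (star B b)"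
  shows "cd_lift A \<phi> v \<in> alg_hom R (cayley_dickson B \<mu>) A"
proof -
  interpret B: scalar_involution R B by fact
  note hom [simp] = alg_homD[OF \<phi>]
  have [simp]: "\<phi> \<zero>\<^bsub>B\<^esub> = \<zero>\<^bsub>A\<^esub>"
    by (rule alg_hom_zero[OF B.unital_algebra_axioms unital_algebra_axioms \<phi>])
  have trace: "\<exists>\<tau>\<in>carrier R. \<phi> a \<oplus>\<^bsub>A\<^esub> \<phi> (star B a) = \<tau> \<odot>\<^bsub>A\<^esub> \<one>\<^bsub>A\<^esub>" if "a \<in> carrier B" for a
  proof -
    obtain \<tau> where t: "\<tau> \<in> carrier R" "a \<oplus>\<^bsub>B\<^esub> star B a = \<tau> \<odot>\<^bsub>B\<^esub> \<one>\<^bsub>B\<^esub>"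
      using B.trace_scalar \<open>a \<in> carrier B\<close> by blast
    then have "\<phi> a \<oplus>\<^bsub>A\<^esub> \<phi> (star B a) = \<tau> \<odot>\<^bsub>A\<^esub> \<one>\<^bsub>A\<^esub>"
      using that hom(2)[of a "star B a"] hom(4)[of \<tau> "\<one>\<^bsub>B\<^esub>"] by simp
    then show ?thesis using t by blast
  qed
  have left: "\<phi> a \<otimes>\<^bsub>A\<^esub> (v \<otimes>\<^bsub>A\<^esub> \<phi> b) = v \<otimes>\<^bsub>A\<^esub> (\<phi> (star B a) \<otimes>\<^bsub>A\<^esub> \<phi> b)"
    if "a \<in> carrier B" "b \<in> carrier B" for a b
    using trace[OF that(1)] that v commute by (auto intro: left_factor_past_generator)
  have right: "(v \<otimes>\<^bsub>A\<^esub> \<phi> a) \<otimes>\<^bsub>A\<^esub> \<phi> b = v \<otimes>\<^bsub>A\<^esub> (\<phi> b \<otimes>\<^bsub>A\<^esub> \<phi> a)"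
    if ab: "a \<in> carrier B" "b \<in> carrier B" for a b
  proof -
    obtain \<tau> where t: "\<tau> \<in> carrier R" "\<phi> b \<oplus>\<^bsub>A\<^esub> \<phi> (star B b) = \<tau> \<odot>\<^bsub>A\<^esub> \<one>\<^bsub>A\<^esub>"
      using trace[OF ab(2)] by blast
    show ?thesis
      using ab v t commute[of "star B a"] commute[of b] commute[of "star B a \<otimes>\<^bsub>B\<^esub> b"]
      by (intro right_factor_into_generator[of \<tau> _ "\<phi> (star B a)" _ "\<phi> (star B b)"]) (simp_all add: B.star_mult)
  qed
  have square: "(v \<otimes>\<^bsub>A\<^esub> \<phi> a) \<otimes>\<^bsub>A\<^esub> (v \<otimes>\<^bsub>A\<^esub> \<phi> b) = \<mu> \<odot>\<^bsub>A\<^esub> (\<phi> b \<otimes>\<^bsub>A\<^esub> \<phi> (star B a))"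
    if ab: "a \<in> carrier B" "b \<in> carrier B" for a b
  proof -
    obtain \<tau> where t: "\<tau> \<in> carrier R" "\<phi> a \<oplus>\<^bsub>A\<^esub> \<phi> (star B a) = \<tau> \<odot>\<^bsub>A\<^esub> \<one>\<^bsub>A\<^esub>"
      using trace[OF ab(1)] by blast
    show ?thesis
      using ab v vv mu t left right by (intro generator_pair_mult[of \<tau>]) simp_all
  qed
  show ?thesis
  proof (rule alg_homI)
    fix x y assume "x \<in> carrier (cayley_dickson B \<mu>)" "y \<in> carrier (cayley_dickson B \<mu>)"
    then obtain a b c d where xy: "x = (a,b)" "y = (c,d)" and
      *: "a \<in> carrier B" "b \<in> carrier B" "c \<in> carrier B" "d \<in> carrier B"
      by auto
    have car: "\<phi> a \<in> carrier A" "\<phi> b \<in> carrier A" "\<phi> c \<in> carrier A" "\<phi> d \<in> carrier A"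
       "\<phi> (star B a) \<in> carrier A" "\<phi> (star B b) \<in> carrier A"
      using * by auto
    show "cd_lift A \<phi> v (x \<oplus>\<^bsub>cayley_dickson B \<mu>\<^esub> y) = cd_lift A \<phi> v x \<oplus>\<^bsub>A\<^esub> cd_lift A \<phi> v y"
      using * v by (simp add: xy mult_add_right M.a_ac)
    have "cd_lift A \<phi> v (x \<otimes>\<^bsub>cayley_dickson B \<mu>\<^esub> y)
       = (\<phi> a \<otimes>\<^bsub>A\<^esub> \<phi> c \<oplus>\<^bsub>A\<^esub> (v \<otimes>\<^bsub>A\<^esub> \<phi> b) \<otimes>\<^bsub>A\<^esub> (v \<otimes>\<^bsub>A\<^esub> \<phi> d))
         \<oplus>\<^bsub>A\<^esub> (\<phi> a \<otimes>\<^bsub>A\<^esub> (v \<otimes>\<^bsub>A\<^esub> \<phi> d) \<oplus>\<^bsub>A\<^esub> (v \<otimes>\<^bsub>A\<^esub> \<phi> b) \<otimes>\<^bsub>A\<^esub> \<phi> c)"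
      using * v mu by (simp add: xy left right square mult_add_right)
    also have "\<dots> = cd_lift A \<phi> v x \<otimes>\<^bsub>A\<^esub> cd_lift A \<phi> v y"
      unfolding xy cd_lift_pair using car v by algebra
    finally show "cd_lift A \<phi> v (x \<otimes>\<^bsub>cayley_dickson B \<mu>\<^esub> y) = cd_lift A \<phi> v x \<otimes>\<^bsub>A\<^esub> cd_lift A \<phi> v y" .
  next
    fix \<alpha> x assume "\<alpha> \<in> carrier R" "x \<in> carrier (cayley_dickson B \<mu>)"
    then show "cd_lift A \<phi> v (\<alpha> \<odot>\<^bsub>cayley_dickson B \<mu>\<^esub> x) = \<alpha> \<odot>\<^bsub>A\<^esub> cd_lift A \<phi> v x"
      using v by (auto simp: smult_r_distr mult_smult_right)
  qed (use v in auto)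
qed

section \<open>Generation by a subset\<close>

definition subalgebra :: "('k, 'm) ring_scheme \<Rightarrow> ('k, 'a, 'n) module_scheme \<Rightarrow> 'a set \<Rightarrow> bool"
  where "subalgebra R A S \<longleftrightarrow>
    submodule S R A \<and> \<one>\<^bsub>A\<^esub> \<in> S \<and> (\<forall>x\<in>S. \<forall>y\<in>S. x \<otimes>\<^bsub>A\<^esub> y \<in> S)"

lemma alg_generated_by_iff:
  "alg_generated_by R A X \<longleftrightarrow>
     X \<subseteq> carrier A \<and> (\<forall>S. subalgebra R A S \<and> X \<subseteq> S \<longrightarrow> S = carrier A)"
  by (auto simp: alg_generated_by_def subalgebra_def)

lemma (in unital_algebra) subalgebraI:
  assumes "S \<subseteq> carrier A" "\<one>\<^bsub>A\<^esub> \<in> S"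
    and add: "\<And>x y. \<lbrakk>x \<in> S; y \<in> S\<rbrakk> \<Longrightarrow> x \<oplus>\<^bsub>A\<^esub> y \<in> S"
    and mult: "\<And>x y. \<lbrakk>x \<in> S; y \<in> S\<rbrakk> \<Longrightarrow> x \<otimes>\<^bsub>A\<^esub> y \<in> S"
    and smult: "\<And>\<alpha> x. \<lbrakk>\<alpha> \<in> carrier R; x \<in> S\<rbrakk> \<Longrightarrow> \<alpha> \<odot>\<^bsub>A\<^esub> x \<in> S"
  shows "subalgebra R A S"
proof -
  have "\<zero>\<^bsub>A\<^esub> \<in> S" using smult[of "\<zero>" "\<one>\<^bsub>A\<^esub>"] assms(1,2) by auto
  moreover have "\<ominus>\<^bsub>A\<^esub> x \<in> S" if "x \<in> S" for x
    using smult[of "\<ominus> \<one>" x] that assms(1) by (auto simp: smult_l_minus subset_iff)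
  ultimately show ?thesis
    using assms by (auto simp: subalgebra_def intro!: submoduleI)
qed

lemma (in unital_algebra) subalgebraD:
  assumes "subalgebra R A S"
  shows "S \<subseteq> carrier A" "\<one>\<^bsub>A\<^esub> \<in> S" "\<zero>\<^bsub>A\<^esub> \<in> S"
    and "\<lbrakk>x \<in> S; y \<in> S\<rbrakk> \<Longrightarrow> x \<oplus>\<^bsub>A\<^esub> y \<in> S"
    and "\<lbrakk>x \<in> S; y \<in> S\<rbrakk> \<Longrightarrow> x \<otimes>\<^bsub>A\<^esub> y \<in> S"
    and "\<lbrakk>\<alpha> \<in> carrier R; x \<in> S\<rbrakk> \<Longrightarrow> \<alpha> \<odot>\<^bsub>A\<^esub> x \<in> S"
proof -
  have S: "submodule S R A" using assms by (simp add: subalgebra_def)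
  show *: "S \<subseteq> carrier A" "\<one>\<^bsub>A\<^esub> \<in> S"
    and **: "\<lbrakk>\<alpha> \<in> carrier R; x \<in> S\<rbrakk> \<Longrightarrow> \<alpha> \<odot>\<^bsub>A\<^esub> x \<in> S" for \<alpha> x
    using submoduleE[OF S] assms by (auto simp: subalgebra_def)
  show "\<lbrakk>x \<in> S; y \<in> S\<rbrakk> \<Longrightarrow> x \<oplus>\<^bsub>A\<^esub> y \<in> S" "\<lbrakk>x \<in> S; y \<in> S\<rbrakk> \<Longrightarrow> x \<otimes>\<^bsub>A\<^esub> y \<in> S"
    using submoduleE[OF S] assms by (auto simp: subalgebra_def)
  show "\<zero>\<^bsub>A\<^esub> \<in> S" using **[of "\<zero>" "\<one>\<^bsub>A\<^esub>"] * by auto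
qed

lemma subalgebra_vimage:
  assumes "unital_algebra R A" "unital_algebra R B" "h \<in> alg_hom R A B" "subalgebra R B S"
  shows "subalgebra R A {x \<in> carrier A. h x \<in> S}"
proof -
  interpret A: unital_algebra R A by fact
  interpret B: unital_algebra R B by fact
  note S = B.subalgebraD[OF assms(4)]
  show ?thesis
    by (rule A.subalgebraI) (use S in \<open>auto simp: alg_homD[OF assms(3)]\<close>)
qed

lemma subalgebra_image:
  assumes "unital_algebra R A" "unital_algebra R B" "h \<in> alg_hom R A B"
  shows "subalgebra R B (h ` carrier A)"
proof -
  interpret A: unital_algebra R A by fact
  interpret B: unital_algebra R B by fact
  note h = alg_homD[OF assms(3)]
  show ?thesis
  proof (rule B.subalgebraI)
    show "\<one>\<^bsub>B\<^esub> \<in> h ` carrier A" using h(5) by (metis A.one_closed image_eqI)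
  qed (auto simp: h simp flip: h(2-4))
qed

lemma subalgebra_equalizer:
  assumes "unital_algebra R A" "unital_algebra R B" "g \<in> alg_hom R A B" "h \<in> alg_hom R A B"
  shows "subalgebra R A {x \<in> carrier A. g x = h x}"
proof -
  interpret A: unital_algebra R A by fact
  interpret B: unital_algebra R B by fact
  show ?thesis
    by (rule A.subalgebraI) (auto simp: alg_homD[OF assms(3)] alg_homD[OF assms(4)])
qed

lemma alg_hom_eq_on_generators:
  assumes "unital_algebra R A" "unital_algebra R B" "g \<in> alg_hom R A B" "h \<in> alg_hom R A B"
    and "alg_generated_by R A X" "\<And>x. x \<in> X \<Longrightarrow> g x = h x" "x \<in> carrier A"
  shows "g x = h x"
proof -
  have "X \<subseteq> {x \<in> carrier A. g x = h x}"
    using assms(5,6) by (auto simp: alg_generated_by_iff)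
  then have "{x \<in> carrier A. g x = h x} = carrier A"
    using subalgebra_equalizer[OF assms(1-4)] assms(5) unfolding alg_generated_by_iff by metis
  then show ?thesis using assms(7) by blast
qed

lemma alg_hom_surj_on_generators:
  assumes "unital_algebra R A" "unital_algebra R B" "h \<in> alg_hom R A B"
    and "alg_generated_by R B X" "X \<subseteq> h ` carrier A"
  shows "h ` carrier A = carrier B"
  using subalgebra_image[OF assms(1-3)] assms(4,5) unfolding alg_generated_by_iff by blast

lemma alg_generated_by_image:
  assumes "unital_algebra R A" "unital_algebra R B" "h \<in> alg_hom R A B"
    and surj: "h ` carrier A = carrier B" and gen: "alg_generated_by R A X"
  shows "alg_generated_by R B (h ` X)"
  unfolding alg_generated_by_iff
proof (intro conjI allI impI)
  show "h ` X \<subseteq> carrier B"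
    using gen alg_homD(1)[OF assms(3)] by (auto simp: alg_generated_by_iff)
next
  fix S assume S: "subalgebra R B S \<and> h ` X \<subseteq> S"
  have "subalgebra R A {x \<in> carrier A. h x \<in> S}"
    using subalgebra_vimage[OF assms(1-3)] S by blast
  moreover have "X \<subseteq> {x \<in> carrier A. h x \<in> S}"
    using gen S by (auto simp: alg_generated_by_iff)
  ultimately have "{x \<in> carrier A. h x \<in> S} = carrier A"
    using gen unfolding alg_generated_by_iff by metis
  then have "h x \<in> S" if "x \<in> carrier A" for x using that by blast
  then have "carrier B \<subseteq> S" unfolding surj[symmetric] by blast
  moreover have "S \<subseteq> carrier B"
    using unital_algebra.subalgebraD(1)[OF assms(2)] S by blast
  ultimately show "S = carrier B" by blast
qed

lemma alg_hom_comp: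
  assumes "g \<in> alg_hom R A B" "h \<in> alg_hom R B C"
  shows "h \<circ> g \<in> alg_hom R A C"
  by (rule alg_homI) (simp_all add: alg_homD[OF assms(1)] alg_homD[OF assms(2)])

lemma alg_hom_id: "id \<in> alg_hom R A A"
  by (rule alg_homI) simp_all

text \<open>Both composites agree with the identity on generators.\<close>

lemma alg_iso_of_generators:
  assumes A: "unital_algebra R A" and B: "unital_algebra R B"
    and h: "h \<in> alg_hom R A B" and g: "g \<in> alg_hom R B A"
    and X: "alg_generated_by R A X" and Y: "alg_generated_by R B Y"
    and gh: "\<And>x. x \<in> X \<Longrightarrow> g (h x) = x" and hg: "\<And>y. y \<in> Y \<Longrightarrow> h (g y) = y"
  shows "h \<in> alg_iso R A B"
proof -
  have 1: "g (h x) = x" if "x \<in> carrier A" for x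
    using alg_hom_eq_on_generators[OF A A alg_hom_comp[OF h g] alg_hom_id X _ that] gh by simp
  have 2: "h (g y) = y" if "y \<in> carrier B" for y
    using alg_hom_eq_on_generators[OF B B alg_hom_comp[OF g h] alg_hom_id Y _ that] hg by simp
  have "bij_betw h (carrier A) (carrier B)"
    by (rule bij_betwI[where g = g]) (use 1 2 alg_homD(1)[OF h] alg_homD(1)[OF g] in auto)
  then show ?thesis using h by (simp add: alg_iso_def)
qed

text \<open>Every element is \<open>a + v \<cdot> b\<close> with \<open>a\<close> and \<open>b\<close> in the base.\<close>

theorem (in scalar_involution) cayley_dickson_generated:
  assumes mu: "\<mu> \<in> carrier R" and gen: "alg_generated_by R B X"
  shows "alg_generated_by R (cayley_dickson B \<mu>) (insert (basic_gen B) (cd_embed B ` X))"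
    (is "alg_generated_by R ?D _")
proof -
  interpret D: scalar_involution R ?D by (rule cayley_dickson_scalar_involution[OF mu])
  have embed: "cd_embed B \<in> alg_hom R B ?D"
    by (rule alg_homI) (use mu in \<open>simp_all add: cd_embed_def\<close>)
  have X: "X \<subseteq> carrier B" using gen by (simp add: alg_generated_by_iff)
  show ?thesis
    unfolding alg_generated_by_iff
  proof (intro conjI allI impI)
    show "insert (basic_gen B) (cd_embed B ` X) \<subseteq> carrier ?D"
      using X by (auto simp: basic_gen_def cd_embed_def)
  next
    fix S assume S: "subalgebra R ?D S \<and> insert (basic_gen B) (cd_embed B ` X) \<subseteq> S"
    then have sub: "subalgebra R ?D S" by simp
    note SD = D.subalgebraD[OF sub]
    have "X \<subseteq> {x \<in> carrier B. cd_embed B x \<in> S}" using X S by auto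
    then have "{x \<in> carrier B. cd_embed B x \<in> S} = carrier B"
      using subalgebra_vimage[OF unital_algebra_axioms D.unital_algebra_axioms embed sub] gen
      unfolding alg_generated_by_iff by metis
    then have base: "(b, \<zero>\<^bsub>B\<^esub>) \<in> S" if "b \<in> carrier B" for b
      using that by (auto simp: cd_embed_def)
    have "(a, b) \<in> S" if "a \<in> carrier B" "b \<in> carrier B" for a b
    proof -
      have "(\<zero>\<^bsub>B\<^esub>, \<one>\<^bsub>B\<^esub>) \<otimes>\<^bsub>?D\<^esub> (b, \<zero>\<^bsub>B\<^esub>) \<in> S"
        using S base[OF that(2)] by (intro SD(5)) (auto simp: basic_gen_def)
      then have "(a, \<zero>\<^bsub>B\<^esub>) \<oplus>\<^bsub>?D\<^esub> (\<zero>\<^bsub>B\<^esub>, b) \<in> S"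
        using that mu base[OF that(1)] by (intro SD(4)) simp_all
      then show ?thesis using that by simp
    qed
    then show "S = carrier ?D" using SD(1) by auto
  qed
qed

section \<open>The octonion algebra\<close>

context cring
begin

lemma scalar_alg_simps [simp]:
  "carrier (scalar_alg R) = carrier R" "mult (scalar_alg R) = mult R" "one (scalar_alg R) = \<one>"
  "zero (scalar_alg R) = \<zero>" "add (scalar_alg R) = add R" "smult (scalar_alg R) = mult R"
  "star (scalar_alg R) x = x"
  by (simp_all add: scalar_alg_def)

lemma scalar_alg_scalar_involution: "scalar_involution R (scalar_alg R)"
proof -
  have "abelian_group (scalar_alg R)"
    by (rule abelian_groupI) (auto simp: a_ac intro: bexI[of _ "\<ominus> _"] l_neg)
  then have "module R (scalar_alg R)"
    by (rule moduleI[OF is_cring]) (auto simp: l_distr r_distr m_assoc)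
  then show ?thesis
    unfolding scalar_involution_def unital_algebra_def
    by (auto simp: unital_algebra_axioms_def scalar_involution_axioms_def l_distr r_distr m_assoc m_lcomm
        intro: m_comm)
qed

lemma scalar_alg_generated: "alg_generated_by R (scalar_alg R) {}"
proof -
  interpret S: scalar_involution R "scalar_alg R" by (rule scalar_alg_scalar_involution)
  show ?thesis
    unfolding alg_generated_by_iff
  proof (intro conjI allI impI)
    fix S assume S: "subalgebra R (scalar_alg R) S \<and> {} \<subseteq> S"
    then have "x \<otimes> \<one> \<in> S" if "x \<in> carrier R" for x
      using S.subalgebraD(6)[of S x "\<one>"] S.subalgebraD(2)[of S] that by simp
    then show "S = carrier (scalar_alg R)"
      using S S.subalgebraD(1)[of S] by (auto simp del: r_one) (metis r_one)
  qed simp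
qed

end

locale octonions = cring R for R :: "('k, 'm) ring_scheme" (structure) +
  fixes \<mu>1 \<mu>2 \<mu>3
  assumes mu1: "\<mu>1 \<in> carrier R" and mu2: "\<mu>2 \<in> carrier R" and mu3: "\<mu>3 \<in> carrier R"
begin

sublocale Sc: scalar_involution R "scalar_alg R"
  by (rule scalar_alg_scalar_involution)

sublocale Bin: scalar_involution R "binarion_alg R \<mu>1"
  unfolding binarion_alg_def by (rule Sc.cayley_dickson_scalar_involution[OF mu1])

sublocale Quat: scalar_involution R "quaternion_alg R \<mu>1 \<mu>2"
  unfolding quaternion_alg_def by (rule Bin.cayley_dickson_scalar_involution[OF mu2])

sublocale Oct: scalar_involution R "octonion_alg R \<mu>1 \<mu>2 \<mu>3"
  unfolding octonion_alg_def by (rule Quat.cayley_dickson_scalar_involution[OF mu3])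

lemma binarion_commutative:
  "\<lbrakk>x \<in> carrier (binarion_alg R \<mu>1); y \<in> carrier (binarion_alg R \<mu>1)\<rbrakk>
    \<Longrightarrow> x \<otimes>\<^bsub>binarion_alg R \<mu>1\<^esub> y = y \<otimes>\<^bsub>binarion_alg R \<mu>1\<^esub> x"
  unfolding binarion_alg_def
  by (rule Sc.cayley_dickson_commutative) (simp_all add: mu1 m_comm)

lemma binarion_associative:
  "\<lbrakk>x \<in> carrier (binarion_alg R \<mu>1); y \<in> carrier (binarion_alg R \<mu>1); z \<in> carrier (binarion_alg R \<mu>1)\<rbrakk>
    \<Longrightarrow> (x \<otimes>\<^bsub>binarion_alg R \<mu>1\<^esub> y) \<otimes>\<^bsub>binarion_alg R \<mu>1\<^esub> z
      = x \<otimes>\<^bsub>binarion_alg R \<mu>1\<^esub> (y \<otimes>\<^bsub>binarion_alg R \<mu>1\<^esub> z)"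
  unfolding binarion_alg_def
  by (rule Sc.cayley_dickson_associative) (simp_all add: mu1 m_ac)

lemma quaternion_associative:
  "\<lbrakk>x \<in> carrier (quaternion_alg R \<mu>1 \<mu>2); y \<in> carrier (quaternion_alg R \<mu>1 \<mu>2);
    z \<in> carrier (quaternion_alg R \<mu>1 \<mu>2)\<rbrakk>
    \<Longrightarrow> (x \<otimes>\<^bsub>quaternion_alg R \<mu>1 \<mu>2\<^esub> y) \<otimes>\<^bsub>quaternion_alg R \<mu>1 \<mu>2\<^esub> z
      = x \<otimes>\<^bsub>quaternion_alg R \<mu>1 \<mu>2\<^esub> (y \<otimes>\<^bsub>quaternion_alg R \<mu>1 \<mu>2\<^esub> z)"
  unfolding quaternion_alg_def
  by (rule Bin.cayley_dickson_associative[OF mu2 binarion_commutative binarion_associative])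

theorem octonion_alternative: "alternative_algebra R (octonion_alg R \<mu>1 \<mu>2 \<mu>3)"
  unfolding octonion_alg_def
  by (rule Quat.cayley_dickson_alternative[OF mu3 quaternion_associative])

theorem octonion_generated:
  "alg_generated_by R (octonion_alg R \<mu>1 \<mu>2 \<mu>3) (range (oct_gen R \<mu>1 \<mu>2))"
proof -
  have bin: "alg_generated_by R (binarion_alg R \<mu>1) {basic_gen (scalar_alg R)}"
    unfolding binarion_alg_def using Sc.cayley_dickson_generated[OF mu1 scalar_alg_generated] by simp
  have quat: "alg_generated_by R (quaternion_alg R \<mu>1 \<mu>2)
      {basic_gen (binarion_alg R \<mu>1), cd_embed (binarion_alg R \<mu>1) (basic_gen (scalar_alg R))}"
    unfolding quaternion_alg_def using Bin.cayley_dickson_generated[OF mu2 bin] by simp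
  have "(UNIV :: gen3 set) = {T3, T2, T1}" using gen3.exhaust by blast
  then have "range (oct_gen R \<mu>1 \<mu>2) = {oct_gen R \<mu>1 \<mu>2 T3, oct_gen R \<mu>1 \<mu>2 T2, oct_gen R \<mu>1 \<mu>2 T1}"
    by (metis image_insert image_empty)
  then show ?thesis
    using Quat.cayley_dickson_generated[OF mu3 quat] by (simp add: octonion_alg_def)
qed

end

definition octonion_triple ::
    "('k, 'a, 'm) module_scheme \<Rightarrow> 'k \<Rightarrow> 'k \<Rightarrow> 'k \<Rightarrow> (gen3 \<Rightarrow> 'a) \<Rightarrow> bool"
  where "octonion_triple A \<mu>1 \<mu>2 \<mu>3 a \<longleftrightarrow> range a \<subseteq> carrier A \<and>
    (\<forall>(l, r) \<in> cayley_rels A (a T1) (a T2) (a T3) \<union> square_rels A \<mu>1 \<mu>2 \<mu>3 (a T1) (a T2) (a T3). l = r)"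

lemma octonion_triple_iff:
  "octonion_triple A \<mu>1 \<mu>2 \<mu>3 a \<longleftrightarrow> range a \<subseteq> carrier A \<and>
    a T2 \<otimes>\<^bsub>A\<^esub> a T1 = \<ominus>\<^bsub>A\<^esub> (a T1 \<otimes>\<^bsub>A\<^esub> a T2) \<and>
    a T3 \<otimes>\<^bsub>A\<^esub> a T1 = \<ominus>\<^bsub>A\<^esub> (a T1 \<otimes>\<^bsub>A\<^esub> a T3) \<and>
    a T3 \<otimes>\<^bsub>A\<^esub> a T2 = \<ominus>\<^bsub>A\<^esub> (a T2 \<otimes>\<^bsub>A\<^esub> a T3) \<and>
    (a T1 \<otimes>\<^bsub>A\<^esub> a T2) \<otimes>\<^bsub>A\<^esub> a T3 = \<ominus>\<^bsub>A\<^esub> (a T1 \<otimes>\<^bsub>A\<^esub> (a T2 \<otimes>\<^bsub>A\<^esub> a T3)) \<and>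
    a T1 \<otimes>\<^bsub>A\<^esub> a T1 = \<mu>1 \<odot>\<^bsub>A\<^esub> \<one>\<^bsub>A\<^esub> \<and> a T2 \<otimes>\<^bsub>A\<^esub> a T2 = \<mu>2 \<odot>\<^bsub>A\<^esub> \<one>\<^bsub>A\<^esub> \<and> a T3 \<otimes>\<^bsub>A\<^esub> a T3 = \<mu>3 \<odot>\<^bsub>A\<^esub> \<one>\<^bsub>A\<^esub>"
  by (simp add: octonion_triple_def cayley_rels_def square_rels_def) blast

theorem (in octonions) octonion_triple_oct_gen:
  "octonion_triple (octonion_alg R \<mu>1 \<mu>2 \<mu>3) \<mu>1 \<mu>2 \<mu>3 (oct_gen R \<mu>1 \<mu>2)"
proof -
  have gen: "range (oct_gen R \<mu>1 \<mu>2) \<subseteq> carrier (octonion_alg R \<mu>1 \<mu>2 \<mu>3)"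
    using octonion_generated by (simp add: alg_generated_by_iff)
  note minus = Sc.cayley_dickson_minus[OF mu1] Bin.cayley_dickson_minus[OF mu2]
     Quat.cayley_dickson_minus[OF mu3]
  have neg: "\<ominus>\<^bsub>scalar_alg R\<^esub> \<zero> = \<zero>" using Sc.minus_zero_A by simp
  have neg1: "\<ominus>\<^bsub>scalar_alg R\<^esub> \<one> \<in> carrier R" "\<ominus>\<^bsub>scalar_alg R\<^esub> (\<ominus>\<^bsub>scalar_alg R\<^esub> \<one>) = \<one>"
    using Sc.M.a_inv_closed[of \<one>] Sc.M.minus_minus[of \<one>] by simp_all
  show ?thesis
    unfolding octonion_triple_iff
    using mu1 mu2 mu3 neg neg1 gen
    by (simp add: cd_embed_def basic_gen_def octonion_alg_def quaternion_alg_def binarion_alg_def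
        minus[unfolded quaternion_alg_def binarion_alg_def])
qed

text \<open>Three applications of \<open>cayley_dickson_lift\<close>, starting from the structure map of the scalars. Each time
the condition to check is that moving the next \<open>a\<^sub>i\<close> past the image of the previous algebra conjugates
its elements.\<close>

theorem (in alternative_algebra) octonion_lift:
  assumes mu: "\<mu>1 \<in> carrier R" "\<mu>2 \<in> carrier R" "\<mu>3 \<in> carrier R"
    and triple: "octonion_triple A \<mu>1 \<mu>2 \<mu>3 a"
  shows "\<exists>h \<in> alg_hom R (octonion_alg R \<mu>1 \<mu>2 \<mu>3) A. \<forall>i. h (oct_gen R \<mu>1 \<mu>2 i) = a i"
proof -
  interpret octonions R \<mu>1 \<mu>2 \<mu>3 by unfold_locales (use mu in auto)
  define a1 a2 a3 where "a1 = a T1" and "a2 = a T2" and "a3 = a T3"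
  have car: "a1 \<in> carrier A" "a2 \<in> carrier A" "a3 \<in> carrier A"
   and rels: "a2 \<otimes>\<^bsub>A\<^esub> a1 = \<ominus>\<^bsub>A\<^esub> (a1 \<otimes>\<^bsub>A\<^esub> a2)" "a3 \<otimes>\<^bsub>A\<^esub> a1 = \<ominus>\<^bsub>A\<^esub> (a1 \<otimes>\<^bsub>A\<^esub> a3)"
     "a3 \<otimes>\<^bsub>A\<^esub> a2 = \<ominus>\<^bsub>A\<^esub> (a2 \<otimes>\<^bsub>A\<^esub> a3)"
   and assoc: "a1 \<otimes>\<^bsub>A\<^esub> a2 \<otimes>\<^bsub>A\<^esub> a3 = \<ominus>\<^bsub>A\<^esub> (a1 \<otimes>\<^bsub>A\<^esub> (a2 \<otimes>\<^bsub>A\<^esub> a3))"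
   and sq: "a1 \<otimes>\<^bsub>A\<^esub> a1 = \<mu>1 \<odot>\<^bsub>A\<^esub> \<one>\<^bsub>A\<^esub>" "a2 \<otimes>\<^bsub>A\<^esub> a2 = \<mu>2 \<odot>\<^bsub>A\<^esub> \<one>\<^bsub>A\<^esub>" "a3 \<otimes>\<^bsub>A\<^esub> a3 = \<mu>3 \<odot>\<^bsub>A\<^esub> \<one>\<^bsub>A\<^esub>"
    using triple by (auto simp: octonion_triple_iff a1_def a2_def a3_def)
  define \<phi>0 where "\<phi>0 = (\<lambda>\<alpha>. \<alpha> \<odot>\<^bsub>A\<^esub> \<one>\<^bsub>A\<^esub>)"
  define \<phi>1 where "\<phi>1 = cd_lift A \<phi>0 a1"
  define \<phi>2 where "\<phi>2 = cd_lift A \<phi>1 a2"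
  define \<phi>3 where "\<phi>3 = cd_lift A \<phi>2 a3"
  have \<phi>0: "\<phi>0 \<in> alg_hom R (scalar_alg R) A"
    by (rule alg_homI) (auto simp: \<phi>0_def smult_l_distr smult_assoc1 mult_smult_left)
  have \<phi>1: "\<phi>1 \<in> alg_hom R (binarion_alg R \<mu>1) A"
    unfolding \<phi>1_def binarion_alg_def
  proof (rule cayley_dickson_lift[OF Sc.scalar_involution_axioms \<phi>0 mu(1) car(1) sq(1)])
    fix b assume "b \<in> carrier (scalar_alg R)"
    then show "\<phi>0 b \<otimes>\<^bsub>A\<^esub> a1 = a1 \<otimes>\<^bsub>A\<^esub> \<phi>0 (star (scalar_alg R) b)"
      using car by (simp add: \<phi>0_def mult_smult_left mult_smult_right)
  qed
  have \<phi>1_eq: "\<phi>1 (\<alpha>, \<beta>) = \<alpha> \<odot>\<^bsub>A\<^esub> \<one>\<^bsub>A\<^esub> \<oplus>\<^bsub>A\<^esub> \<beta> \<odot>\<^bsub>A\<^esub> a1" if "\<alpha> \<in> carrier R" "\<beta> \<in> carrier R" for \<alpha> \<beta>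
    using that car by (simp add: \<phi>1_def \<phi>0_def mult_smult_right)
  have neg: "\<ominus>\<^bsub>scalar_alg R\<^esub> \<alpha> = \<ominus> \<alpha>" if "\<alpha> \<in> carrier R" for \<alpha>
    using that by (intro Sc.M.minus_equality) (auto simp: R.l_neg)
  have \<phi>2: "\<phi>2 \<in> alg_hom R (quaternion_alg R \<mu>1 \<mu>2) A"
    unfolding \<phi>2_def quaternion_alg_def
  proof (rule cayley_dickson_lift[OF Bin.scalar_involution_axioms \<phi>1 mu(2) car(2) sq(2)])
    fix b assume "b \<in> carrier (binarion_alg R \<mu>1)"
    then obtain \<alpha> \<beta> where b: "b = (\<alpha>, \<beta>)" "\<alpha> \<in> carrier R" "\<beta> \<in> carrier R"
      by (auto simp: binarion_alg_def)
    then have s: "star (binarion_alg R \<mu>1) b = (\<alpha>, \<ominus> \<beta>)"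
      by (simp add: binarion_alg_def neg)
    show "\<phi>1 b \<otimes>\<^bsub>A\<^esub> a2 = a2 \<otimes>\<^bsub>A\<^esub> \<phi>1 (star (binarion_alg R \<mu>1) b)"
      unfolding s unfolding b(1) \<phi>1_eq[OF b(2,3)] \<phi>1_eq[OF b(2) R.a_inv_closed[OF b(3)]]
      using b(2,3) car rels(1) by algebra
  qed
  have \<phi>2_eq: "\<phi>2 ((\<alpha>, \<beta>), (\<gamma>, \<delta>)) =
      (\<alpha> \<odot>\<^bsub>A\<^esub> \<one>\<^bsub>A\<^esub> \<oplus>\<^bsub>A\<^esub> \<beta> \<odot>\<^bsub>A\<^esub> a1) \<oplus>\<^bsub>A\<^esub> (\<gamma> \<odot>\<^bsub>A\<^esub> a2 \<oplus>\<^bsub>A\<^esub> \<delta> \<odot>\<^bsub>A\<^esub> (a2 \<otimes>\<^bsub>A\<^esub> a1))"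
    if "\<alpha> \<in> carrier R" "\<beta> \<in> carrier R" "\<gamma> \<in> carrier R" "\<delta> \<in> carrier R" for \<alpha> \<beta> \<gamma> \<delta>
    using that car by (simp add: \<phi>2_def \<phi>1_eq mult_smult_right mult_add_right)
  \<comment> \<open>\<open>a\<^sub>3\<close> has to anticommute with \<open>a\<^sub>1a\<^sub>2\<close> as well. By left alternativity this sum equals
      \<open>(a\<^sub>1a\<^sub>3 + a\<^sub>3a\<^sub>1)a\<^sub>2\<close>.\<close>
  have "a1 \<otimes>\<^bsub>A\<^esub> (a3 \<otimes>\<^bsub>A\<^esub> a2) \<oplus>\<^bsub>A\<^esub> a3 \<otimes>\<^bsub>A\<^esub> (a1 \<otimes>\<^bsub>A\<^esub> a2) = \<zero>\<^bsub>A\<^esub>"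
    using left_alternative_linearized[OF car(1,3,2)] car rels(2)
    by (simp add: mult_minus_left M.r_neg)
  then have minus: "\<ominus>\<^bsub>A\<^esub> (a3 \<otimes>\<^bsub>A\<^esub> (a1 \<otimes>\<^bsub>A\<^esub> a2)) = a1 \<otimes>\<^bsub>A\<^esub> (a3 \<otimes>\<^bsub>A\<^esub> a2)"
    by (rule M.minus_equality) (use car in simp_all)
  have "a3 \<otimes>\<^bsub>A\<^esub> (a1 \<otimes>\<^bsub>A\<^esub> a2) = \<ominus>\<^bsub>A\<^esub> (\<ominus>\<^bsub>A\<^esub> (a3 \<otimes>\<^bsub>A\<^esub> (a1 \<otimes>\<^bsub>A\<^esub> a2)))"
    using car by simp
  also have "\<dots> = a1 \<otimes>\<^bsub>A\<^esub> (a2 \<otimes>\<^bsub>A\<^esub> a3)"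
    unfolding minus rels(3) using car by (simp add: mult_minus_right)
  finally have "a3 \<otimes>\<^bsub>A\<^esub> (a1 \<otimes>\<^bsub>A\<^esub> a2) = a1 \<otimes>\<^bsub>A\<^esub> (a2 \<otimes>\<^bsub>A\<^esub> a3)" .
  then have assoc': "a3 \<otimes>\<^bsub>A\<^esub> (a1 \<otimes>\<^bsub>A\<^esub> a2) = \<ominus>\<^bsub>A\<^esub> (a1 \<otimes>\<^bsub>A\<^esub> a2 \<otimes>\<^bsub>A\<^esub> a3)"
    using car assoc by simp
  have \<phi>3: "\<phi>3 \<in> alg_hom R (octonion_alg R \<mu>1 \<mu>2 \<mu>3) A"
    unfolding \<phi>3_def octonion_alg_def
  proof (rule cayley_dickson_lift[OF Quat.scalar_involution_axioms \<phi>2 mu(3) car(3) sq(3)])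
    fix b assume "b \<in> carrier (quaternion_alg R \<mu>1 \<mu>2)"
    then obtain \<alpha> \<beta> \<gamma> \<delta> where b: "b = ((\<alpha>, \<beta>), (\<gamma>, \<delta>))"
      "\<alpha> \<in> carrier R" "\<beta> \<in> carrier R" "\<gamma> \<in> carrier R" "\<delta> \<in> carrier R"
      by (auto simp: binarion_alg_def quaternion_alg_def)
    then have s: "star (quaternion_alg R \<mu>1 \<mu>2) b = ((\<alpha>, \<ominus> \<beta>), (\<ominus> \<gamma>, \<ominus> \<delta>))"
      using Sc.cayley_dickson_minus[OF mu1]
      by (simp add: quaternion_alg_def binarion_alg_def neg)
    have n: "\<ominus> \<beta> \<in> carrier R" "\<ominus> \<gamma> \<in> carrier R" "\<ominus> \<delta> \<in> carrier R" using b by auto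
    show "\<phi>2 b \<otimes>\<^bsub>A\<^esub> a3 = a3 \<otimes>\<^bsub>A\<^esub> \<phi>2 (star (quaternion_alg R \<mu>1 \<mu>2) b)"
      unfolding s unfolding b(1) \<phi>2_eq[OF b(2-5)] \<phi>2_eq[OF b(2) n]
      using b(2-5) car rels assoc' by algebra
  qed
  have "\<phi>3 (oct_gen R \<mu>1 \<mu>2 i) = a i" for i
  proof -
    have "\<phi>1 (\<zero>, \<zero>) = \<zero>\<^bsub>A\<^esub>" "\<phi>1 (\<zero>, \<one>) = a1" "\<phi>1 (\<one>, \<zero>) = \<one>\<^bsub>A\<^esub>"
      using car by (simp_all add: \<phi>1_eq)
    then show ?thesis
      using car
      by (cases i) (simp_all add: cd_embed_def basic_gen_def quaternion_alg_def binarion_alg_def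
          \<phi>3_def \<phi>2_def a1_def a2_def a3_def)
  qed
  then show ?thesis using \<phi>3 by blast
qed

section \<open>Ideals and quotients\<close>

lemma (in unital_algebra) carrier_alg_ideal: "alg_ideal R A (carrier A)"
  by (simp add: alg_ideal_def carrier_is_submodule)

lemma (in unital_algebra) alg_ideal_genideal:
  assumes "S \<subseteq> carrier A"
  shows "alg_ideal R A (alg_genideal R A S)"
proof -
  define F where "F = {I. alg_ideal R A I \<and> S \<subseteq> I}"
  have sub: "submodule I R A" if "I \<in> F" for I using that by (simp add: F_def alg_ideal_def)
  note E = submoduleE[OF sub]
  have "submodule (\<Inter>F) R A"
  proof (rule submoduleI)
    show "\<Inter>F \<subseteq> carrier A" using carrier_alg_ideal assms by (auto simp: F_def)
    show "\<zero>\<^bsub>A\<^esub> \<in> \<Inter>F"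
      using subgroup.one_closed[OF submodule.axioms(1)[OF sub]] by auto
    fix a b \<alpha>
    assume "a \<in> \<Inter>F"
    then have a: "a \<in> I" if "I \<in> F" for I using that by (rule InterD)
    show "\<ominus>\<^bsub>A\<^esub> a \<in> \<Inter>F" using E(3) a by (intro InterI) simp
    show "\<alpha> \<odot>\<^bsub>A\<^esub> a \<in> \<Inter>F" if "\<alpha> \<in> carrier R" using E(4) a that by (intro InterI) simp
    assume "b \<in> \<Inter>F"
    then have "b \<in> I" if "I \<in> F" for I using that by (rule InterD)
    then show "a \<oplus>\<^bsub>A\<^esub> b \<in> \<Inter>F" using E(5) a by (intro InterI) simp
  qed
  moreover have "x \<otimes>\<^bsub>A\<^esub> y \<in> \<Inter>F \<and> y \<otimes>\<^bsub>A\<^esub> x \<in> \<Inter>F" if "x \<in> carrier A" "y \<in> \<Inter>F" for x y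
    using that by (auto simp: F_def alg_ideal_def)
  ultimately have "alg_ideal R A (\<Inter>F)" by (simp add: alg_ideal_def)
  then show ?thesis unfolding alg_genideal_def F_def .
qed

lemma subset_alg_genideal: "S \<subseteq> alg_genideal R A S"
  by (auto simp: alg_genideal_def)

lemma alg_genideal_minimal: "\<lbrakk>alg_ideal R A I; S \<subseteq> I\<rbrakk> \<Longrightarrow> alg_genideal R A S \<subseteq> I"
  by (auto simp: alg_genideal_def)

lemma alg_ideal_kernel:
  assumes A: "unital_algebra R A" and B: "unital_algebra R B" and h: "h \<in> alg_hom R A B"
  shows "alg_ideal R A {x \<in> carrier A. h x = \<zero>\<^bsub>B\<^esub>}"
proof -
  interpret A: unital_algebra R A by fact
  interpret B: unital_algebra R B by fact
  note hD = alg_homD[OF h]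
  have "submodule {x \<in> carrier A. h x = \<zero>\<^bsub>B\<^esub>} R A"
    by (rule A.submoduleI) (auto simp: hD alg_hom_zero[OF A B h] alg_hom_minus[OF A B h])
  then show ?thesis by (auto simp: alg_ideal_def hD)
qed

lemma alg_hom_associator:
  assumes A: "unital_algebra R A" and B: "unital_algebra R B" and h: "h \<in> alg_hom R A B"
    and abc: "a \<in> carrier A" "b \<in> carrier A" "c \<in> carrier A"
  shows "h (associator A a b c) = associator B (h a) (h b) (h c)"
proof -
  interpret A: unital_algebra R A by fact
  interpret B: unital_algebra R B by fact
  show ?thesis
    using abc by (simp add: associator_def a_minus_def alg_homD[OF h] alg_hom_minus[OF A B h])
qed

text \<open>Alternativity of the target only requires \<open>h\<close> to kill the alternators of the source, so the source may
be a free nonassociative algebra as well as an alternative one.\<close>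

lemma alternative_algebra_of_surj:
  assumes A: "unital_algebra R A" and B: "unital_algebra R B" and h: "h \<in> alg_hom R A B"
    and surj: "h ` carrier A = carrier B" and kill: "\<And>x. x \<in> alternators A \<Longrightarrow> h x = \<zero>\<^bsub>B\<^esub>"
  shows "alternative_algebra R B"
proof -
  interpret B: unital_algebra R B by fact
  show ?thesis
  proof
    fix a b assume "a \<in> carrier B" "b \<in> carrier B"
    then obtain x y where xy: "x \<in> carrier A" "y \<in> carrier A" "a = h x" "b = h y"
      using surj by blast
    show "associator B a a b = \<zero>\<^bsub>B\<^esub>"
      unfolding xy using xy kill[of "associator A x x y"]
      by (auto simp: alg_hom_associator[OF A B h, symmetric] alternators_def)
    show "associator B b a a = \<zero>\<^bsub>B\<^esub>"
      unfolding xy using xy kill[of "associator A y x x"]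
      by (auto simp: alg_hom_associator[OF A B h, symmetric] alternators_def)
  qed
qed

lemma unital_algebra_of_surj:
  assumes A: "unital_algebra R A" and h: "h \<in> alg_hom R A B"
    and surj: "h ` carrier A = carrier B" and zero: "h \<zero>\<^bsub>A\<^esub> = \<zero>\<^bsub>B\<^esub>"
  shows "unital_algebra R B"
proof -
  interpret A: unital_algebra R A by fact
  note hD = alg_homD[OF h]
  have rep: "\<exists>x\<in>carrier A. y = h x" if "y \<in> carrier B" for y using that surj by blast
  have "abelian_group B"
  proof (rule abelian_groupI)
    show "\<zero>\<^bsub>B\<^esub> \<in> carrier B" using hD(1)[of "\<zero>\<^bsub>A\<^esub>"] zero by simp
    fix x y z assume "x \<in> carrier B" "y \<in> carrier B" "z \<in> carrier B"
    then obtain a b c where *: "a \<in> carrier A" "b \<in> carrier A" "c \<in> carrier A" "x = h a" "y = h b" "z = h c"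
      using rep by metis
    show "x \<oplus>\<^bsub>B\<^esub> y \<in> carrier B" using * hD(1)[of "a \<oplus>\<^bsub>A\<^esub> b"] by (simp add: hD(2))
    show "(x \<oplus>\<^bsub>B\<^esub> y) \<oplus>\<^bsub>B\<^esub> z = x \<oplus>\<^bsub>B\<^esub> (y \<oplus>\<^bsub>B\<^esub> z)"
      using * by (simp add: hD(2)[symmetric] A.M.a_assoc)
    show "x \<oplus>\<^bsub>B\<^esub> y = y \<oplus>\<^bsub>B\<^esub> x"
      using * by (simp add: hD(2)[symmetric] A.M.a_comm)
    show "\<zero>\<^bsub>B\<^esub> \<oplus>\<^bsub>B\<^esub> x = x"
      using * by (simp add: hD(2)[symmetric] zero[symmetric])
    show "\<exists>y\<in>carrier B. y \<oplus>\<^bsub>B\<^esub> x = \<zero>\<^bsub>B\<^esub>"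
      using * hD(1)[of "\<ominus>\<^bsub>A\<^esub> a"]
      by (intro bexI[of _ "h (\<ominus>\<^bsub>A\<^esub> a)"]) (simp_all add: hD(2)[symmetric] zero[symmetric] A.M.l_neg)
  qed
  then have "module R B"
  proof (rule moduleI[OF A.R.is_cring])
    fix \<alpha> \<beta> x y assume ab: "\<alpha> \<in> carrier R" "\<beta> \<in> carrier R" and "x \<in> carrier B" "y \<in> carrier B"
    then obtain a b where *: "a \<in> carrier A" "b \<in> carrier A" "x = h a" "y = h b"
      using rep by metis
    show "\<alpha> \<odot>\<^bsub>B\<^esub> x \<in> carrier B" using * ab hD(1)[of "\<alpha> \<odot>\<^bsub>A\<^esub> a"] by (simp add: hD(4))
    show "(\<alpha> \<oplus>\<^bsub>R\<^esub> \<beta>) \<odot>\<^bsub>B\<^esub> x = \<alpha> \<odot>\<^bsub>B\<^esub> x \<oplus>\<^bsub>B\<^esub> \<beta> \<odot>\<^bsub>B\<^esub> x"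
      using * ab by (simp add: hD(2,4)[symmetric] A.smult_l_distr)
    show "\<alpha> \<odot>\<^bsub>B\<^esub> (x \<oplus>\<^bsub>B\<^esub> y) = \<alpha> \<odot>\<^bsub>B\<^esub> x \<oplus>\<^bsub>B\<^esub> \<alpha> \<odot>\<^bsub>B\<^esub> y"
      using * ab by (simp add: hD(2,4)[symmetric] A.smult_r_distr)
    show "(\<alpha> \<otimes>\<^bsub>R\<^esub> \<beta>) \<odot>\<^bsub>B\<^esub> x = \<alpha> \<odot>\<^bsub>B\<^esub> (\<beta> \<odot>\<^bsub>B\<^esub> x)"
      using * ab by (simp add: hD(4)[symmetric] A.smult_assoc1)
  next
    fix x assume "x \<in> carrier B"
    then obtain a where "a \<in> carrier A" "x = h a" using rep by blast
    then show "\<one>\<^bsub>R\<^esub> \<odot>\<^bsub>B\<^esub> x = x" by (simp add: hD(4)[symmetric])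
  qed
  then show ?thesis
  proof (rule unital_algebra.intro, unfold_locales)
    show "\<one>\<^bsub>B\<^esub> \<in> carrier B" using hD(1)[of "\<one>\<^bsub>A\<^esub>"] hD(5) by simp
    fix x y z assume "x \<in> carrier B" "y \<in> carrier B" "z \<in> carrier B"
    then obtain a b c where *: "a \<in> carrier A" "b \<in> carrier A" "c \<in> carrier A" "x = h a" "y = h b" "z = h c"
      using rep by metis
    show "x \<otimes>\<^bsub>B\<^esub> y \<in> carrier B" using * hD(1)[of "a \<otimes>\<^bsub>A\<^esub> b"] by (simp add: hD(3))
    show "\<one>\<^bsub>B\<^esub> \<otimes>\<^bsub>B\<^esub> x = x" "x \<otimes>\<^bsub>B\<^esub> \<one>\<^bsub>B\<^esub> = x"
      using * by (simp_all add: hD(3,5)[symmetric])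
    show "(x \<oplus>\<^bsub>B\<^esub> y) \<otimes>\<^bsub>B\<^esub> z = x \<otimes>\<^bsub>B\<^esub> z \<oplus>\<^bsub>B\<^esub> y \<otimes>\<^bsub>B\<^esub> z"
      "z \<otimes>\<^bsub>B\<^esub> (x \<oplus>\<^bsub>B\<^esub> y) = z \<otimes>\<^bsub>B\<^esub> x \<oplus>\<^bsub>B\<^esub> z \<otimes>\<^bsub>B\<^esub> y"
      using * by (simp_all add: hD(2,3)[symmetric] A.mult_add_left A.mult_add_right)
  next
    fix \<alpha> x y assume al: "\<alpha> \<in> carrier R" and "x \<in> carrier B" "y \<in> carrier B"
    then obtain a b where *: "a \<in> carrier A" "b \<in> carrier A" "x = h a" "y = h b"
      using rep by metis
    show "(\<alpha> \<odot>\<^bsub>B\<^esub> x) \<otimes>\<^bsub>B\<^esub> y = \<alpha> \<odot>\<^bsub>B\<^esub> (x \<otimes>\<^bsub>B\<^esub> y)" "x \<otimes>\<^bsub>B\<^esub> (\<alpha> \<odot>\<^bsub>B\<^esub> y) = \<alpha> \<odot>\<^bsub>B\<^esub> (x \<otimes>\<^bsub>B\<^esub> y)"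
      using * al by (simp_all add: hD(3,4)[symmetric] A.mult_smult_left A.mult_smult_right)
  qed
qed

locale algebra_ideal = unital_algebra R A
  for R :: "('k, 'm) ring_scheme" (structure) and A :: "('k, 'a, 'n) module_scheme" (structure) +
  fixes I
  assumes alg_ideal: "alg_ideal R A I"
begin

lemma submodule_ideal: "submodule I R A"
  using alg_ideal by (simp add: alg_ideal_def)

sublocale coset: abelian_subgroup I A
  by (rule abelian_subgroupI3)
     (auto intro: additive_subgroup.intro submodule.axioms(1)[OF submodule_ideal] M.abelian_group_axioms)

lemma ideal_closed:
  "i \<in> I \<Longrightarrow> i \<in> carrier A"
  "\<lbrakk>i \<in> I; j \<in> I\<rbrakk> \<Longrightarrow> i \<oplus>\<^bsub>A\<^esub> j \<in> I"
  "\<lbrakk>i \<in> I; x \<in> carrier A\<rbrakk> \<Longrightarrow> i \<otimes>\<^bsub>A\<^esub> x \<in> I"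
  "\<lbrakk>i \<in> I; x \<in> carrier A\<rbrakk> \<Longrightarrow> x \<otimes>\<^bsub>A\<^esub> i \<in> I"
  "\<lbrakk>\<alpha> \<in> carrier R; i \<in> I\<rbrakk> \<Longrightarrow> \<alpha> \<odot>\<^bsub>A\<^esub> i \<in> I"
  using alg_ideal submoduleE[OF submodule_ideal] by (auto simp: alg_ideal_def)

lemma coset_memE:
  assumes "y \<in> I +>\<^bsub>A\<^esub> x"
  obtains i where "i \<in> I" "y = i \<oplus>\<^bsub>A\<^esub> x"
  using assms by (auto simp: a_r_coset_def')

lemma coset_eqI:
  assumes "i \<in> I" "x \<in> carrier A"
  shows "I +>\<^bsub>A\<^esub> (i \<oplus>\<^bsub>A\<^esub> x) = I +>\<^bsub>A\<^esub> x"
  using coset.a_repr_independence'[of "i \<oplus>\<^bsub>A\<^esub> x" x] assms by (auto simp: a_r_coset_def')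

lemma coset_eq_iff:
  assumes "x \<in> carrier A" "y \<in> carrier A"
  shows "I +>\<^bsub>A\<^esub> x = I +>\<^bsub>A\<^esub> y \<longleftrightarrow> x \<ominus>\<^bsub>A\<^esub> y \<in> I"
proof
  assume "I +>\<^bsub>A\<^esub> x = I +>\<^bsub>A\<^esub> y"
  then have "x \<in> I +>\<^bsub>A\<^esub> y" using coset.a_rcos_self assms by blast
  then show "x \<ominus>\<^bsub>A\<^esub> y \<in> I" using coset.a_rcos_module[OF assms(2,1)] by (simp add: M.minus_eq)
next
  assume "x \<ominus>\<^bsub>A\<^esub> y \<in> I"
  from coset_eqI[OF this assms(2)] show "I +>\<^bsub>A\<^esub> x = I +>\<^bsub>A\<^esub> y"
    using assms by (simp add: M.minus_eq M.a_assoc M.l_neg)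
qed

lemma quot_carrier: "carrier (alg_quot A I) = (\<lambda>x. I +>\<^bsub>A\<^esub> x) ` carrier A"
  by (auto simp: alg_quot_def A_RCOSETS_def')

text \<open>The product and the scalar multiples of \<^const>\<open>alg_quot\<close> are unions of cosets over all representatives.
All members of the union coincide because \<open>I\<close> is an ideal, so any representatives may be chosen.\<close>

lemma quot_hom: "(\<lambda>x. I +>\<^bsub>A\<^esub> x) \<in> alg_hom R A (alg_quot A I)"
proof (rule alg_homI)
  fix x y assume xy: "x \<in> carrier A" "y \<in> carrier A"
  show "I +>\<^bsub>A\<^esub> (x \<oplus>\<^bsub>A\<^esub> y) = (I +>\<^bsub>A\<^esub> x) \<oplus>\<^bsub>alg_quot A I\<^esub> (I +>\<^bsub>A\<^esub> y)"
    using xy by (simp add: alg_quot_def coset.a_rcos_sum)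
  have const: "I +>\<^bsub>A\<^esub> (a \<otimes>\<^bsub>A\<^esub> b) = I +>\<^bsub>A\<^esub> (x \<otimes>\<^bsub>A\<^esub> y)" if ab: "a \<in> I +>\<^bsub>A\<^esub> x" "b \<in> I +>\<^bsub>A\<^esub> y" for a b
  proof -
    obtain i j where ij: "i \<in> I" "a = i \<oplus>\<^bsub>A\<^esub> x" "j \<in> I" "b = j \<oplus>\<^bsub>A\<^esub> y"
      using ab by (metis coset_memE)
    note ij' = ideal_closed(1)[OF ij(1)] ideal_closed(1)[OF ij(3)]
    have "a \<otimes>\<^bsub>A\<^esub> b = (i \<otimes>\<^bsub>A\<^esub> (j \<oplus>\<^bsub>A\<^esub> y) \<oplus>\<^bsub>A\<^esub> x \<otimes>\<^bsub>A\<^esub> j) \<oplus>\<^bsub>A\<^esub> x \<otimes>\<^bsub>A\<^esub> y"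
      unfolding ij using ij' xy by algebra
    moreover have "i \<otimes>\<^bsub>A\<^esub> (j \<oplus>\<^bsub>A\<^esub> y) \<oplus>\<^bsub>A\<^esub> x \<otimes>\<^bsub>A\<^esub> j \<in> I"
      using ij ij' xy by (intro ideal_closed(2-4)) auto
    ultimately show ?thesis using coset_eqI[of _ "x \<otimes>\<^bsub>A\<^esub> y"] xy by simp
  qed
  have "(\<Union>a\<in>I +>\<^bsub>A\<^esub> x. \<Union>b\<in>I +>\<^bsub>A\<^esub> y. I +>\<^bsub>A\<^esub> (a \<otimes>\<^bsub>A\<^esub> b)) = I +>\<^bsub>A\<^esub> (x \<otimes>\<^bsub>A\<^esub> y)"
    by (rule UN_constant_eq[OF coset.a_rcos_self[OF xy(1)]], rule ballI,
        rule UN_constant_eq[OF coset.a_rcos_self[OF xy(2)]], rule ballI) (rule const)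
  then show "I +>\<^bsub>A\<^esub> (x \<otimes>\<^bsub>A\<^esub> y) = (I +>\<^bsub>A\<^esub> x) \<otimes>\<^bsub>alg_quot A I\<^esub> (I +>\<^bsub>A\<^esub> y)"
    by (simp add: alg_quot_def rcoset_mult_def)
next
  fix \<alpha> x assume ax: "\<alpha> \<in> carrier R" "x \<in> carrier A"
  have const: "I +>\<^bsub>A\<^esub> (\<alpha> \<odot>\<^bsub>A\<^esub> a) = I +>\<^bsub>A\<^esub> (\<alpha> \<odot>\<^bsub>A\<^esub> x)" if a: "a \<in> I +>\<^bsub>A\<^esub> x" for a
  proof -
    obtain i where i: "i \<in> I" "a = i \<oplus>\<^bsub>A\<^esub> x"
      using a by (metis coset_memE)
    then show ?thesis
      using ax ideal_closed(1)[OF i(1)] ideal_closed(5)[OF ax(1) i(1)] coset_eqI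
      by (simp add: smult_r_distr)
  qed
  have "(\<Union>a\<in>I +>\<^bsub>A\<^esub> x. I +>\<^bsub>A\<^esub> (\<alpha> \<odot>\<^bsub>A\<^esub> a)) = I +>\<^bsub>A\<^esub> (\<alpha> \<odot>\<^bsub>A\<^esub> x)"
    by (rule UN_constant_eq[OF coset.a_rcos_self[OF ax(2)]], rule ballI) (rule const)
  then show "I +>\<^bsub>A\<^esub> (\<alpha> \<odot>\<^bsub>A\<^esub> x) = \<alpha> \<odot>\<^bsub>alg_quot A I\<^esub> (I +>\<^bsub>A\<^esub> x)"
    by (simp add: alg_quot_def)
qed (simp_all add: quot_carrier, simp add: alg_quot_def)

lemma quot_zero: "I +>\<^bsub>A\<^esub> \<zero>\<^bsub>A\<^esub> = \<zero>\<^bsub>alg_quot A I\<^esub>"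
  using M.a_coset_add_zero[OF coset.a_subset] by (simp add: alg_quot_def)

lemma quot_surj: "(\<lambda>x. I +>\<^bsub>A\<^esub> x) ` carrier A = carrier (alg_quot A I)"
  by (simp add: quot_carrier)

theorem quot_unital_algebra: "unital_algebra R (alg_quot A I)"
  by (rule unital_algebra_of_surj[OF unital_algebra_axioms quot_hom quot_surj quot_zero])

lemma quot_eq_zero: "x \<in> I \<Longrightarrow> I +>\<^bsub>A\<^esub> x = \<zero>\<^bsub>alg_quot A I\<^esub>"
  using coset.a_rcos_const by (simp add: alg_quot_def)

theorem quot_alternative:
  assumes "alternators A \<subseteq> I"
  shows "alternative_algebra R (alg_quot A I)"
  by (rule alternative_algebra_of_surj[OF unital_algebra_axioms quot_unital_algebra quot_hom quot_surj])
     (use assms quot_eq_zero in auto)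

text \<open>The factored map evaluates \<open>h\<close> at an arbitrary representative of the coset.\<close>

theorem quot_lift:
  fixes B :: "('k, 'b, 'l) module_scheme"
  assumes B: "unital_algebra R B" and h: "h \<in> alg_hom R A B" and ker: "\<And>x. x \<in> I \<Longrightarrow> h x = \<zero>\<^bsub>B\<^esub>"
  shows "\<exists>g \<in> alg_hom R (alg_quot A I) B. \<forall>x\<in>carrier A. g (I +>\<^bsub>A\<^esub> x) = h x"
proof -
  interpret B: unital_algebra R B by fact
  note hD = alg_homD[OF h] and qD = alg_homD[OF quot_hom]
  define g where "g = (\<lambda>X. h (SOME x. x \<in> X))"
  have g: "g (I +>\<^bsub>A\<^esub> x) = h x" if x: "x \<in> carrier A" for x
  proof -
    have "(SOME y. y \<in> I +>\<^bsub>A\<^esub> x) \<in> I +>\<^bsub>A\<^esub> x" using coset.a_rcos_self[OF x] by (rule someI)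
    then obtain i where i: "i \<in> I" "(SOME y. y \<in> I +>\<^bsub>A\<^esub> x) = i \<oplus>\<^bsub>A\<^esub> x" by (rule coset_memE)
    show ?thesis
      unfolding g_def i(2) using i(1) x ideal_closed(1) hD(1)[OF x] by (simp add: hD(2) ker)
  qed
  have "g \<in> alg_hom R (alg_quot A I) B"
  proof (rule alg_homI)
    show "g \<one>\<^bsub>alg_quot A I\<^esub> = \<one>\<^bsub>B\<^esub>" using g[of "\<one>\<^bsub>A\<^esub>"] qD(5) hD(5) by simp
    fix X assume "X \<in> carrier (alg_quot A I)"
    then obtain x where x: "x \<in> carrier A" "X = I +>\<^bsub>A\<^esub> x" by (auto simp: quot_carrier)
    show "g X \<in> carrier B" using x by (simp add: g hD(1))
    show "g (\<alpha> \<odot>\<^bsub>alg_quot A I\<^esub> X) = \<alpha> \<odot>\<^bsub>B\<^esub> g X" if "\<alpha> \<in> carrier R" for \<alpha>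
      using x that by (simp add: qD(4)[symmetric] g hD(4))
    fix Y assume "Y \<in> carrier (alg_quot A I)"
    then obtain y where y: "y \<in> carrier A" "Y = I +>\<^bsub>A\<^esub> y" by (auto simp: quot_carrier)
    show "g (X \<oplus>\<^bsub>alg_quot A I\<^esub> Y) = g X \<oplus>\<^bsub>B\<^esub> g Y" "g (X \<otimes>\<^bsub>alg_quot A I\<^esub> Y) = g X \<otimes>\<^bsub>B\<^esub> g Y"
      using x y by (simp_all add: qD(2,3)[symmetric] g hD(2,3))
  qed
  then show ?thesis using g by blast
qed

end

section \<open>The free nonassociative algebra\<close>

lemma mono_mult_None_right [simp]: "mono_mult u None = u"
  by (cases u) simp_all

lemma mono_mult_eq_None_iff: "mono_mult u v = None \<longleftrightarrow> u = None \<and> v = None"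
  by (cases u; cases v) simp_all

text \<open>A monomial has at most three factorizations: the two trivial ones, and the topmost splitting of a
proper product. Reading the convolution off this list makes the algebra laws pointwise identities of
ring elements.\<close>

lemma factorizations:
  "{(u, v). mono_mult u v = None} = {(None, None)}"
  "{(u, v). mono_mult u v = Some (Gen x)} = {(None, Some (Gen x)), (Some (Gen x), None)}"
  "{(u, v). mono_mult u v = Some (Prod p q)} =
     {(None, Some (Prod p q)), (Some (Prod p q), None), (Some p, Some q)}"
proof -
  show "{(u, v). mono_mult u v = None} = {(None, None)}"
    by (auto simp: mono_mult_eq_None_iff)
  have "mono_mult u v = Some (Gen x) \<longleftrightarrow> (u, v) \<in> {(None, Some (Gen x)), (Some (Gen x), None)}" for u v
    by (cases u; cases v) auto
  then show "{(u, v). mono_mult u v = Some (Gen x)} = {(None, Some (Gen x)), (Some (Gen x), None)}"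
    by blast
  have "mono_mult u v = Some (Prod p q)
    \<longleftrightarrow> (u, v) \<in> {(None, Some (Prod p q)), (Some (Prod p q), None), (Some p, Some q)}" for u v
    by (cases u; cases v) auto
  then show "{(u, v). mono_mult u v = Some (Prod p q)} =
     {(None, Some (Prod p q)), (Some (Prod p q), None), (Some p, Some q)}"
    by blast
qed

lemma monomial_cases [case_names None Gen Prod]:
  fixes w :: "'x monomial"
  obtains "w = None" | x where "w = Some (Gen x)" | p q where "w = Some (Prod p q)"
  by (metis option.exhaust word.exhaust)

lemma (in cring) free_alg_simps:
  "f \<in> carrier (free_alg R) \<longleftrightarrow> (\<forall>w. f w \<in> carrier R) \<and> finite {w. f w \<noteq> \<zero>}"
  "\<one>\<^bsub>free_alg R\<^esub> = (\<lambda>w. if w = None then \<one> else \<zero>)"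
  "\<zero>\<^bsub>free_alg R\<^esub> = (\<lambda>w. \<zero>)"
  "f \<oplus>\<^bsub>free_alg R\<^esub> g = (\<lambda>w. f w \<oplus> g w)"
  "\<alpha> \<odot>\<^bsub>free_alg R\<^esub> f = (\<lambda>w. \<alpha> \<otimes> f w)"
  by (simp_all add: free_alg_def)

lemma (in cring) free_alg_mult:
  assumes f: "\<And>w. f w \<in> carrier R" and g: "\<And>w. g w \<in> carrier R"
  shows "(f \<otimes>\<^bsub>free_alg R\<^esub> g) None = f None \<otimes> g None"
    "(f \<otimes>\<^bsub>free_alg R\<^esub> g) (Some (Gen x)) = f None \<otimes> g (Some (Gen x)) \<oplus> f (Some (Gen x)) \<otimes> g None"
    "(f \<otimes>\<^bsub>free_alg R\<^esub> g) (Some (Prod p q)) = f None \<otimes> g (Some (Prod p q))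
       \<oplus> (f (Some (Prod p q)) \<otimes> g None \<oplus> f (Some p) \<otimes> g (Some q))"
  by (simp_all add: free_alg_def factorizations f g)

lemma (in cring) free_alg_mult_support:
  assumes f: "f \<in> carrier (free_alg R)" and g: "g \<in> carrier (free_alg R)"
  shows "finite {w. (f \<otimes>\<^bsub>free_alg R\<^esub> g) w \<noteq> \<zero>}"
proof (rule finite_subset)
  let ?S = "(\<lambda>(u, v). mono_mult u v) ` ({w. f w \<noteq> \<zero>} \<times> {w. g w \<noteq> \<zero>})"
  show "finite ?S" using f g by (auto simp: free_alg_simps)
  show "{w. (f \<otimes>\<^bsub>free_alg R\<^esub> g) w \<noteq> \<zero>} \<subseteq> ?S"
  proof (rule subsetI, rule ccontr)
    fix w assume w: "w \<in> {w. (f \<otimes>\<^bsub>free_alg R\<^esub> g) w \<noteq> \<zero>}" and "w \<notin> ?S"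
    have "f u \<otimes> g v = \<zero>" if uv: "mono_mult u v = w" for u v
    proof -
      have "f u = \<zero> \<or> g v = \<zero>" using \<open>w \<notin> ?S\<close> uv by (auto simp: image_iff)
      then show ?thesis using f g by (auto simp: free_alg_simps)
    qed
    then have "finsum R (\<lambda>(u, v). f u \<otimes> g v) {(u, v). mono_mult u v = w} = \<zero>"
      by (intro add.finprod_one_eqI) auto
    then show False using w by (simp add: free_alg_def)
  qed
qed

theorem (in cring) free_alg_unital_algebra: "unital_algebra R (free_alg R :: ('a, 'x monomial \<Rightarrow> 'a) module)"
    (is "unital_algebra R ?F")
proof -
  have car: "f w \<in> carrier R" if "f \<in> carrier ?F" for f w using that by (simp add: free_alg_simps)
  have fin: "finite {w. f w \<noteq> \<zero>}" if "f \<in> carrier ?F" for f :: "'x monomial \<Rightarrow> 'a"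
    using that by (simp add: free_alg_simps)
  have "abelian_group ?F"
  proof (rule abelian_groupI)
    fix f g h :: "'x monomial \<Rightarrow> 'a"
    assume fgh: "f \<in> carrier ?F" "g \<in> carrier ?F" "h \<in> carrier ?F"
    have "{w. f w \<oplus> g w \<noteq> \<zero>} \<subseteq> {w. f w \<noteq> \<zero>} \<union> {w. g w \<noteq> \<zero>}" by auto
    then show "f \<oplus>\<^bsub>?F\<^esub> g \<in> carrier ?F"
      using fgh fin finite_subset[of "{w. f w \<oplus> g w \<noteq> \<zero>}"] by (auto simp: free_alg_simps)
    show "(f \<oplus>\<^bsub>?F\<^esub> g) \<oplus>\<^bsub>?F\<^esub> h = f \<oplus>\<^bsub>?F\<^esub> (g \<oplus>\<^bsub>?F\<^esub> h)" "f \<oplus>\<^bsub>?F\<^esub> g = g \<oplus>\<^bsub>?F\<^esub> f" "\<zero>\<^bsub>?F\<^esub> \<oplus>\<^bsub>?F\<^esub> f = f"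
      using fgh[THEN car] by (simp_all add: free_alg_simps a_ac)
    have "{w. \<ominus> f w \<noteq> \<zero>} \<subseteq> {w. f w \<noteq> \<zero>}" by auto
    then have "(\<lambda>w. \<ominus> f w) \<in> carrier ?F"
      using fgh fin finite_subset[of "{w. \<ominus> f w \<noteq> \<zero>}"] by (auto simp: free_alg_simps)
    then show "\<exists>g\<in>carrier ?F. g \<oplus>\<^bsub>?F\<^esub> f = \<zero>\<^bsub>?F\<^esub>"
      using car[OF fgh(1)] by (intro bexI[of _ "\<lambda>w. \<ominus> f w"]) (simp_all add: free_alg_simps l_neg)
  qed (simp add: free_alg_simps)
  then have "module R ?F"
  proof (rule moduleI[OF is_cring])
    fix \<alpha> \<beta> and f g :: "'x monomial \<Rightarrow> 'a"
    assume *: "\<alpha> \<in> carrier R" "\<beta> \<in> carrier R" "f \<in> carrier ?F" "g \<in> carrier ?F"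
    have "{w. \<alpha> \<otimes> f w \<noteq> \<zero>} \<subseteq> {w. f w \<noteq> \<zero>}" using * by auto
    then show "\<alpha> \<odot>\<^bsub>?F\<^esub> f \<in> carrier ?F"
      using * fin finite_subset[of "{w. \<alpha> \<otimes> f w \<noteq> \<zero>}"] by (auto simp: free_alg_simps)
    show "(\<alpha> \<oplus> \<beta>) \<odot>\<^bsub>?F\<^esub> f = \<alpha> \<odot>\<^bsub>?F\<^esub> f \<oplus>\<^bsub>?F\<^esub> \<beta> \<odot>\<^bsub>?F\<^esub> f"
      "\<alpha> \<odot>\<^bsub>?F\<^esub> (f \<oplus>\<^bsub>?F\<^esub> g) = \<alpha> \<odot>\<^bsub>?F\<^esub> f \<oplus>\<^bsub>?F\<^esub> \<alpha> \<odot>\<^bsub>?F\<^esub> g"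
      "(\<alpha> \<otimes> \<beta>) \<odot>\<^bsub>?F\<^esub> f = \<alpha> \<odot>\<^bsub>?F\<^esub> (\<beta> \<odot>\<^bsub>?F\<^esub> f)"
      using * car by (simp_all add: free_alg_simps l_distr r_distr m_assoc)
  next
    fix f :: "'x monomial \<Rightarrow> 'a" assume "f \<in> carrier ?F"
    then show "\<one> \<odot>\<^bsub>?F\<^esub> f = f" using car by (simp add: free_alg_simps)
  qed
  then show ?thesis
  proof (rule unital_algebra.intro, unfold_locales)
    show one: "\<one>\<^bsub>?F\<^esub> \<in> carrier ?F" by (simp add: free_alg_simps)
    fix f g h :: "'x monomial \<Rightarrow> 'a"
    assume fgh: "f \<in> carrier ?F" "g \<in> carrier ?F" "h \<in> carrier ?F"
    note c [simp] = car[OF fgh(1)] car[OF fgh(2)] car[OF fgh(3)]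
    have "(f \<otimes>\<^bsub>?F\<^esub> g) w \<in> carrier R" for w
      by (cases w rule: monomial_cases) (simp_all add: free_alg_mult)
    then show "f \<otimes>\<^bsub>?F\<^esub> g \<in> carrier ?F"
      using free_alg_mult_support[OF fgh(1,2)] by (simp add: free_alg_simps)
    show "\<one>\<^bsub>?F\<^esub> \<otimes>\<^bsub>?F\<^esub> f = f" "f \<otimes>\<^bsub>?F\<^esub> \<one>\<^bsub>?F\<^esub> = f"
    proof -
      have "(\<one>\<^bsub>?F\<^esub> \<otimes>\<^bsub>?F\<^esub> f) w = f w" "(f \<otimes>\<^bsub>?F\<^esub> \<one>\<^bsub>?F\<^esub>) w = f w" for w
        by (cases w rule: monomial_cases; simp add: free_alg_mult free_alg_simps(2))+
      then show "\<one>\<^bsub>?F\<^esub> \<otimes>\<^bsub>?F\<^esub> f = f" "f \<otimes>\<^bsub>?F\<^esub> \<one>\<^bsub>?F\<^esub> = f" by auto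
    qed
    have "((f \<oplus>\<^bsub>?F\<^esub> g) \<otimes>\<^bsub>?F\<^esub> h) w = (f \<otimes>\<^bsub>?F\<^esub> h \<oplus>\<^bsub>?F\<^esub> g \<otimes>\<^bsub>?F\<^esub> h) w"
      "(h \<otimes>\<^bsub>?F\<^esub> (f \<oplus>\<^bsub>?F\<^esub> g)) w = (h \<otimes>\<^bsub>?F\<^esub> f \<oplus>\<^bsub>?F\<^esub> h \<otimes>\<^bsub>?F\<^esub> g) w" for w
      by (cases w rule: monomial_cases; simp add: free_alg_mult free_alg_simps(4) l_distr r_distr a_ac)+
    then show "(f \<oplus>\<^bsub>?F\<^esub> g) \<otimes>\<^bsub>?F\<^esub> h = f \<otimes>\<^bsub>?F\<^esub> h \<oplus>\<^bsub>?F\<^esub> g \<otimes>\<^bsub>?F\<^esub> h"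
      "h \<otimes>\<^bsub>?F\<^esub> (f \<oplus>\<^bsub>?F\<^esub> g) = h \<otimes>\<^bsub>?F\<^esub> f \<oplus>\<^bsub>?F\<^esub> h \<otimes>\<^bsub>?F\<^esub> g" by auto
    fix \<alpha> assume al: "\<alpha> \<in> carrier R"
    have "((\<alpha> \<odot>\<^bsub>?F\<^esub> f) \<otimes>\<^bsub>?F\<^esub> g) w = (\<alpha> \<odot>\<^bsub>?F\<^esub> (f \<otimes>\<^bsub>?F\<^esub> g)) w"
       "(f \<otimes>\<^bsub>?F\<^esub> (\<alpha> \<odot>\<^bsub>?F\<^esub> g)) w = (\<alpha> \<odot>\<^bsub>?F\<^esub> (f \<otimes>\<^bsub>?F\<^esub> g)) w" for w
      using al by (cases w rule: monomial_cases; simp add: free_alg_mult free_alg_simps(5) r_distr m_ac)+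
    then show "(\<alpha> \<odot>\<^bsub>?F\<^esub> f) \<otimes>\<^bsub>?F\<^esub> g = \<alpha> \<odot>\<^bsub>?F\<^esub> (f \<otimes>\<^bsub>?F\<^esub> g)"
       "f \<otimes>\<^bsub>?F\<^esub> (\<alpha> \<odot>\<^bsub>?F\<^esub> g) = \<alpha> \<odot>\<^bsub>?F\<^esub> (f \<otimes>\<^bsub>?F\<^esub> g)" by auto
  qed
qed

definition free_monomial :: "('k, 'm) ring_scheme \<Rightarrow> 'x monomial \<Rightarrow> 'x monomial \<Rightarrow> 'k"
  where "free_monomial R u = (\<lambda>w. if w = u then \<one>\<^bsub>R\<^esub> else \<zero>\<^bsub>R\<^esub>)"

lemma free_gen_eq_monomial: "free_gen R x = free_monomial R (Some (Gen x))"
  by (simp add: free_gen_def free_monomial_def)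

context cring
begin

lemma free_monomial_closed [simp]: "free_monomial R u \<in> carrier (free_alg R)"
proof -
  have "{w. free_monomial R u w \<noteq> \<zero>} \<subseteq> {u}" by (auto simp: free_monomial_def)
  then show ?thesis
    using finite_subset by (auto simp: free_alg_simps free_monomial_def)
qed

lemma one_eq_free_monomial: "\<one>\<^bsub>free_alg R\<^esub> = free_monomial R None"
  by (simp add: free_alg_simps free_monomial_def)

lemma free_monomial_mult:
  "free_monomial R u \<otimes>\<^bsub>free_alg R\<^esub> free_monomial R v = free_monomial R (mono_mult u v)"
proof
  fix w
  have c: "free_monomial R z w \<in> carrier R" for z w by (simp add: free_monomial_def)
  show "(free_monomial R u \<otimes>\<^bsub>free_alg R\<^esub> free_monomial R v) w = free_monomial R (mono_mult u v) w"
    by (cases u; cases v; cases w rule: monomial_cases)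
       (auto simp: free_alg_mult c, auto simp: free_monomial_def)
qed

text \<open>The monomials span. The induction is on a finite set containing the support.\<close>

lemma free_alg_induct [consumes 1, case_names zero add]:
  fixes f :: "'x monomial \<Rightarrow> 'a"
  assumes f: "f \<in> carrier (free_alg R)"
    and zero: "P \<zero>\<^bsub>free_alg R\<^esub>"
    and add: "\<And>f \<alpha> u. \<lbrakk>f \<in> carrier (free_alg R); \<alpha> \<in> carrier R; P f\<rbrakk>
        \<Longrightarrow> P (f \<oplus>\<^bsub>free_alg R\<^esub> \<alpha> \<odot>\<^bsub>free_alg R\<^esub> free_monomial R u)"
  shows "P f"
proof -
  have "P f" if "finite S" "f \<in> carrier (free_alg R)" "{w. f w \<noteq> \<zero>} \<subseteq> S" for S and f :: "'x monomial \<Rightarrow> 'a"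
    using that
  proof (induction S arbitrary: f rule: finite_induct)
    case empty
    then have "f = \<zero>\<^bsub>free_alg R\<^esub>" by (auto simp: free_alg_simps)
    then show ?case using zero by simp
  next
    case (insert u S)
    have c: "f w \<in> carrier R" for w using insert.prems by (simp add: free_alg_simps)
    \<comment> \<open>Split off the term of the monomial that leaves the support.\<close>
    define g where "g = f(u := \<zero>)"
    have "{w. g w \<noteq> \<zero>} \<subseteq> {w. f w \<noteq> \<zero>}" by (auto simp: g_def)
    then have "finite {w. g w \<noteq> \<zero>}"
      using insert.prems finite_subset by (auto simp: free_alg_simps)
    then have g: "g \<in> carrier (free_alg R)" using c by (auto simp: g_def free_alg_simps)
    have "{w. g w \<noteq> \<zero>} \<subseteq> S" using insert.prems by (auto simp: g_def)
    then have "P g" by (rule insert.IH[OF g])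
    moreover have "f = g \<oplus>\<^bsub>free_alg R\<^esub> f u \<odot>\<^bsub>free_alg R\<^esub> free_monomial R u"
      using c by (auto simp: free_alg_simps g_def free_monomial_def)
    ultimately show ?case using add[OF g c] by metis
  qed
  from this[OF _ f subset_refl] show ?thesis using f by (simp add: free_alg_simps)
qed

theorem free_alg_generated: "alg_generated_by R (free_alg R) (range (free_gen R :: 'x \<Rightarrow> _))"
proof -
  interpret F: unital_algebra R "free_alg R :: ('a, 'x monomial \<Rightarrow> 'a) module"
    by (rule free_alg_unital_algebra)
  show ?thesis
    unfolding alg_generated_by_iff
  proof (intro conjI allI impI)
    show "range (free_gen R :: 'x \<Rightarrow> _) \<subseteq> carrier (free_alg R)"
      by (auto simp: free_gen_eq_monomial)
    fix S :: "('x monomial \<Rightarrow> 'a) set" assume S: "subalgebra R (free_alg R) S \<and> range (free_gen R) \<subseteq> S"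
    note SD = F.subalgebraD[OF conjunct1[OF S]]
    have word: "free_monomial R (Some t) \<in> S" for t
    proof (induction t)
      case (Gen x)
      then show ?case using S by (auto simp: free_gen_eq_monomial)
    next
      case (Prod p q)
      then show ?case using SD(5) free_monomial_mult[of "Some p" "Some q"] by fastforce
    qed
    have mono: "free_monomial R u \<in> S" for u
      using SD(2) word by (cases u) (auto simp: one_eq_free_monomial)
    have "f \<in> S" if "f \<in> carrier (free_alg R)" for f
      using that by (induction rule: free_alg_induct) (use SD mono in auto)
    then show "S = carrier (free_alg R)" using SD(1) by blast
  qed
qed

end

primrec word_eval :: "('a, 'm) ring_scheme \<Rightarrow> ('x \<Rightarrow> 'a) \<Rightarrow> 'x word \<Rightarrow> 'a" where
  "word_eval A a (Gen x) = a x"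
| "word_eval A a (Prod p q) = word_eval A a p \<otimes>\<^bsub>A\<^esub> word_eval A a q"

definition monomial_eval :: "('a, 'm) ring_scheme \<Rightarrow> ('x \<Rightarrow> 'a) \<Rightarrow> 'x monomial \<Rightarrow> 'a"
  where "monomial_eval A a u = (case u of None \<Rightarrow> \<one>\<^bsub>A\<^esub> | Some t \<Rightarrow> word_eval A a t)"

definition free_eval ::
    "('k, 'm) ring_scheme \<Rightarrow> ('k, 'a, 'n) module_scheme \<Rightarrow> ('x \<Rightarrow> 'a) \<Rightarrow> ('x monomial \<Rightarrow> 'k) \<Rightarrow> 'a"
  where "free_eval R A a f = finsum A (\<lambda>u. f u \<odot>\<^bsub>A\<^esub> monomial_eval A a u) {u. f u \<noteq> \<zero>\<^bsub>R\<^esub>}"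

text \<open>The homomorphism substitutes \<open>a\<close> for the generators. It is linear since the sum defining it may be taken
over any finite set containing the support; it is multiplicative because it is so on monomials, which
span.\<close>

theorem (in unital_algebra) free_alg_lift:
  fixes a :: "'x \<Rightarrow> 'a"
  assumes a: "range a \<subseteq> carrier A"
  shows "\<exists>h \<in> alg_hom R (free_alg R) A. \<forall>x. h (free_gen R x) = a x"
proof -
  interpret F: unital_algebra R "free_alg R :: ('k, 'x monomial \<Rightarrow> 'k) module"
    by (rule R.free_alg_unital_algebra)
  note simps = R.free_alg_simps
  let ?e = "free_eval R A a" and ?m = "monomial_eval A a"
  have word: "word_eval A a t \<in> carrier A" for t
    using a by (induction t) auto
  then have m [simp]: "?m u \<in> carrier A" for u
    by (auto simp: monomial_eval_def split: option.split)
  have m_mult: "?m (mono_mult u v) = ?m u \<otimes>\<^bsub>A\<^esub> ?m v" for u v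
    using word by (cases u; cases v) (auto simp: monomial_eval_def)
  \<comment> \<open>A common finite index set makes the sums for two elements comparable.\<close>
  have super: "?e f = finsum A (\<lambda>u. f u \<odot>\<^bsub>A\<^esub> ?m u) S"
    if f: "f \<in> carrier (free_alg R)" and S: "finite S" "{u. f u \<noteq> \<zero>} \<subseteq> S" for f S
    unfolding free_eval_def
    using f S by (intro M.add.finprod_mono_neutral_cong_left) (auto simp: simps)
  have closed: "?e f \<in> carrier A" if "f \<in> carrier (free_alg R)" for f
    using that unfolding free_eval_def by (intro M.finsum_closed) (auto simp: simps)
  have e_add: "?e (f \<oplus>\<^bsub>free_alg R\<^esub> g) = ?e f \<oplus>\<^bsub>A\<^esub> ?e g"
    if f: "f \<in> carrier (free_alg R)" and g: "g \<in> carrier (free_alg R)" for f g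
  proof -
    let ?S = "{u. f u \<noteq> \<zero>} \<union> {u. g u \<noteq> \<zero>}"
    have fin: "finite ?S" using f g by (auto simp: simps)
    have c: "f u \<in> carrier R" "g u \<in> carrier R" for u using f g by (auto simp: simps)
    have "?e (f \<oplus>\<^bsub>free_alg R\<^esub> g) = finsum A (\<lambda>u. (f \<oplus>\<^bsub>free_alg R\<^esub> g) u \<odot>\<^bsub>A\<^esub> ?m u) ?S"
      by (rule super[OF _ fin]) (use F.M.a_closed[OF f g] c in \<open>auto simp: simps(4)\<close>)
    also have "\<dots> = finsum A (\<lambda>u. f u \<odot>\<^bsub>A\<^esub> ?m u \<oplus>\<^bsub>A\<^esub> g u \<odot>\<^bsub>A\<^esub> ?m u) ?S"
      by (rule M.finsum_cong') (auto simp: simps(4) c smult_l_distr)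
    also have "\<dots> = finsum A (\<lambda>u. f u \<odot>\<^bsub>A\<^esub> ?m u) ?S \<oplus>\<^bsub>A\<^esub> finsum A (\<lambda>u. g u \<odot>\<^bsub>A\<^esub> ?m u) ?S"
      by (rule M.finsum_addf) (auto simp: c)
    also have "\<dots> = ?e f \<oplus>\<^bsub>A\<^esub> ?e g"
      using super[OF f fin] super[OF g fin] by simp
    finally show ?thesis .
  qed
  have e_smult: "?e (\<alpha> \<odot>\<^bsub>free_alg R\<^esub> f) = \<alpha> \<odot>\<^bsub>A\<^esub> ?e f"
    if al: "\<alpha> \<in> carrier R" and f: "f \<in> carrier (free_alg R)" for \<alpha> f
  proof -
    let ?S = "{u. f u \<noteq> \<zero>}"
    have fin: "finite ?S" using f by (auto simp: simps)
    have c: "f u \<in> carrier R" for u using f by (auto simp: simps)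
    have "?e (\<alpha> \<odot>\<^bsub>free_alg R\<^esub> f) = finsum A (\<lambda>u. (\<alpha> \<odot>\<^bsub>free_alg R\<^esub> f) u \<odot>\<^bsub>A\<^esub> ?m u) ?S"
      by (rule super[OF _ fin]) (use F.smult_closed[OF al f] al in \<open>auto simp: simps(5)\<close>)
    also have "\<dots> = finsum A (\<lambda>u. \<alpha> \<odot>\<^bsub>A\<^esub> (f u \<odot>\<^bsub>A\<^esub> ?m u)) ?S"
      by (rule M.finsum_cong') (auto simp: simps(5) c al smult_assoc1)
    also have "\<dots> = \<alpha> \<odot>\<^bsub>A\<^esub> ?e f"
      unfolding free_eval_def by (rule finsum_smult_ldistr[symmetric]) (auto simp: fin c al)
    finally show ?thesis .
  qed
  have e_mono: "?e (free_monomial R u) = ?m u" for u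
  proof -
    have "?e (free_monomial R u) = finsum A (\<lambda>v. free_monomial R u v \<odot>\<^bsub>A\<^esub> ?m v) {u}"
      by (rule super[OF R.free_monomial_closed]) (auto simp: free_monomial_def)
    also have "\<dots> = ?m u" by (simp add: free_monomial_def)
    finally show ?thesis .
  qed
  have e_zero: "?e \<zero>\<^bsub>free_alg R\<^esub> = \<zero>\<^bsub>A\<^esub>" by (simp add: free_eval_def simps(3))
  have mono_mult: "?e (free_monomial R u \<otimes>\<^bsub>free_alg R\<^esub> g) = ?m u \<otimes>\<^bsub>A\<^esub> ?e g"
    if "g \<in> carrier (free_alg R)" for u g
    using that
  proof (induction rule: R.free_alg_induct)
    case zero
    then show ?case by (simp add: e_zero)
  next
    case (add g \<alpha> v)
    then show ?case
      by (simp add: F.mult_add_right F.mult_smult_right mult_add_right mult_smult_right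
          e_add e_smult e_mono closed R.free_monomial_mult m_mult)
  qed
  have e_mult: "?e (f \<otimes>\<^bsub>free_alg R\<^esub> g) = ?e f \<otimes>\<^bsub>A\<^esub> ?e g"
    if "f \<in> carrier (free_alg R)" and g: "g \<in> carrier (free_alg R)" for f g
    using that(1)
  proof (induction rule: R.free_alg_induct)
    case zero
    then show ?case using g closed by (simp add: e_zero)
  next
    case (add f \<alpha> u)
    then show ?case using g
      by (simp add: F.mult_add_left F.mult_smult_left mult_add_left mult_smult_left
          e_add e_smult e_mono closed mono_mult)
  qed
  have "?e \<in> alg_hom R (free_alg R) A"
    by (rule alg_homI)
       (auto simp: closed e_add e_smult e_mult R.one_eq_free_monomial e_mono, simp add: monomial_eval_def)
  moreover have "?e (free_gen R x) = a x" for x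
    by (simp add: free_gen_eq_monomial e_mono monomial_eval_def)
  ultimately show ?thesis by blast
qed

section \<open>Presented alternative algebras\<close>

text \<open>Kernels are ideals, so with the next lemma a homomorphism to an alternative algebra that respects the
relations kills the whole presentation ideal.\<close>

lemma relators_subset_kernel:
  assumes A: "unital_algebra R A" and B: "unital_algebra R B" and h: "h \<in> alg_hom R A B"
    and Rel: "Rel \<subseteq> carrier A \<times> carrier A" and eq: "\<And>l r. (l, r) \<in> Rel \<Longrightarrow> h l = h r"
  shows "relators A Rel \<subseteq> {x \<in> carrier A. h x = \<zero>\<^bsub>B\<^esub>}"
proof
  interpret A: unital_algebra R A by fact
  interpret B: unital_algebra R B by fact
  fix x assume "x \<in> relators A Rel"
  then obtain l r where lr: "(l, r) \<in> Rel" "x = l \<ominus>\<^bsub>A\<^esub> r" by (auto simp: relators_def)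
  then have c: "l \<in> carrier A" "r \<in> carrier A" using Rel by auto
  then have "h x = h l \<ominus>\<^bsub>B\<^esub> h r"
    by (simp add: lr(2) a_minus_def alg_homD(2)[OF h] alg_hom_minus[OF A B h])
  also have "\<dots> = \<zero>\<^bsub>B\<^esub>"
    using eq[OF lr(1)] alg_homD(1)[OF h c(2)] by (simp add: a_minus_def B.M.r_neg)
  finally show "x \<in> {x \<in> carrier A. h x = \<zero>\<^bsub>B\<^esub>}" using c by (simp add: lr(2))
qed

lemma alternators_subset_kernel:
  assumes A: "unital_algebra R A" and B: "alternative_algebra R B" and h: "h \<in> alg_hom R A B"
  shows "alternators A \<subseteq> {x \<in> carrier A. h x = \<zero>\<^bsub>B\<^esub>}"
proof -
  interpret A: unital_algebra R A by fact
  interpret B: alternative_algebra R B by fact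
  have "h (associator A a b c) = associator B (h a) (h b) (h c)"
    if "a \<in> carrier A" "b \<in> carrier A" "c \<in> carrier A" for a b c
    using that by (rule alg_hom_associator[OF A B.unital_algebra_axioms h])
  moreover have "associator A a b c \<in> carrier A"
    if "a \<in> carrier A" "b \<in> carrier A" "c \<in> carrier A" for a b c
    using that by (simp add: associator_def)
  ultimately show ?thesis
    using B.left_alternative B.right_alternative alg_homD(1)[OF h] by (auto simp: alternators_def)
qed

locale presentation = cring R for R :: "('k, 'm) ring_scheme" (structure) +
  fixes Rel :: "(('x monomial \<Rightarrow> 'k) \<times> ('x monomial \<Rightarrow> 'k)) set"
  assumes Rel: "Rel \<subseteq> carrier (free_alg R) \<times> carrier (free_alg R)"
begin

sublocale F: unital_algebra R "free_alg R :: ('k, 'x monomial \<Rightarrow> 'k) module"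
  by (rule free_alg_unital_algebra)

lemma relators_closed:
  "alternators (free_alg R) \<union> relators (free_alg R) Rel \<subseteq> carrier (free_alg R)"
  using Rel by (auto simp: alternators_def relators_def associator_def)

sublocale algebra_ideal R "free_alg R" "presentation_ideal R Rel"
  by unfold_locales (use F.alg_ideal_genideal[OF relators_closed] in \<open>simp add: presentation_ideal_def\<close>)

lemma relators_in_ideal:
  "alternators (free_alg R) \<subseteq> presentation_ideal R Rel"
  "relators (free_alg R) Rel \<subseteq> presentation_ideal R Rel"
  using subset_alg_genideal[of "alternators (free_alg R) \<union> relators (free_alg R) Rel" R "free_alg R"]
  by (auto simp: presentation_ideal_def)

theorem presented_alternative: "alternative_algebra R (presented_alg R Rel)"
  unfolding presented_alg_def by (rule quot_alternative[OF relators_in_ideal(1)])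

lemma presented_hom:
  "(\<lambda>f. presentation_ideal R Rel +>\<^bsub>free_alg R\<^esub> f) \<in> alg_hom R (free_alg R) (presented_alg R Rel)"
  unfolding presented_alg_def by (rule quot_hom)

theorem presented_relation:
  assumes "(l, r) \<in> Rel"
  shows "presentation_ideal R Rel +>\<^bsub>free_alg R\<^esub> l = presentation_ideal R Rel +>\<^bsub>free_alg R\<^esub> r"
proof (subst coset_eq_iff)
  show "l \<ominus>\<^bsub>free_alg R\<^esub> r \<in> presentation_ideal R Rel"
    using relators_in_ideal(2) assms by (auto simp: relators_def)
qed (use assms Rel in auto)

theorem presented_generated: "alg_generated_by R (presented_alg R Rel) (range (presented_gen R Rel))"
proof -
  have "range (presented_gen R Rel)
      = (\<lambda>f. presentation_ideal R Rel +>\<^bsub>free_alg R\<^esub> f) ` range (free_gen R)"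
    by (auto simp: presented_gen_def)
  then show ?thesis
    using alg_generated_by_image[OF F.unital_algebra_axioms quot_unital_algebra quot_hom quot_surj free_alg_generated]
    by (simp add: presented_alg_def)
qed

text \<open>The presented algebra is universal among alternative algebras with elements satisfying the
relations: these elements are given by \<open>h\<close>, a homomorphism on the free algebra.\<close>

theorem presented_lift:
  fixes A :: "('k, 'a, 'n) module_scheme"
  assumes A: "alternative_algebra R A" and h: "h \<in> alg_hom R (free_alg R) A"
    and rel: "\<And>l r. (l, r) \<in> Rel \<Longrightarrow> h l = h r"
  shows "\<exists>g \<in> alg_hom R (presented_alg R Rel) A. \<forall>x. g (presented_gen R Rel x) = h (free_gen R x)"
proof -
  interpret A: alternative_algebra R A by fact
  let ?K = "{f \<in> carrier (free_alg R). h f = \<zero>\<^bsub>A\<^esub>}"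
  have "alternators (free_alg R) \<union> relators (free_alg R) Rel \<subseteq> ?K"
    using relators_subset_kernel[OF F.unital_algebra_axioms A.unital_algebra_axioms h Rel rel]
      alternators_subset_kernel[OF F.unital_algebra_axioms A h] by simp
  then have "presentation_ideal R Rel \<subseteq> ?K"
    unfolding presentation_ideal_def
    by (rule alg_genideal_minimal[OF alg_ideal_kernel[OF F.unital_algebra_axioms A.unital_algebra_axioms h]])
  then obtain g where g: "g \<in> alg_hom R (presented_alg R Rel) A"
      "\<forall>f\<in>carrier (free_alg R). g (presentation_ideal R Rel +>\<^bsub>free_alg R\<^esub> f) = h f"
    using quot_lift[OF A.unital_algebra_axioms h] unfolding presented_alg_def by blast
  then have "\<forall>x. g (presented_gen R Rel x) = h (free_gen R x)"
    by (simp add: presented_gen_def free_gen_eq_monomial)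
  then show ?thesis using g(1) by blast
qed

end

section \<open>The octonion relations\<close>

text \<open>The relation sets are natural in the algebra. This carries the relations between the free algebra, its
quotients and the octonions without looking at the individual equations.\<close>

lemma cayley_rels_image:
  assumes A: "unital_algebra R A" and B: "unital_algebra R B" and h: "h \<in> alg_hom R A B"
    and t: "t1 \<in> carrier A" "t2 \<in> carrier A" "t3 \<in> carrier A"
  shows "cayley_rels B (h t1) (h t2) (h t3) = map_prod h h ` cayley_rels A t1 t2 t3"
proof -
  interpret A: unital_algebra R A by fact
  show ?thesis using t by (simp add: cayley_rels_def alg_homD[OF h] alg_hom_minus[OF A B h])
qed

lemma square_rels_image:
  assumes A: "unital_algebra R A" and h: "h \<in> alg_hom R A B"
    and mu: "\<mu>1 \<in> carrier R" "\<mu>2 \<in> carrier R" "\<mu>3 \<in> carrier R"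
    and t: "t1 \<in> carrier A" "t2 \<in> carrier A" "t3 \<in> carrier A"
  shows "square_rels B \<mu>1 \<mu>2 \<mu>3 (h t1) (h t2) (h t3) = map_prod h h ` square_rels A \<mu>1 \<mu>2 \<mu>3 t1 t2 t3"
proof -
  interpret A: unital_algebra R A by fact
  show ?thesis using t mu by (simp add: square_rels_def alg_homD[OF h])
qed

lemma (in unital_algebra) cayley_rels_closed:
  assumes t: "t1 \<in> carrier A" "t2 \<in> carrier A" "t3 \<in> carrier A"
  shows "cayley_rels A t1 t2 t3 \<subseteq> carrier A \<times> carrier A"
  using t by (simp add: cayley_rels_def)

lemma (in unital_algebra) square_rels_closed:
  assumes t: "t1 \<in> carrier A" "t2 \<in> carrier A" "t3 \<in> carrier A"
    and mu: "\<mu>1 \<in> carrier R" "\<mu>2 \<in> carrier R" "\<mu>3 \<in> carrier R"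
  shows "square_rels A \<mu>1 \<mu>2 \<mu>3 t1 t2 t3 \<subseteq> carrier A \<times> carrier A"
  using t mu by (simp add: square_rels_def)

lemma octonion_tripleD:
  assumes "octonion_triple A \<mu>1 \<mu>2 \<mu>3 a"
    and "(l, r) \<in> cayley_rels A (a T1) (a T2) (a T3) \<union> square_rels A \<mu>1 \<mu>2 \<mu>3 (a T1) (a T2) (a T3)"
  shows "l = r"
  using bspec[OF conjunct2[OF assms(1)[unfolded octonion_triple_def]] assms(2)] by simp

text \<open>This lemma and the next are the two directions in which naturality is used: a homomorphism that equates
the two sides of the relations maps \<open>t\<close> to an octonion triple, and one that maps \<open>t\<close> to an octonion triple
equates the two sides.\<close>

lemma octonion_triple_image:
  assumes A: "unital_algebra R A" and B: "unital_algebra R B" and h: "h \<in> alg_hom R A B"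
    and mu: "\<mu>1 \<in> carrier R" "\<mu>2 \<in> carrier R" "\<mu>3 \<in> carrier R" and t: "range t \<subseteq> carrier A"
    and eq: "\<And>l r. (l, r) \<in> cayley_rels A (t T1) (t T2) (t T3) \<union> square_rels A \<mu>1 \<mu>2 \<mu>3 (t T1) (t T2) (t T3)
      \<Longrightarrow> h l = h r"
  shows "octonion_triple B \<mu>1 \<mu>2 \<mu>3 (\<lambda>i. h (t i))"
  unfolding octonion_triple_def
proof (intro conjI ballI)
  have t': "t i \<in> carrier A" for i using t by auto
  then show "range (\<lambda>i. h (t i)) \<subseteq> carrier B" using alg_homD(1)[OF h] by auto
  fix p assume "p \<in> cayley_rels B (h (t T1)) (h (t T2)) (h (t T3))
      \<union> square_rels B \<mu>1 \<mu>2 \<mu>3 (h (t T1)) (h (t T2)) (h (t T3))"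
  then have "p \<in> map_prod h h `
      (cayley_rels A (t T1) (t T2) (t T3) \<union> square_rels A \<mu>1 \<mu>2 \<mu>3 (t T1) (t T2) (t T3))"
    by (simp only: image_Un cayley_rels_image[OF A B h t' t' t'] square_rels_image[OF A h mu t' t' t'])
  then obtain q where q: "p = map_prod h h q"
      "q \<in> cayley_rels A (t T1) (t T2) (t T3) \<union> square_rels A \<mu>1 \<mu>2 \<mu>3 (t T1) (t T2) (t T3)"
    by (rule imageE)
  then show "case p of (l, r) \<Rightarrow> l = r" using eq[of "fst q" "snd q"] by (simp add: map_prod_def split_beta)
qed

lemma octonion_triple_hom_eq:
  assumes A: "unital_algebra R A" and B: "unital_algebra R B" and h: "h \<in> alg_hom R A B"
    and mu: "\<mu>1 \<in> carrier R" "\<mu>2 \<in> carrier R" "\<mu>3 \<in> carrier R" and t: "range t \<subseteq> carrier A"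
    and triple: "octonion_triple B \<mu>1 \<mu>2 \<mu>3 b" and b: "\<forall>i. h (t i) = b i"
    and lr: "(l, r) \<in> cayley_rels A (t T1) (t T2) (t T3) \<union> square_rels A \<mu>1 \<mu>2 \<mu>3 (t T1) (t T2) (t T3)"
  shows "h l = h r"
proof (rule octonion_tripleD[OF triple])
  have t': "t i \<in> carrier A" for i using t by auto
  have "(h l, h r) \<in> map_prod h h `
      (cayley_rels A (t T1) (t T2) (t T3) \<union> square_rels A \<mu>1 \<mu>2 \<mu>3 (t T1) (t T2) (t T3))"
    using imageI[OF lr, of "map_prod h h"] by simp
  then show "(h l, h r) \<in> cayley_rels B (b T1) (b T2) (b T3) \<union> square_rels B \<mu>1 \<mu>2 \<mu>3 (b T1) (b T2) (b T3)"
    by (simp only: image_Un cayley_rels_image[OF A B h t' t' t', symmetric]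
        square_rels_image[OF A h mu t' t' t', symmetric] spec[OF b])
qed

context octonions
begin

text \<open>The inverse of \<open>h\<close> is supplied by \<open>octonion_lift\<close>; the two maps exchange the generators.\<close>

lemma octonion_iso:
  fixes A :: "('k, 'a, 'n) module_scheme"
  assumes A: "alternative_algebra R A" and triple: "octonion_triple A \<mu>1 \<mu>2 \<mu>3 a"
    and gen: "alg_generated_by R A (range a)"
    and h: "h \<in> alg_hom R A (octonion_alg R \<mu>1 \<mu>2 \<mu>3)" "\<And>i. h (a i) = oct_gen R \<mu>1 \<mu>2 i"
  shows "h \<in> alg_iso R A (octonion_alg R \<mu>1 \<mu>2 \<mu>3)"
    and "alg_isomorphic R (octonion_alg R \<mu>1 \<mu>2 \<mu>3) A"
proof -
  interpret A: alternative_algebra R A by fact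
  obtain g where g: "g \<in> alg_hom R (octonion_alg R \<mu>1 \<mu>2 \<mu>3) A" "\<forall>i. g (oct_gen R \<mu>1 \<mu>2 i) = a i"
    using A.octonion_lift[OF mu1 mu2 mu3 triple] by blast
  show "h \<in> alg_iso R A (octonion_alg R \<mu>1 \<mu>2 \<mu>3)"
    by (rule alg_iso_of_generators[OF A.unital_algebra_axioms Oct.unital_algebra_axioms h(1) g(1)
          gen octonion_generated]) (use h(2) g(2) in auto)
  have "g \<in> alg_iso R (octonion_alg R \<mu>1 \<mu>2 \<mu>3) A"
    by (rule alg_iso_of_generators[OF Oct.unital_algebra_axioms A.unital_algebra_axioms g(1) h(1)
          octonion_generated gen]) (use h(2) g(2) in auto)
  then show "alg_isomorphic R (octonion_alg R \<mu>1 \<mu>2 \<mu>3) A" by (auto simp: alg_isomorphic_def)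
qed

lemma free_gen_closed: "free_gen R i \<in> carrier (free_alg R)"
  by (simp add: free_gen_eq_monomial)

lemma range_free_gen: "range (free_gen R) \<subseteq> carrier (free_alg R)"
  using free_gen_closed by auto

lemma presentation_cayley: "presentation R (free_cayley_rels R)"
proof -
  interpret F: unital_algebra R "free_alg R :: ('k, gen3 monomial \<Rightarrow> 'k) module"
    by (rule free_alg_unital_algebra)
  show ?thesis
    by unfold_locales (unfold free_cayley_rels_def, intro F.cayley_rels_closed free_gen_closed)
qed

lemma presentation_octonion: "presentation R (free_cayley_rels R \<union> free_square_rels R \<mu>1 \<mu>2 \<mu>3)"
proof -
  interpret F: unital_algebra R "free_alg R :: ('k, gen3 monomial \<Rightarrow> 'k) module"
    by (rule free_alg_unital_algebra)
  show ?thesis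
    by unfold_locales (unfold free_cayley_rels_def free_square_rels_def,
        intro Un_least F.cayley_rels_closed F.square_rels_closed free_gen_closed mu1 mu2 mu3)
qed

theorem octonion_presentation:
  defines "Rel \<equiv> free_cayley_rels R \<union> free_square_rels R \<mu>1 \<mu>2 \<mu>3"
  shows "\<exists>h \<in> alg_iso R (presented_alg R Rel) (octonion_alg R \<mu>1 \<mu>2 \<mu>3).
    \<forall>i. h (presented_gen R Rel i) = oct_gen R \<mu>1 \<mu>2 i"
proof -
  interpret P: presentation R Rel unfolding Rel_def by (rule presentation_octonion)
  let ?P = "presented_alg R Rel" and ?t = "presented_gen R Rel"
  let ?\<pi> = "\<lambda>f. presentation_ideal R Rel +>\<^bsub>free_alg R\<^esub> f"
  interpret PA: alternative_algebra R ?P by (rule P.presented_alternative)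
  have triple: "octonion_triple ?P \<mu>1 \<mu>2 \<mu>3 ?t"
    unfolding presented_gen_def
    by (rule octonion_triple_image[OF P.F.unital_algebra_axioms PA.unital_algebra_axioms P.presented_hom
          mu1 mu2 mu3 range_free_gen], rule P.presented_relation)
       (simp add: Rel_def free_cayley_rels_def free_square_rels_def)
  obtain e where e: "e \<in> alg_hom R (free_alg R) (octonion_alg R \<mu>1 \<mu>2 \<mu>3)"
      "\<forall>i. e (free_gen R i) = oct_gen R \<mu>1 \<mu>2 i"
    using Oct.free_alg_lift[of "oct_gen R \<mu>1 \<mu>2"] octonion_generated by (auto simp: alg_generated_by_iff)
  have "e l = e r" if "(l, r) \<in> Rel" for l r
    by (rule octonion_triple_hom_eq[where h = e and t = "free_gen R" and b = "oct_gen R \<mu>1 \<mu>2", OF P.F.unital_algebra_axioms Oct.unital_algebra_axioms e(1)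
          mu1 mu2 mu3 range_free_gen octonion_triple_oct_gen e(2)])
       (use that in \<open>simp add: Rel_def free_cayley_rels_def free_square_rels_def\<close>)
  then obtain h where h: "h \<in> alg_hom R ?P (octonion_alg R \<mu>1 \<mu>2 \<mu>3)" "\<forall>i. h (?t i) = oct_gen R \<mu>1 \<mu>2 i"
    using P.presented_lift[OF octonion_alternative e(1)] e(2) by auto
  then show ?thesis
    using octonion_iso(1)[OF PA.alternative_algebra_axioms triple P.presented_generated] by blast
qed

text \<open>The quotient is again an alternative algebra generated by an octonion triple: the Cayley relations hold
already before passing to the quotient and the squares are imposed by the ideal. The map to the
octonions factors first through the presentation and then through the ideal of the squares.\<close>

theorem octonion_quotient_of_cayley_polys:
  "alg_isomorphic R (octonion_alg R \<mu>1 \<mu>2 \<mu>3)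
     (alg_quot (cayley_polys R) (cayley_square_ideal R \<mu>1 \<mu>2 \<mu>3))"
proof -
  interpret P: presentation R "free_cayley_rels R" by (rule presentation_cayley)
  let ?P = "cayley_polys R" and ?t = "cayley_var R"
  let ?\<pi> = "\<lambda>f. presentation_ideal R (free_cayley_rels R) +>\<^bsub>free_alg R\<^esub> f"
  interpret PA: alternative_algebra R ?P unfolding cayley_polys_def by (rule P.presented_alternative)
  have \<pi>: "?\<pi> \<in> alg_hom R (free_alg R) ?P" unfolding cayley_polys_def by (rule P.presented_hom)
  have gen: "alg_generated_by R ?P (range ?t)"
    unfolding cayley_polys_def cayley_var_def by (rule P.presented_generated)
  then have t: "?t i \<in> carrier ?P" for i by (auto simp: alg_generated_by_iff)
  note free_image = cayley_rels_image[OF P.F.unital_algebra_axioms _ _ free_gen_closed free_gen_closed free_gen_closed]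
  have cayley: "l = r" if "(l, r) \<in> cayley_rels ?P (?t T1) (?t T2) (?t T3)" for l r
    using that free_image[OF PA.unital_algebra_axioms \<pi>] P.presented_relation
    by (auto simp: cayley_var_def presented_gen_def free_cayley_rels_def)
  let ?sq = "square_rels ?P \<mu>1 \<mu>2 \<mu>3 (?t T1) (?t T2) (?t T3)"
  have sq: "?sq \<subseteq> carrier ?P \<times> carrier ?P" by (intro PA.square_rels_closed t mu1 mu2 mu3)
  then have relators: "relators ?P ?sq \<subseteq> carrier ?P"
    unfolding relators_def by auto
  let ?J = "cayley_square_ideal R \<mu>1 \<mu>2 \<mu>3"
  interpret J: algebra_ideal R ?P ?J
    by unfold_locales (unfold cayley_square_ideal_def, rule PA.alg_ideal_genideal[OF relators])
  let ?Q = "alg_quot ?P ?J" and ?\<rho> = "\<lambda>x. ?J +>\<^bsub>?P\<^esub> x"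
  have kill: "?\<rho> x = \<zero>\<^bsub>?Q\<^esub>" if "x \<in> alternators ?P" for x
  proof -
    have "x = \<zero>\<^bsub>?P\<^esub>" using that PA.left_alternative PA.right_alternative by (auto simp: alternators_def)
    then show ?thesis by (simp only: J.quot_zero)
  qed
  interpret QA: alternative_algebra R ?Q
    by (rule alternative_algebra_of_surj[OF PA.unital_algebra_axioms J.quot_unital_algebra J.quot_hom J.quot_surj kill])
  have genQ: "alg_generated_by R ?Q (range (\<lambda>i. ?\<rho> (?t i)))"
    using alg_generated_by_image[OF PA.unital_algebra_axioms QA.unital_algebra_axioms J.quot_hom J.quot_surj gen]
    by (simp add: image_image)
  have triple: "octonion_triple ?Q \<mu>1 \<mu>2 \<mu>3 (\<lambda>i. ?\<rho> (?t i))"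
  proof -
    have "?\<rho> l = ?\<rho> r" if lr: "(l, r) \<in> ?sq" for l r
    proof (subst J.coset_eq_iff)
      have "l \<ominus>\<^bsub>?P\<^esub> r \<in> relators ?P ?sq" using lr by (auto simp: relators_def)
      then show "l \<ominus>\<^bsub>?P\<^esub> r \<in> ?J"
        unfolding cayley_square_ideal_def by (rule subsetD[OF subset_alg_genideal])
    qed (use lr sq in auto)
    moreover have "?\<rho> l = ?\<rho> r" if "(l, r) \<in> cayley_rels ?P (?t T1) (?t T2) (?t T3)" for l r
      using cayley[OF that] by (rule arg_cong)
    ultimately show ?thesis
      using t by (intro octonion_triple_image[OF PA.unital_algebra_axioms QA.unital_algebra_axioms
            J.quot_hom mu1 mu2 mu3]) (auto simp only: Un_iff image_subset_iff)
  qed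
  obtain e where e: "e \<in> alg_hom R (free_alg R) (octonion_alg R \<mu>1 \<mu>2 \<mu>3)"
      "\<forall>i. e (free_gen R i) = oct_gen R \<mu>1 \<mu>2 i"
    using Oct.free_alg_lift[of "oct_gen R \<mu>1 \<mu>2"] octonion_generated by (auto simp: alg_generated_by_iff)
  have "e l = e r" if "(l, r) \<in> free_cayley_rels R" for l r
    by (rule octonion_triple_hom_eq[where h = e and t = "free_gen R" and b = "oct_gen R \<mu>1 \<mu>2", OF P.F.unital_algebra_axioms Oct.unital_algebra_axioms e(1)
          mu1 mu2 mu3 range_free_gen octonion_triple_oct_gen e(2)])
       (use that in \<open>simp add: free_cayley_rels_def\<close>)
  then obtain h where h: "h \<in> alg_hom R ?P (octonion_alg R \<mu>1 \<mu>2 \<mu>3)" "\<forall>i. h (?t i) = oct_gen R \<mu>1 \<mu>2 i"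
    using P.presented_lift[OF octonion_alternative e(1)] e(2) by (auto simp: cayley_polys_def cayley_var_def)
  have "h x = \<zero>\<^bsub>octonion_alg R \<mu>1 \<mu>2 \<mu>3\<^esub>" if "x \<in> ?J" for x
  proof -
    let ?K = "{x \<in> carrier ?P. h x = \<zero>\<^bsub>octonion_alg R \<mu>1 \<mu>2 \<mu>3\<^esub>}"
    have "relators ?P ?sq \<subseteq> ?K"
    proof (rule relators_subset_kernel[OF PA.unital_algebra_axioms Oct.unital_algebra_axioms h(1) sq])
      fix l r assume lr: "(l, r) \<in> ?sq"
      show "h l = h r"
        by (rule octonion_triple_hom_eq[where h = h and t = ?t and b = "oct_gen R \<mu>1 \<mu>2",
              OF PA.unital_algebra_axioms Oct.unital_algebra_axioms h(1)
              mu1 mu2 mu3 _ octonion_triple_oct_gen h(2)]) (use lr t in auto)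
    qed
    then have "?J \<subseteq> ?K"
      unfolding cayley_square_ideal_def
      by (rule alg_genideal_minimal[OF alg_ideal_kernel[OF PA.unital_algebra_axioms Oct.unital_algebra_axioms h(1)]])
    then show ?thesis using that by blast
  qed
  then obtain g where g: "g \<in> alg_hom R ?Q (octonion_alg R \<mu>1 \<mu>2 \<mu>3)" "\<forall>x\<in>carrier ?P. g (?\<rho> x) = h x"
    using J.quot_lift[OF Oct.unital_algebra_axioms h(1)] by blast
  show ?thesis
    by (rule octonion_iso(2)[OF QA.alternative_algebra_axioms triple genQ g(1)]) (use g(2) h(2) t in auto)
qed

end

section \<open>Octonion algebras over a field\<close>

text \<open>The expression in the premise is the polar form of the norm, as a scalar multiple of \<open>1\<close>.\<close>

definition nondegenerate :: "('k, 'a, 'n) star_algebra_scheme \<Rightarrow> bool"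
  where "nondegenerate B \<longleftrightarrow> (\<forall>x\<in>carrier B.
    (\<forall>y\<in>carrier B. x \<otimes>\<^bsub>B\<^esub> star B y \<oplus>\<^bsub>B\<^esub> y \<otimes>\<^bsub>B\<^esub> star B x = \<zero>\<^bsub>B\<^esub>) \<longrightarrow> x = \<zero>\<^bsub>B\<^esub>)"

text \<open>The two summands are orthogonal. Testing \<open>a + vb\<close> against the base recovers the form of the base at
\<open>a\<close>, and testing against its multiples by \<open>v\<close> recovers the form at \<open>b\<close> multiplied by \<open>-\<mu>\<close>.\<close>

theorem (in scalar_involution) cayley_dickson_nondegenerate:
  assumes mu: "\<mu> \<in> carrier R" and cancel: "\<And>x. \<lbrakk>x \<in> carrier B; \<mu> \<odot>\<^bsub>B\<^esub> x = \<zero>\<^bsub>B\<^esub>\<rbrakk> \<Longrightarrow> x = \<zero>\<^bsub>B\<^esub>"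
    and nondeg: "nondegenerate B"
  shows "nondegenerate (cayley_dickson B \<mu>)" (is "nondegenerate ?D")
  unfolding nondegenerate_def
proof (intro ballI impI)
  fix x assume x: "x \<in> carrier ?D"
    and orth: "\<forall>y\<in>carrier ?D. x \<otimes>\<^bsub>?D\<^esub> star ?D y \<oplus>\<^bsub>?D\<^esub> y \<otimes>\<^bsub>?D\<^esub> star ?D x = \<zero>\<^bsub>?D\<^esub>"
  obtain a b where ab: "x = (a, b)" "a \<in> carrier B" "b \<in> carrier B" using x by auto
  have "a \<otimes>\<^bsub>B\<^esub> star B c \<oplus>\<^bsub>B\<^esub> c \<otimes>\<^bsub>B\<^esub> star B a = \<zero>\<^bsub>B\<^esub>" if "c \<in> carrier B" for c
    using bspec[OF orth, of "(c, \<zero>\<^bsub>B\<^esub>)"] ab that mu by simp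
  then have "a = \<zero>\<^bsub>B\<^esub>" using nondeg ab by (simp add: nondegenerate_def)
  moreover have "b \<otimes>\<^bsub>B\<^esub> star B d \<oplus>\<^bsub>B\<^esub> d \<otimes>\<^bsub>B\<^esub> star B b = \<zero>\<^bsub>B\<^esub>" if d: "d \<in> carrier B" for d
  proof -
    have "\<mu> \<odot>\<^bsub>B\<^esub> (\<ominus>\<^bsub>B\<^esub> d \<otimes>\<^bsub>B\<^esub> star B b) \<oplus>\<^bsub>B\<^esub> \<mu> \<odot>\<^bsub>B\<^esub> (\<ominus>\<^bsub>B\<^esub> b \<otimes>\<^bsub>B\<^esub> star B d) = \<zero>\<^bsub>B\<^esub>"
      using bspec[OF orth, of "(\<zero>\<^bsub>B\<^esub>, d)"] ab d mu by simp
    then have "\<ominus>\<^bsub>B\<^esub> d \<otimes>\<^bsub>B\<^esub> star B b \<oplus>\<^bsub>B\<^esub> \<ominus>\<^bsub>B\<^esub> b \<otimes>\<^bsub>B\<^esub> star B d = \<zero>\<^bsub>B\<^esub>"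
      using cancel[of "\<ominus>\<^bsub>B\<^esub> d \<otimes>\<^bsub>B\<^esub> star B b \<oplus>\<^bsub>B\<^esub> \<ominus>\<^bsub>B\<^esub> b \<otimes>\<^bsub>B\<^esub> star B d"] ab d mu
      by (simp add: smult_r_distr)
    moreover have "b \<otimes>\<^bsub>B\<^esub> star B d \<oplus>\<^bsub>B\<^esub> d \<otimes>\<^bsub>B\<^esub> star B b
       = \<ominus>\<^bsub>B\<^esub> (\<ominus>\<^bsub>B\<^esub> d \<otimes>\<^bsub>B\<^esub> star B b \<oplus>\<^bsub>B\<^esub> \<ominus>\<^bsub>B\<^esub> b \<otimes>\<^bsub>B\<^esub> star B d)"
      using ab d by algebra
    ultimately show ?thesis by simp
  qed
  then have "b = \<zero>\<^bsub>B\<^esub>" using nondeg ab by (simp add: nondegenerate_def)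
  ultimately show "x = \<zero>\<^bsub>?D\<^esub>" using ab by simp
qed

lemma (in unital_algebra) smult_eq_zero_field:
  assumes "field R" "\<alpha> \<in> carrier R" "\<alpha> \<noteq> \<zero>" "x \<in> carrier A" "\<alpha> \<odot>\<^bsub>A\<^esub> x = \<zero>\<^bsub>A\<^esub>"
  shows "x = \<zero>\<^bsub>A\<^esub>"
proof -
  have "\<alpha> \<in> Units R" using assms(2,3) field.field_Units[OF assms(1)] by simp
  then have "x = inv \<alpha> \<odot>\<^bsub>A\<^esub> (\<alpha> \<odot>\<^bsub>A\<^esub> x)"
    using assms(2,4) by (simp flip: smult_assoc1)
  then show ?thesis using assms \<open>\<alpha> \<in> Units R\<close> by simp
qed

lemma (in unital_algebra) scalar_eq_zero_field:
  assumes "field R" "carrier A \<noteq> {\<zero>\<^bsub>A\<^esub>}" "\<alpha> \<in> carrier R" "\<alpha> \<odot>\<^bsub>A\<^esub> \<one>\<^bsub>A\<^esub> = \<zero>\<^bsub>A\<^esub>"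
  shows "\<alpha> = \<zero>"
proof (rule ccontr)
  assume "\<alpha> \<noteq> \<zero>"
  then have one: "\<one>\<^bsub>A\<^esub> = \<zero>\<^bsub>A\<^esub>"
    by (rule smult_eq_zero_field[OF assms(1,3) _ one_closed assms(4)])
  have "x = \<zero>\<^bsub>A\<^esub>" if x: "x \<in> carrier A" for x
  proof -
    have "x = \<one>\<^bsub>A\<^esub> \<otimes>\<^bsub>A\<^esub> x" using x by simp
    also have "\<dots> = \<zero>\<^bsub>A\<^esub>" unfolding one using x by simp
    finally show ?thesis .
  qed
  then have "carrier A = {\<zero>\<^bsub>A\<^esub>}" using M.zero_closed by (intro equalityI subsetI) auto
  then show False using assms(2) by simp
qed

lemma alg_hom_injI:
  assumes A: "unital_algebra R A" and B: "unital_algebra R B" and h: "h \<in> alg_hom R A B"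
    and ker: "\<And>x. \<lbrakk>x \<in> carrier A; h x = \<zero>\<^bsub>B\<^esub>\<rbrakk> \<Longrightarrow> x = \<zero>\<^bsub>A\<^esub>"
  shows "inj_on h (carrier A)"
proof (rule inj_onI)
  interpret A: unital_algebra R A by fact
  interpret B: unital_algebra R B by fact
  fix x y assume xy: "x \<in> carrier A" "y \<in> carrier A" "h x = h y"
  have "h (x \<ominus>\<^bsub>A\<^esub> y) = h x \<ominus>\<^bsub>B\<^esub> h y"
    using xy by (simp add: a_minus_def alg_homD[OF h] alg_hom_minus[OF A B h])
  also have "\<dots> = \<zero>\<^bsub>B\<^esub>"
    using xy alg_homD(1)[OF h, of y] by (simp add: B.M.minus_eq B.M.r_neg)
  finally have "x \<ominus>\<^bsub>A\<^esub> y = \<zero>\<^bsub>A\<^esub>" using ker[of "x \<ominus>\<^bsub>A\<^esub> y"] xy by simp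
  then show "x = y" using A.minus_eq_zeroD xy by simp
qed

text \<open>For \<open>x\<close> in the kernel with trace \<open>\<tau>\<close> and any \<open>y\<close>, the image of \<open>xy\<^sup>* + yx\<^sup>* = \<kappa> 1\<close> is
\<open>\<tau> h y\<close>, because \<open>h x\<^sup>* = \<tau> 1\<close>. Depending on \<open>\<tau>\<close>, either all \<open>\<kappa>\<close> vanish, or all values of \<open>h\<close> are
scalars. The latter is incompatible with anticommuting \<open>u\<close> and \<open>w\<close> of nonzero square.\<close>

theorem (in scalar_involution) hom_inj_of_nondegenerate:
  fixes A :: "('k, 'b, 'l) module_scheme"
  assumes field: "field R" and two: "\<one> \<oplus> \<one> \<noteq> \<zero>" and nondeg: "nondegenerate B"
    and u: "u \<in> carrier B" "u \<otimes>\<^bsub>B\<^esub> u = \<mu> \<odot>\<^bsub>B\<^esub> \<one>\<^bsub>B\<^esub>" "\<mu> \<in> carrier R" "\<mu> \<noteq> \<zero>"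
    and w: "w \<in> carrier B" "w \<otimes>\<^bsub>B\<^esub> w = \<nu> \<odot>\<^bsub>B\<^esub> \<one>\<^bsub>B\<^esub>" "\<nu> \<in> carrier R" "\<nu> \<noteq> \<zero>"
    and anti: "w \<otimes>\<^bsub>B\<^esub> u = \<ominus>\<^bsub>B\<^esub> (u \<otimes>\<^bsub>B\<^esub> w)"
    and A: "unital_algebra R A" "carrier A \<noteq> {\<zero>\<^bsub>A\<^esub>}" and h: "h \<in> alg_hom R B A"
  shows "inj_on h (carrier B)"
proof (rule alg_hom_injI[OF unital_algebra_axioms A(1) h])
  interpret A: unital_algebra R A by (rule A(1))
  interpret R: field R by (rule field)
  note scalar_zero = A.scalar_eq_zero_field[OF field A(2)]
  note hD = alg_homD[OF h]
  have scalar_eq: "\<alpha> = \<beta>" if "\<alpha> \<odot>\<^bsub>A\<^esub> \<one>\<^bsub>A\<^esub> = \<beta> \<odot>\<^bsub>A\<^esub> \<one>\<^bsub>A\<^esub>" "\<alpha> \<in> carrier R" "\<beta> \<in> carrier R" for \<alpha> \<beta>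
  proof -
    have "(\<alpha> \<ominus> \<beta>) \<odot>\<^bsub>A\<^esub> \<one>\<^bsub>A\<^esub> = \<zero>\<^bsub>A\<^esub>"
      using that by (simp add: R.minus_eq A.smult_l_distr A.smult_l_minus A.M.r_neg)
    then have "\<alpha> \<ominus> \<beta> = \<zero>" using scalar_zero that by simp
    moreover have "\<alpha> = (\<alpha> \<ominus> \<beta>) \<oplus> \<beta>" using that(2,3) by algebra
    ultimately show ?thesis using that by simp
  qed
  fix x assume x: "x \<in> carrier B" "h x = \<zero>\<^bsub>A\<^esub>"
  obtain \<tau> where t: "\<tau> \<in> carrier R" "x \<oplus>\<^bsub>B\<^esub> star B x = \<tau> \<odot>\<^bsub>B\<^esub> \<one>\<^bsub>B\<^esub>"
    using trace_scalar[OF x(1)] by blast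
  have hstar: "h (star B x) = \<tau> \<odot>\<^bsub>A\<^esub> \<one>\<^bsub>A\<^esub>"
  proof -
    have "h (x \<oplus>\<^bsub>B\<^esub> star B x) = h (star B x)" using x hD(1)[of "star B x"] by (simp add: hD(2))
    then show ?thesis using t by (simp add: hD(4,5))
  qed
  have bilinear: "\<exists>\<kappa>\<in>carrier R. x \<otimes>\<^bsub>B\<^esub> star B y \<oplus>\<^bsub>B\<^esub> y \<otimes>\<^bsub>B\<^esub> star B x = \<kappa> \<odot>\<^bsub>B\<^esub> \<one>\<^bsub>B\<^esub>
      \<and> \<tau> \<odot>\<^bsub>A\<^esub> h y = \<kappa> \<odot>\<^bsub>A\<^esub> \<one>\<^bsub>A\<^esub>" if y: "y \<in> carrier B" for y
  proof -
    obtain \<kappa> where k: "\<kappa> \<in> carrier R" "x \<otimes>\<^bsub>B\<^esub> star B y \<oplus>\<^bsub>B\<^esub> y \<otimes>\<^bsub>B\<^esub> star B x = \<kappa> \<odot>\<^bsub>B\<^esub> \<one>\<^bsub>B\<^esub>"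
      using trace_scalar[of "x \<otimes>\<^bsub>B\<^esub> star B y"] x y by (auto simp: star_mult)
    have "\<kappa> \<odot>\<^bsub>A\<^esub> \<one>\<^bsub>A\<^esub> = h (x \<otimes>\<^bsub>B\<^esub> star B y \<oplus>\<^bsub>B\<^esub> y \<otimes>\<^bsub>B\<^esub> star B x)"
      using k by (simp add: hD(4,5))
    also have "\<dots> = \<tau> \<odot>\<^bsub>A\<^esub> h y"
      using x y t hD(1)[of y] hD(1)[of "star B y"] by (simp add: hD(2,3) hstar A.mult_smult_right)
    finally show ?thesis using k by auto
  qed
  show "x = \<zero>\<^bsub>B\<^esub>"
  proof (cases "\<tau> = \<zero>")
    case True
    have "x \<otimes>\<^bsub>B\<^esub> star B y \<oplus>\<^bsub>B\<^esub> y \<otimes>\<^bsub>B\<^esub> star B x = \<zero>\<^bsub>B\<^esub>" if y: "y \<in> carrier B" for y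
    proof -
      obtain \<kappa> where k: "\<kappa> \<in> carrier R" "x \<otimes>\<^bsub>B\<^esub> star B y \<oplus>\<^bsub>B\<^esub> y \<otimes>\<^bsub>B\<^esub> star B x = \<kappa> \<odot>\<^bsub>B\<^esub> \<one>\<^bsub>B\<^esub>"
          "\<tau> \<odot>\<^bsub>A\<^esub> h y = \<kappa> \<odot>\<^bsub>A\<^esub> \<one>\<^bsub>A\<^esub>" using bilinear[OF y] by blast
      then have "\<kappa> \<odot>\<^bsub>A\<^esub> \<one>\<^bsub>A\<^esub> = \<zero>\<^bsub>A\<^esub>" using True hD(1)[OF y] by simp
      then have "\<kappa> = \<zero>" by (rule scalar_zero[OF k(1)])
      then show ?thesis using k(2) by simp
    qed
    then show ?thesis using nondeg x(1) by (simp add: nondegenerate_def)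
  next
    case False
    have scalar: "\<exists>\<sigma>\<in>carrier R. h y = \<sigma> \<odot>\<^bsub>A\<^esub> \<one>\<^bsub>A\<^esub>" if y: "y \<in> carrier B" for y
    proof -
      have T: "\<tau> \<in> Units R" using False t R.field_Units by simp
      obtain \<kappa> where k: "\<kappa> \<in> carrier R" "\<tau> \<odot>\<^bsub>A\<^esub> h y = \<kappa> \<odot>\<^bsub>A\<^esub> \<one>\<^bsub>A\<^esub>" using bilinear[OF y] by blast
      have "h y = inv \<tau> \<odot>\<^bsub>A\<^esub> (\<tau> \<odot>\<^bsub>A\<^esub> h y)"
        using T t hD(1)[OF y] by (simp flip: A.smult_assoc1)
      also have "\<dots> = (inv \<tau> \<otimes> \<kappa>) \<odot>\<^bsub>A\<^esub> \<one>\<^bsub>A\<^esub>"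
        using T k by (simp add: A.smult_assoc1)
      finally show ?thesis using T k by blast
    qed
    obtain \<sigma> where s: "\<sigma> \<in> carrier R" "h u = \<sigma> \<odot>\<^bsub>A\<^esub> \<one>\<^bsub>A\<^esub>" using scalar[OF u(1)] by blast
    obtain \<rho> where r: "\<rho> \<in> carrier R" "h w = \<rho> \<odot>\<^bsub>A\<^esub> \<one>\<^bsub>A\<^esub>" using scalar[OF w(1)] by blast
    \<comment> \<open>Scalars \<open>\<sigma>\<close>, \<open>\<rho>\<close> with nonzero squares and \<open>\<rho>\<sigma> = -\<rho>\<sigma>\<close> contradict \<open>2 \<noteq> 0\<close>.\<close>
    have "(\<sigma> \<otimes> \<sigma>) \<odot>\<^bsub>A\<^esub> \<one>\<^bsub>A\<^esub> = h (u \<otimes>\<^bsub>B\<^esub> u)"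
      unfolding hD(3)[OF u(1) u(1)] using s by (simp add: A.smult_assoc1 A.mult_smult_left)
    also have "\<dots> = \<mu> \<odot>\<^bsub>A\<^esub> \<one>\<^bsub>A\<^esub>" unfolding u(2) using u by (simp add: hD(4,5))
    finally have ss: "\<sigma> \<otimes> \<sigma> = \<mu>" by (rule scalar_eq) (use s u in auto)
    have "(\<rho> \<otimes> \<rho>) \<odot>\<^bsub>A\<^esub> \<one>\<^bsub>A\<^esub> = h (w \<otimes>\<^bsub>B\<^esub> w)"
      unfolding hD(3)[OF w(1) w(1)] using r by (simp add: A.smult_assoc1 A.mult_smult_left)
    also have "\<dots> = \<nu> \<odot>\<^bsub>A\<^esub> \<one>\<^bsub>A\<^esub>" unfolding w(2) using w by (simp add: hD(4,5))
    finally have rr: "\<rho> \<otimes> \<rho> = \<nu>" by (rule scalar_eq) (use r w in auto)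
    have "(\<rho> \<otimes> \<sigma>) \<odot>\<^bsub>A\<^esub> \<one>\<^bsub>A\<^esub> = h (w \<otimes>\<^bsub>B\<^esub> u)"
      unfolding hD(3)[OF w(1) u(1)] using s r by (simp add: A.smult_assoc1 A.mult_smult_left)
    also have "\<dots> = \<ominus>\<^bsub>A\<^esub> (h u \<otimes>\<^bsub>A\<^esub> h w)"
      unfolding anti using u w by (simp add: alg_hom_minus[OF unital_algebra_axioms A(1) h] hD(3))
    also have "\<dots> = (\<ominus> (\<rho> \<otimes> \<sigma>)) \<odot>\<^bsub>A\<^esub> \<one>\<^bsub>A\<^esub>"
      using s r by (simp add: A.smult_assoc1 A.smult_l_minus A.mult_smult_left A.smult_lcomm)
    finally have "\<rho> \<otimes> \<sigma> = \<ominus> (\<rho> \<otimes> \<sigma>)" by (rule scalar_eq) (use s r in auto)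
    then have "(\<one> \<oplus> \<one>) \<otimes> (\<rho> \<otimes> \<sigma>) = \<zero>"
      using s r by (metis R.l_distr R.l_one R.m_closed R.one_closed R.r_neg)
    then have "\<rho> = \<zero> \<or> \<sigma> = \<zero>"
      using two s r by (metis R.integral R.add.m_closed R.m_closed R.one_closed)
    then show ?thesis using ss rr u w s r by auto
  qed
qed

lemma alg_iso_sym:
  assumes A: "unital_algebra R A" and h: "h \<in> alg_iso R A B"
  shows "inv_into (carrier A) h \<in> alg_iso R B A"
proof -
  interpret A: unital_algebra R A by fact
  let ?g = "inv_into (carrier A) h"
  have hom: "h \<in> alg_hom R A B" and bij: "bij_betw h (carrier A) (carrier B)"
    using h by (simp_all add: alg_iso_def)
  note hD = alg_homD[OF hom]
  have gh: "?g (h x) = x" if "x \<in> carrier A" for x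
    using bij_betw_inv_into_left[OF bij that] .
  have rep: "\<exists>x\<in>carrier A. y = h x" if "y \<in> carrier B" for y
    using that bij_betw_imp_surj_on[OF bij] by blast
  have "?g \<in> alg_hom R B A"
  proof (rule alg_homI)
    show "?g \<one>\<^bsub>B\<^esub> = \<one>\<^bsub>A\<^esub>" using gh[OF A.one_closed] hD(5) by simp
    fix y assume "y \<in> carrier B"
    then obtain x where x: "x \<in> carrier A" "y = h x" using rep by blast
    show "?g y \<in> carrier A" using x gh by simp
    show "?g (\<alpha> \<odot>\<^bsub>B\<^esub> y) = \<alpha> \<odot>\<^bsub>A\<^esub> ?g y" if "\<alpha> \<in> carrier R" for \<alpha>
      using x that by (simp add: gh hD(4)[symmetric])
    fix z assume "z \<in> carrier B"
    then obtain w where w: "w \<in> carrier A" "z = h w" using rep by blast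
    show "?g (y \<oplus>\<^bsub>B\<^esub> z) = ?g y \<oplus>\<^bsub>A\<^esub> ?g z" "?g (y \<otimes>\<^bsub>B\<^esub> z) = ?g y \<otimes>\<^bsub>A\<^esub> ?g z"
      using x w by (simp_all add: gh hD(2,3)[symmetric])
  qed
  then show ?thesis using bij_betw_inv_into[OF bij] by (simp add: alg_iso_def)
qed

text \<open>The form is \<open>2xy\<close>.\<close>

lemma (in cring) scalar_alg_nondegenerate:
  assumes two: "\<one> \<oplus> \<one> \<in> Units R"
  shows "nondegenerate (scalar_alg R)"
  unfolding nondegenerate_def
proof (intro ballI impI)
  fix x assume "x \<in> carrier (scalar_alg R)"
    and orth: "\<forall>y\<in>carrier (scalar_alg R). x \<otimes>\<^bsub>scalar_alg R\<^esub> star (scalar_alg R) y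
      \<oplus>\<^bsub>scalar_alg R\<^esub> y \<otimes>\<^bsub>scalar_alg R\<^esub> star (scalar_alg R) x = \<zero>\<^bsub>scalar_alg R\<^esub>"
  then have x: "x \<in> carrier R" by simp
  have "(\<one> \<oplus> \<one>) \<otimes> x = \<zero>" using bspec[OF orth, of \<one>] x by (simp add: l_distr)
  then have "inv (\<one> \<oplus> \<one>) \<otimes> ((\<one> \<oplus> \<one>) \<otimes> x) = \<zero>" using two by simp
  then have "x = \<zero>" using x two by (simp add: m_assoc[symmetric])
  then show "x = \<zero>\<^bsub>scalar_alg R\<^esub>" by simp
qed

lemma cayley_dickson_smult_cancel:
  assumes "\<And>b. \<lbrakk>b \<in> carrier B; \<alpha> \<odot>\<^bsub>B\<^esub> b = \<zero>\<^bsub>B\<^esub>\<rbrakk> \<Longrightarrow> b = \<zero>\<^bsub>B\<^esub>"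
    and "x \<in> carrier (cayley_dickson B \<mu>)" "\<alpha> \<odot>\<^bsub>cayley_dickson B \<mu>\<^esub> x = \<zero>\<^bsub>cayley_dickson B \<mu>\<^esub>"
  shows "x = \<zero>\<^bsub>cayley_dickson B \<mu>\<^esub>"
  using assms by auto

theorem (in octonions) octonion_nondegenerate:
  assumes two: "\<one> \<oplus> \<one> \<in> Units R"
    and cancel: "cancellable R \<mu>1" "cancellable R \<mu>2" "cancellable R \<mu>3"
  shows "nondegenerate (octonion_alg R \<mu>1 \<mu>2 \<mu>3)"
proof -
  have Sc: "b = \<zero>\<^bsub>scalar_alg R\<^esub>"
    if "cancellable R \<alpha>" "b \<in> carrier (scalar_alg R)" "\<alpha> \<odot>\<^bsub>scalar_alg R\<^esub> b = \<zero>\<^bsub>scalar_alg R\<^esub>" for \<alpha> b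
    using that by (simp add: cancellable_def)
  have Bin: "b = \<zero>\<^bsub>binarion_alg R \<mu>1\<^esub>"
    if "cancellable R \<alpha>" "b \<in> carrier (binarion_alg R \<mu>1)"
      "\<alpha> \<odot>\<^bsub>binarion_alg R \<mu>1\<^esub> b = \<zero>\<^bsub>binarion_alg R \<mu>1\<^esub>" for \<alpha> b
    using cayley_dickson_smult_cancel[OF Sc[OF that(1)]] that(2,3) by (simp add: binarion_alg_def)
  have Quat: "b = \<zero>\<^bsub>quaternion_alg R \<mu>1 \<mu>2\<^esub>"
    if "cancellable R \<alpha>" "b \<in> carrier (quaternion_alg R \<mu>1 \<mu>2)"
      "\<alpha> \<odot>\<^bsub>quaternion_alg R \<mu>1 \<mu>2\<^esub> b = \<zero>\<^bsub>quaternion_alg R \<mu>1 \<mu>2\<^esub>" for \<alpha> b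
    using cayley_dickson_smult_cancel[OF Bin[OF that(1)]] that(2,3) by (simp add: quaternion_alg_def)
  have bin: "nondegenerate (binarion_alg R \<mu>1)"
    unfolding binarion_alg_def
    by (rule Sc.cayley_dickson_nondegenerate[OF mu1 Sc[OF cancel(1)] scalar_alg_nondegenerate[OF two]])
  have quat: "nondegenerate (quaternion_alg R \<mu>1 \<mu>2)"
    unfolding quaternion_alg_def
    by (rule Bin.cayley_dickson_nondegenerate[OF mu2 Bin[OF cancel(2)] bin])
  show ?thesis
    unfolding octonion_alg_def
    by (rule Quat.cayley_dickson_nondegenerate[OF mu3 Quat[OF cancel(3)] quat])
qed

text \<open>The homomorphism from the octonions is onto because its image contains the generators, and injective
because \<open>v\<^sub>1\<close> and \<open>v\<^sub>2\<close> anticommute and have nonzero squares.\<close>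

theorem (in octonions) generated_iso_octonion_field:
  fixes A :: "('k, 'a, 'n) module_scheme"
  assumes field: "field R" and two: "\<one> \<oplus> \<one> \<in> Units R"
    and cancel: "cancellable R \<mu>1" "cancellable R \<mu>2" "cancellable R \<mu>3"
    and A: "alternative_algebra R A" "carrier A \<noteq> {\<zero>\<^bsub>A\<^esub>}"
    and triple: "octonion_triple A \<mu>1 \<mu>2 \<mu>3 a" and gen: "alg_generated_by R A (range a)"
  shows "alg_isomorphic R A (octonion_alg R \<mu>1 \<mu>2 \<mu>3)"
proof -
  interpret A: alternative_algebra R A by (rule A(1))
  interpret R: field R by (rule field)
  let ?O = "octonion_alg R \<mu>1 \<mu>2 \<mu>3" and ?v = "oct_gen R \<mu>1 \<mu>2"
  obtain h where h: "h \<in> alg_hom R ?O A" "\<forall>i. h (?v i) = a i"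
    using A.octonion_lift[OF mu1 mu2 mu3 triple] by blast
  have nonzero: "\<mu> \<noteq> \<zero>" if "cancellable R \<mu>" for \<mu>
    using that R.one_not_zero unfolding cancellable_def by (metis l_null one_closed)
  have two': "\<one> \<oplus> \<one> \<noteq> \<zero>" using two R.field_Units by simp
  have v: "octonion_triple ?O \<mu>1 \<mu>2 \<mu>3 ?v" by (rule octonion_triple_oct_gen)
  have vc: "?v i \<in> carrier ?O" for i using v by (auto simp only: octonion_triple_iff)
  have sq: "?v T1 \<otimes>\<^bsub>?O\<^esub> ?v T1 = \<mu>1 \<odot>\<^bsub>?O\<^esub> \<one>\<^bsub>?O\<^esub>" "?v T2 \<otimes>\<^bsub>?O\<^esub> ?v T2 = \<mu>2 \<odot>\<^bsub>?O\<^esub> \<one>\<^bsub>?O\<^esub>"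
    and anti: "?v T2 \<otimes>\<^bsub>?O\<^esub> ?v T1 = \<ominus>\<^bsub>?O\<^esub> (?v T1 \<otimes>\<^bsub>?O\<^esub> ?v T2)"
    using v unfolding octonion_triple_iff by blast+
  have inj: "inj_on h (carrier ?O)"
    by (rule Oct.hom_inj_of_nondegenerate[OF field two' octonion_nondegenerate[OF two cancel]
          vc sq(1) mu1 nonzero[OF cancel(1)] vc sq(2) mu2 nonzero[OF cancel(2)] anti
          A.unital_algebra_axioms A(2) h(1)])
  have "range a \<subseteq> h ` carrier ?O"
  proof
    fix x assume "x \<in> range a"
    then obtain i where "x = h (?v i)" using h(2) by force
    then show "x \<in> h ` carrier ?O" using vc by simp
  qed
  then have "h ` carrier ?O = carrier A"
    by (rule alg_hom_surj_on_generators[OF Oct.unital_algebra_axioms A.unital_algebra_axioms h(1) gen])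
  then have "h \<in> alg_iso R ?O A" using h(1) inj by (simp add: alg_iso_def bij_betw_def)
  then show ?thesis
    using alg_iso_sym[OF Oct.unital_algebra_axioms] by (auto simp: alg_isomorphic_def)
qed

theorem theorem3p6:
  fixes \<Phi> :: "('k, 'm) ring_scheme" and \<mu>1 \<mu>2 \<mu>3 :: 'k
  defines "Oct \<equiv> octonion_alg \<Phi> \<mu>1 \<mu>2 \<mu>3"
    and "v \<equiv> oct_gen \<Phi> \<mu>1 \<mu>2"
    and "Rel \<equiv> free_cayley_rels \<Phi> \<union> free_square_rels \<Phi> \<mu>1 \<mu>2 \<mu>3"
  assumes "cring \<Phi>" and "\<one>\<^bsub>\<Phi>\<^esub> \<oplus>\<^bsub>\<Phi>\<^esub> \<one>\<^bsub>\<Phi>\<^esub> \<in> Units \<Phi>"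
    and "cancellable \<Phi> \<mu>1" and "cancellable \<Phi> \<mu>2" and "cancellable \<Phi> \<mu>3"
  shows
    "alg_isomorphic \<Phi> Oct (alg_quot (cayley_polys \<Phi>) (cayley_square_ideal \<Phi> \<mu>1 \<mu>2 \<mu>3))
     \<and> (\<exists>h \<in> alg_iso \<Phi> (presented_alg \<Phi> Rel) Oct. \<forall>i. h (presented_gen \<Phi> Rel i) = v i)
     \<and> (alternative_algebra \<Phi> Oct \<and> alg_generated_by \<Phi> Oct (range v)
        \<and> (\<forall>(l, r) \<in> cayley_rels Oct (v T1) (v T2) (v T3)
              \<union> square_rels Oct \<mu>1 \<mu>2 \<mu>3 (v T1) (v T2) (v T3). l = r)
        \<and> (\<forall>(A :: ('k, 'a, 'n) module_scheme) a.
             alternative_algebra \<Phi> A \<and> range a \<subseteq> carrier A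
             \<and> (\<forall>(l, r) \<in> cayley_rels A (a T1) (a T2) (a T3)
                   \<union> square_rels A \<mu>1 \<mu>2 \<mu>3 (a T1) (a T2) (a T3). l = r)
             \<longrightarrow> (\<exists>h \<in> alg_hom \<Phi> Oct A. (\<forall>i. h (v i) = a i)
                   \<and> (\<forall>g \<in> alg_hom \<Phi> Oct A. (\<forall>i. g (v i) = a i)
                        \<longrightarrow> (\<forall>x \<in> carrier Oct. g x = h x)))))
     \<and> (field \<Phi> \<longrightarrow>
        (\<forall>(A :: ('k, 'a, 'n) module_scheme) a1 a2 a3.
           alternative_algebra \<Phi> A \<and> carrier A \<noteq> {\<zero>\<^bsub>A\<^esub>}
           \<and> alg_generated_by \<Phi> A {a1, a2, a3}
           \<and> a1 \<otimes>\<^bsub>A\<^esub> a1 = \<mu>1 \<odot>\<^bsub>A\<^esub> \<one>\<^bsub>A\<^esub> \<and> a2 \<otimes>\<^bsub>A\<^esub> a2 = \<mu>2 \<odot>\<^bsub>A\<^esub> \<one>\<^bsub>A\<^esub> \<and> a3 \<otimes>\<^bsub>A\<^esub> a3 = \<mu>3 \<odot>\<^bsub>A\<^esub> \<one>\<^bsub>A\<^esub>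
           \<and> a1 \<otimes>\<^bsub>A\<^esub> a2 = \<ominus>\<^bsub>A\<^esub> (a2 \<otimes>\<^bsub>A\<^esub> a1) \<and> a1 \<otimes>\<^bsub>A\<^esub> a3 = \<ominus>\<^bsub>A\<^esub> (a3 \<otimes>\<^bsub>A\<^esub> a1)
           \<and> a2 \<otimes>\<^bsub>A\<^esub> a3 = \<ominus>\<^bsub>A\<^esub> (a3 \<otimes>\<^bsub>A\<^esub> a2)
           \<and> (a1 \<otimes>\<^bsub>A\<^esub> a2) \<otimes>\<^bsub>A\<^esub> a3 = \<ominus>\<^bsub>A\<^esub> (a1 \<otimes>\<^bsub>A\<^esub> (a2 \<otimes>\<^bsub>A\<^esub> a3))
           \<longrightarrow> alg_isomorphic \<Phi> A Oct))"
proof -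
  interpret octonions \<Phi> \<mu>1 \<mu>2 \<mu>3
    using assms(4,6-8) by (auto simp: octonions_def octonions_axioms_def cancellable_def)
  have triple: "octonion_triple Oct \<mu>1 \<mu>2 \<mu>3 v"
    unfolding Oct_def v_def by (rule octonion_triple_oct_gen)
  have gen: "alg_generated_by \<Phi> Oct (range v)"
    unfolding Oct_def v_def by (rule octonion_generated)
  have universal: "\<exists>h \<in> alg_hom \<Phi> Oct A. (\<forall>i. h (v i) = a i)
      \<and> (\<forall>g \<in> alg_hom \<Phi> Oct A. (\<forall>i. g (v i) = a i) \<longrightarrow> (\<forall>x \<in> carrier Oct. g x = h x))"
    if A: "alternative_algebra \<Phi> A" and a: "octonion_triple A \<mu>1 \<mu>2 \<mu>3 a"
    for A :: "('k, 'a, 'n) module_scheme" and a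
  proof -
    interpret A: alternative_algebra \<Phi> A by (rule A)
    obtain h where h: "h \<in> alg_hom \<Phi> Oct A" "\<forall>i. h (v i) = a i"
      using A.octonion_lift[OF mu1 mu2 mu3 a] unfolding Oct_def v_def by blast
    have "g x = h x" if g: "g \<in> alg_hom \<Phi> Oct A" "\<forall>i. g (v i) = a i" and x: "x \<in> carrier Oct" for g x
      by (rule alg_hom_eq_on_generators[OF Oct.unital_algebra_axioms[folded Oct_def]
            A.unital_algebra_axioms g(1) h(1) gen _ x]) (use g(2) h(2) in auto)
    then show ?thesis using h by blast
  qed
  have field: "alg_isomorphic \<Phi> A Oct"
    if "field \<Phi>" and A: "alternative_algebra \<Phi> A" "carrier A \<noteq> {\<zero>\<^bsub>A\<^esub>}"
      and genA: "alg_generated_by \<Phi> A {a1, a2, a3}"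
      and sq: "a1 \<otimes>\<^bsub>A\<^esub> a1 = \<mu>1 \<odot>\<^bsub>A\<^esub> \<one>\<^bsub>A\<^esub>" "a2 \<otimes>\<^bsub>A\<^esub> a2 = \<mu>2 \<odot>\<^bsub>A\<^esub> \<one>\<^bsub>A\<^esub>" "a3 \<otimes>\<^bsub>A\<^esub> a3 = \<mu>3 \<odot>\<^bsub>A\<^esub> \<one>\<^bsub>A\<^esub>"
      and anti: "a1 \<otimes>\<^bsub>A\<^esub> a2 = \<ominus>\<^bsub>A\<^esub> (a2 \<otimes>\<^bsub>A\<^esub> a1)" "a1 \<otimes>\<^bsub>A\<^esub> a3 = \<ominus>\<^bsub>A\<^esub> (a3 \<otimes>\<^bsub>A\<^esub> a1)"
        "a2 \<otimes>\<^bsub>A\<^esub> a3 = \<ominus>\<^bsub>A\<^esub> (a3 \<otimes>\<^bsub>A\<^esub> a2)"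
      and antiassoc: "(a1 \<otimes>\<^bsub>A\<^esub> a2) \<otimes>\<^bsub>A\<^esub> a3 = \<ominus>\<^bsub>A\<^esub> (a1 \<otimes>\<^bsub>A\<^esub> (a2 \<otimes>\<^bsub>A\<^esub> a3))"
    for A :: "('k, 'a, 'n) module_scheme" and a1 a2 a3
  proof -
    interpret A: alternative_algebra \<Phi> A by (rule A(1))
    define a where "a i = (case i of T1 \<Rightarrow> a1 | T2 \<Rightarrow> a2 | T3 \<Rightarrow> a3)" for i
    have a: "a T1 = a1" "a T2 = a2" "a T3 = a3" by (simp_all add: a_def)
    have range: "range a = {a1, a2, a3}"
      using a by (auto simp: image_iff a_def split: gen3.split)
    have "{a1, a2, a3} \<subseteq> carrier A" using genA by (simp add: alg_generated_by_iff)
    then have "octonion_triple A \<mu>1 \<mu>2 \<mu>3 a"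
      unfolding octonion_triple_iff a range using sq antiassoc by (simp add: anti)
    then show ?thesis
      unfolding Oct_def
      using generated_iso_octonion_field[OF \<open>field \<Phi>\<close> assms(5-8) A] genA by (simp add: range)
  qed
  show ?thesis
  proof (intro conjI impI allI)
    show "alg_isomorphic \<Phi> Oct (alg_quot (cayley_polys \<Phi>) (cayley_square_ideal \<Phi> \<mu>1 \<mu>2 \<mu>3))"
      unfolding Oct_def by (rule octonion_quotient_of_cayley_polys)
    show "\<exists>h \<in> alg_iso \<Phi> (presented_alg \<Phi> Rel) Oct. \<forall>i. h (presented_gen \<Phi> Rel i) = v i"
      unfolding Oct_def v_def Rel_def by (rule octonion_presentation)
    show "alternative_algebra \<Phi> Oct"
      unfolding Oct_def by (rule octonion_alternative)
    show "alg_generated_by \<Phi> Oct (range v)" by (rule gen)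
    show "\<forall>(l, r) \<in> cayley_rels Oct (v T1) (v T2) (v T3)
        \<union> square_rels Oct \<mu>1 \<mu>2 \<mu>3 (v T1) (v T2) (v T3). l = r"
      using triple unfolding octonion_triple_def by (rule conjunct2)
  qed (elim conjE, (rule universal, assumption, unfold octonion_triple_def, intro conjI; assumption)
        | (elim conjE, rule field; assumption))+
qed

end
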